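(* As $x\to\infty$ through odd integers, $$\sum_{i=1}^{(x+1)/2} l(2i-1)=\frac{x^2}{4\ln^2 x}+O\!\left(\frac{x^2\ln\ln x}{\ln^3 x}\right).$$
   Context: For an odd positive integer $n$, $l(n)$ denotes the number of Lemoine–Levy partitions of $n$, i.e. the number of pairs $(p,q)$ of primes such that $n=p+2q$. *)

theory Defs
  imports "HOL-Analysis.Analysis" "HOL-Computational_Algebra.Primes"
begin

definition lemoine_levy :: "nat \<Rightarrow> nat" where
  "lemoine_levy n = card {(p::nat, q::nat). prime p \<and> prime q \<and> n = p + 2 * q}"

end

theory Submission
  imports Defs "HOL-Complex_Analysis.Complex_Analysis" "HOL-Number_Theory.Prime_Powers"
    "HOL-Probability.Probability" "HOL-Real_Asymp.Real_Asymp"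
begin

text \<open>
  Counting pairs \<open>(p, q)\<close> with \<open>p + 2 q \<le> x\<close> gives a sum of \<open>\<pi>(x - 2 q)\<close> over primes \<open>q \<le> x / 2\<close>, so the
  claim follows from \<open>\<pi>(y) = y / ln x + O(x ln ln x / ln\<^sup>2 x)\<close>, uniformly in \<open>y \<le> x\<close>, applied twice.
  This needs the prime number theorem with an error term \<open>O(x / ln\<^sup>2 x)\<close>, which is obtained without
  contour integration. Let \<open>F(s) = \<Sum> (\<Lambda>(n) - 1) n\<^bsup>-s\<^esup> = - \<zeta>'/\<zeta> - \<zeta>\<close>.
  The inequality \<open>3 + 4 cos \<theta> + cos 2\<theta> \<ge> 0\<close> gives
  \<open>\<bar>\<zeta>(\<sigma> + it)\<bar> \<ge> c \<bar>t\<bar>\<^bsup>-\<epsilon>\<^esup>\<close> for \<open>\<sigma> > 1\<close>, hence \<open>F\<close> continues to a disc of radius \<open>c' \<bar>t\<bar>\<^bsup>-\<epsilon>\<^esup>\<close> around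
  such a point, and Cauchy's inequality bounds \<open>F'''(\<sigma> + it)\<close> by a multiple of \<open>2 + \<bar>t\<bar>\<close>, uniformly in \<open>\<sigma> > 1\<close>.
  Since the Gaussian is its own Fourier transform, the averages
  \<open>\<Sum> (\<Lambda>(n) - 1) ln\<^sup>3 n n\<^bsup>-\<sigma>\<^esup> exp (- T\<^sup>2 ln\<^sup>2 (y / n) / 2)\<close> are then \<open>O(T)\<close>. Integrating them over \<open>y < x\<close>
  yields a smoothed cut-off at \<open>x\<close>, which differs from the sharp one by no more than a Gaussian window
  around \<open>x\<close>. With \<open>T = ln x\<close> and \<open>\<sigma> = 1 + 1 / ln x\<close> this gives
  \<open>\<Sum>\<^bsub>n \<le> x\<^esub> (\<Lambda>(n) - 1) ln\<^sup>3 n = O(x ln\<^sup>2 x)\<close>, and the logarithms are removed by partial summation.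
\<close>

subsection \<open>Dirichlet series\<close>

text \<open>Why the weight is the cube of ln. Write L = ln x and let ln n occur to the power k. A
  linear bound for the k-th derivative makes every average O(T), and undoing the smoothing costs
  another factor T, so T^2 in all. The window around x needs absolute values;
  \<open>\<bar>\<Lambda> - 1\<bar> \<le> \<Lambda> + 1\<close> brings the pole at 1 back, which
  after k derivatives and a Gaussian mean contributes 1 / ((\<sigma> - 1)^k T) = L^k / T. Since the
  trivial size is L^k, the savings are L^k / T^2 and T. The error O(x / ln^2 x) for \<pi> amounts to
  a saving of L: this needs T at least of order L and then k at least 3, and for k = 3 and T = L
  both parts are L^2.

  Staying at \<sigma> = 1 + 1 / L keeps all series absolutely convergent, so the averaging takes no
  limit to the line of real part 1, while x^\<sigma> is only e x. A sharper \<pi> would be wasted in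
  this argument: replacing ln y by ln x already costs x ln ln x / ln^2 x.\<close>

definition dser :: "(nat \<Rightarrow> real) \<Rightarrow> complex \<Rightarrow> complex" where
  "dser a s = (\<Sum>n. of_real (a n) * of_nat n powr (-s))"

text \<open>Series run over all naturals. The index 0 contributes nothing, whatever
  \<open>a 0\<close> is, since \<open>0 powr z = 0\<close>.\<close>

definition absconv :: "(nat \<Rightarrow> real) \<Rightarrow> bool" where
  "absconv a \<longleftrightarrow> (\<forall>\<sigma>>1. summable (\<lambda>n. \<bar>a n\<bar> * real n powr (-\<sigma>)))"

lemma norm_of_nat_powr: "norm (of_nat n powr s :: complex) = real n powr Re s"
  by (metis Re_complex_of_real norm_powr_real_powr of_nat_0_le_iff of_real_of_nat_eq Reals_of_nat)

lemma absconvD: "absconv a \<Longrightarrow> \<sigma> > 1 \<Longrightarrow> summable (\<lambda>n. \<bar>a n\<bar> * real n powr (-\<sigma>))"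
  by (auto simp: absconv_def)

lemma absconv_summable_norm:
  assumes "absconv a" "Re s > 1"
  shows "summable (\<lambda>n. norm (of_real (a n) * of_nat n powr (-s) :: complex))"
  using absconvD[OF assms] by (simp add: norm_mult norm_of_nat_powr)

lemma absconv_sums:
  assumes "absconv a" "Re s > 1"
  shows "(\<lambda>n. of_real (a n) * of_nat n powr (-s)) sums dser a s"
  using summable_norm_cancel[OF absconv_summable_norm[OF assms]] 
  unfolding dser_def by (rule summable_sums)

lemma absconv_mono:
  assumes "absconv b" "\<And>n. n > 0 \<Longrightarrow> \<bar>a n\<bar> \<le> \<bar>b n\<bar>"
  shows "absconv a"
  unfolding absconv_def
proof (intro allI impI)
  fix \<sigma> :: real assume "\<sigma> > 1"
  show "summable (\<lambda>n. \<bar>a n\<bar> * real n powr - \<sigma>)"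
    apply (rule summable_comparison_test'[OF absconvD[OF assms(1) \<open>\<sigma> > 1\<close>], of 1])
    using assms(2) by (auto intro!: mult_right_mono)
qed

lemma absconv_add:
  assumes "absconv a" "absconv b"
  shows "absconv (\<lambda>n. a n + b n)"
  unfolding absconv_def
proof (intro allI impI)
  fix \<sigma> :: real assume \<sigma>: "\<sigma> > 1"
  show "summable (\<lambda>n. \<bar>a n + b n\<bar> * real n powr - \<sigma>)"
    apply (rule summable_comparison_test'[OF summable_add[OF absconvD[OF assms(1) \<sigma>] absconvD[OF assms(2) \<sigma>]], of 0])
    by (auto simp: distrib_right[symmetric] intro!: mult_right_mono)
qed

lemma absconv_uminus: "absconv a \<Longrightarrow> absconv (\<lambda>n. - a n)"
  by (simp add: absconv_def)

lemma absconv_diff: "absconv a \<Longrightarrow> absconv b \<Longrightarrow> absconv (\<lambda>n. a n - b n)"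
  using absconv_add[OF _ absconv_uminus, of a b] by simp

lemma absconv_one: "absconv (\<lambda>_. 1)"
  unfolding absconv_def by (auto simp: summable_real_powr_iff)

text \<open>Since ln n is at most n^d / d, the logarithm only shifts \<sigma> by d, and half of the
  room \<sigma> - 1 is spent on this.\<close>

lemma absconv_ln:
  assumes "absconv a"
  shows "absconv (\<lambda>n. ln (real n) * a n)"
  unfolding absconv_def
proof (intro allI impI)
  fix \<sigma> :: real assume \<sigma>: "\<sigma> > 1"
  define d where "d = (\<sigma> - 1) / 2"
  have d: "d > 0" "\<sigma> - d > 1" using \<sigma> by (auto simp: d_def field_simps)
  show "summable (\<lambda>n. \<bar>ln (real n) * a n\<bar> * real n powr - \<sigma>)"
  proof (rule summable_comparison_test'[OF summable_mult[OF absconvD[OF assms d(2)], of "1/d"], of 1])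
    fix n :: nat assume n: "n \<ge> 1"
    have "ln (real n) \<le> real n powr d / d" using n d by (intro ln_powr_bound) auto
    hence "\<bar>ln (real n)\<bar> \<le> real n powr d / d" using n by simp
    hence "\<bar>ln (real n)\<bar> * (\<bar>a n\<bar> * real n powr -\<sigma>) \<le> (real n powr d / d) * (\<bar>a n\<bar> * real n powr -\<sigma>)"
      by (intro mult_right_mono) auto
    also have "\<dots> = 1 / d * (\<bar>a n\<bar> * real n powr - (\<sigma> - d))"
      using n by (simp add: powr_add[symmetric])
    finally show "norm (\<bar>ln (real n) * a n\<bar> * real n powr - \<sigma>) \<le> 1 / d * (\<bar>a n\<bar> * real n powr - (\<sigma> - d))"
      by (simp add: abs_mult mult.assoc)
  qed
qed

lemma mangoldt_le_ln: "n > 0 \<Longrightarrow> mangoldt n \<le> ln (real n)"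
proof -
  assume n: "n > 0"
  have "mangoldt n \<le> (\<Sum>d | d dvd n. mangoldt d :: real)"
    using n by (intro member_le_sum) (auto simp: mangoldt_nonneg)
  thus ?thesis using n by (simp add: mangoldt_sum)
qed

lemma absconv_mangoldt: "absconv mangoldt"
  by (rule absconv_mono[OF absconv_ln[OF absconv_one]])
     (auto simp: mangoldt_nonneg mangoldt_le_ln)

lemma dser_add:
  assumes "absconv a" "absconv b" "Re s > 1"
  shows "dser (\<lambda>n. a n + b n) s = dser a s + dser b s"
  using sums_add[OF absconv_sums[OF assms(1,3)] absconv_sums[OF assms(2,3)]]
        absconv_sums[OF absconv_add[OF assms(1,2)] assms(3)]
  by (simp add: distrib_right sums_iff)

lemma dser_uminus: "absconv a \<Longrightarrow> Re s > 1 \<Longrightarrow> dser (\<lambda>n. - a n) s = - dser a s"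
  using sums_minus[OF absconv_sums[of a s]]
        absconv_sums[OF absconv_uminus[of a], of s]
  by (simp add: sums_iff)

lemma dser_diff:
  assumes "absconv a" "absconv b" "Re s > 1"
  shows "dser (\<lambda>n. a n - b n) s = dser a s - dser b s"
  using dser_add[OF assms(1) absconv_uminus[OF assms(2)] assms(3)] dser_uminus[OF assms(2,3)] by simp

lemma open_halfplane: "open {s. Re s > c}"
  by (simp add: open_halfspace_Re_gt)

text \<open>Termwise differentiation. On a ball of half the distance to the line of real part 1, all
  terms are dominated by those of a real point that still lies beyond 1.\<close>

lemma has_field_derivative_dser:
  assumes "absconv a" "Re s > 1"
  shows "(dser a has_field_derivative dser (\<lambda>n. - (ln (real n) * a n)) s) (at s)"
proof -
  define f where "f = (\<lambda>n s. complex_of_real (a n) * of_nat n powr (-s))"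
  define f' where "f' = (\<lambda>n s. complex_of_real (- (ln (real n) * a n)) * of_nat n powr (-s))"
  define S where "S = {s. Re s > 1}"
  have "\<exists>g g'. \<forall>x\<in>S. ((\<lambda>n. f n x) sums g x) \<and> ((\<lambda>n. f' n x) sums g' x) \<and> (g has_field_derivative g' x) (at x)"
  proof (rule series_and_derivative_comparison_local)
    show "open S" by (simp add: S_def open_halfplane)
    show "(f n has_field_derivative f' n x) (at x)" for n x
    proof (cases "n = 0")
      case False
      hence "((\<lambda>s. exp (- s * of_real (ln (real n)))) has_field_derivative
               exp (- x * of_real (ln (real n))) * (- of_real (ln (real n)))) (at x)"
        by (auto intro!: derivative_eq_intros)
      hence "((\<lambda>s. of_nat n powr (-s)) has_field_derivative
               - (of_real (ln (real n)) * of_nat n powr (-x))) (at x)"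
        using False by (simp add: powr_def Ln_of_nat mult_ac)
      from DERIV_cmult[OF this, of "of_real (a n)"] show ?thesis
        by (simp add: f_def f'_def mult_ac)
    qed (simp add: f_def f'_def)
    fix x assume x: "x \<in> S"
    define d where "d = (Re x - 1) / 2"
    have d: "d > 0" "Re x - d > 1" using x by (auto simp: S_def d_def field_simps)
    show "\<exists>d h. 0 < d \<and> summable h \<and> (\<forall>\<^sub>F n in sequentially. \<forall>y\<in>ball x d \<inter> S. norm (f n y) \<le> h n)"
    proof (intro exI conjI eventually_sequentiallyI ballI)
      show "0 < d" by fact
      show "summable (\<lambda>n. \<bar>a n\<bar> * real n powr (-(Re x - d)))" by (rule absconvD[OF assms(1) d(2)])
      fix n :: nat and y assume n: "n \<ge> 1" and y: "y \<in> ball x d \<inter> S"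
      have "\<bar>Re x - Re y\<bar> \<le> norm (x - y)" by (metis abs_Re_le_cmod minus_complex.simps(1))
      hence "Re y \<ge> Re x - d" using y by (auto simp: dist_norm)
      thus "norm (f n y) \<le> \<bar>a n\<bar> * real n powr (-(Re x - d))"
        using n by (auto simp: f_def norm_mult norm_of_nat_powr intro!: mult_left_mono powr_mono)
    qed
  qed
  then obtain g g' where g: "\<And>x. x \<in> S \<Longrightarrow> (\<lambda>n. f n x) sums g x" "\<And>x. x \<in> S \<Longrightarrow> (\<lambda>n. f' n x) sums g' x"
     "\<And>x. x \<in> S \<Longrightarrow> (g has_field_derivative g' x) (at x)" by blast
  have s: "s \<in> S" using assms by (simp add: S_def)
  have "g' s = dser (\<lambda>n. - (ln (real n) * a n)) s"
    using g(2)[OF s] by (simp add: dser_def f'_def sums_iff)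
  moreover have "(dser a has_field_derivative g' s) (at s)"
    using g(3)[OF s]
  proof (rule has_field_derivative_transform_within_open[of _ _ _ S])
    show "open S" by (simp add: S_def open_halfplane)
    show "g x = dser a x" if "x \<in> S" for x
      using g(1)[OF that] by (simp add: dser_def f_def sums_iff)
  qed fact
  ultimately show ?thesis by simp
qed

lemma absconv_ln_power: "absconv a \<Longrightarrow> absconv (\<lambda>n. ln (real n) ^ k * a n)"
  by (induction k) (auto simp: mult.assoc dest: absconv_ln)

lemma higher_deriv_dser:
  assumes "absconv a" "Re s > 1"
  shows "(deriv ^^ k) (dser a) s = (-1) ^ k * dser (\<lambda>n. ln (real n) ^ k * a n) s"
  using assms(2)
proof (induction k arbitrary: s)
  case (Suc k)
  have ev: "eventually (\<lambda>s. (deriv ^^ k) (dser a) s = (-1) ^ k * dser (\<lambda>n. ln (real n) ^ k * a n) s) (nhds s)"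
    using Suc by (intro eventually_nhds_in_open[OF open_halfplane[of 1], THEN eventually_mono]) auto
  have "(deriv ^^ Suc k) (dser a) s = deriv (\<lambda>s. (-1) ^ k * dser (\<lambda>n. ln (real n) ^ k * a n) s) s"
    using deriv_cong_ev[OF ev refl] by simp
  also have "\<dots> = (-1) ^ k * dser (\<lambda>n. - (ln (real n) * (ln (real n) ^ k * a n))) s"
    by (intro DERIV_imp_deriv DERIV_cmult has_field_derivative_dser absconv_ln_power assms Suc.prems)
  also have "\<dots> = (-1) ^ Suc k * dser (\<lambda>n. ln (real n) ^ Suc k * a n) s"
    using dser_uminus[OF absconv_ln_power[OF assms(1)] Suc.prems, of "Suc k"] by (simp add: mult.assoc)
  finally show ?case .
qed auto

lemma holomorphic_dser: "absconv a \<Longrightarrow> dser a holomorphic_on {s. Re s > 1}"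
  using has_field_derivative_dser
  by (auto simp: holomorphic_on_open[OF open_halfplane])

subsection \<open>The zeta function in the half-plane of absolute convergence\<close>

text \<open>The divisor sum of \<Lambda> is ln, carried over to series: the absolutely convergent
  double series over (d, m) is regrouped by the product n = d m.\<close>

lemma dser_mult_mangoldt:
  assumes "Re s > 1"
  shows "dser (\<lambda>_. 1) s * dser mangoldt s = dser (\<lambda>n. ln (real n)) s"
proof -
  define A where "A = {n::nat. n > 0}"
  define z where "z = (\<lambda>n. complex_of_real (mangoldt n) * of_nat n powr (-s))"
  define w where "w = (\<lambda>n. complex_of_real 1 * of_nat n powr (-s))"
  have sum_z: "(z has_sum dser mangoldt s) UNIV" and "(\<lambda>x. norm (z x)) summable_on UNIV"
    unfolding z_def
    using norm_summable_imp_has_sum[OF absconv_summable_norm[OF absconv_mangoldt assms] absconv_sums[OF absconv_mangoldt assms]]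
       absconv_summable_norm[OF absconv_mangoldt assms] by (auto intro!: norm_summable_imp_summable_on)
  moreover have sum_w: "(w has_sum dser (\<lambda>_. 1) s) UNIV" and "(\<lambda>x. norm (w x)) summable_on UNIV"
    unfolding w_def
    using norm_summable_imp_has_sum[OF absconv_summable_norm[OF absconv_one assms] absconv_sums[OF absconv_one assms]]
       absconv_summable_norm[OF absconv_one assms] by (auto intro!: norm_summable_imp_summable_on)
  ultimately have abs_z: "(\<lambda>x. norm (z x)) summable_on A" and abs_w: "(\<lambda>x. norm (w x)) summable_on A"
    by (auto intro: summable_on_subset_banach)
  \<comment> \<open>The index 0 has to go before regrouping, because every d divides 0 and the inner
    sum would be infinite there.\<close>
  have sum_z: "(z has_sum dser mangoldt s) A"
    using sum_z by (subst has_sum_cong_neutral[where T = UNIV and g = z]) (auto simp: A_def z_def)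
  have sum_w: "(w has_sum dser (\<lambda>_. 1) s) A"
    using sum_w by (subst has_sum_cong_neutral[where T = UNIV and g = w]) (auto simp: A_def w_def)
  define f where "f = (\<lambda>(d, m). z d * w m)"
  have "(f has_sum (dser mangoldt s * dser (\<lambda>_. 1) s)) (A \<times> A)"
  proof (rule has_sum_SigmaI)
    show "((\<lambda>y. f (x, y)) has_sum z x * dser (\<lambda>_. 1) s) A" for x
      unfolding f_def using has_sum_cmult_right[OF sum_w] by simp
    show "((\<lambda>x. z x * dser (\<lambda>_. 1) s) has_sum dser mangoldt s * dser (\<lambda>_. 1) s) A"
      by (rule has_sum_cmult_left[OF sum_z])
    have "(\<lambda>x. norm (f x)) summable_on (A \<times> A)"
      unfolding Infinite_Sum.abs_summable_on_Sigma_iff f_def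
      using abs_z abs_w
      by (auto simp: norm_mult infsum_cmult_right' abs_mult
               intro!: summable_on_cmult_right summable_on_cmult_left)
    thus "f summable_on (A \<times> A)" by (rule abs_summable_summable)
  qed
  also have "(f has_sum (dser mangoldt s * dser (\<lambda>_. 1) s)) (A \<times> A) \<longleftrightarrow>
      ((\<lambda>(n,d). f (d, n div d)) has_sum (dser mangoldt s * dser (\<lambda>_. 1) s)) (Sigma A (\<lambda>n. {d. d dvd n}))"
    by (rule has_sum_reindex_bij_witness[of _ "\<lambda>(n,d). (d, n div d)" "\<lambda>(d,m). (d * m, d)"])
       (auto simp: A_def elim!: dvdE)
  finally have "((\<lambda>n. \<Sum>d | d dvd n. f (d, n div d)) has_sum (dser mangoldt s * dser (\<lambda>_. 1) s)) A"
    by (rule has_sum_SigmaD) (auto simp: A_def intro!: has_sum_finiteI)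
  also have "?this \<longleftrightarrow> ((\<lambda>n. complex_of_real (ln (real n)) * of_nat n powr (-s)) has_sum (dser mangoldt s * dser (\<lambda>_. 1) s)) A"
  proof (rule has_sum_cong)
    fix n assume n: "n \<in> A"
    have "(\<Sum>d | d dvd n. f (d, n div d)) = (\<Sum>d | d dvd n. complex_of_real (mangoldt d) * of_nat n powr (-s))"
    proof (rule sum.cong)
      fix d assume "d \<in> {d. d dvd n}"
      then obtain m where m: "n = d * m" by (auto elim!: dvdE)
      with n have "d > 0" "m > 0" by (auto simp: A_def)
      thus "f (d, n div d) = complex_of_real (mangoldt d) * of_nat n powr (-s)"
        using powr_times_real[of "of_nat d :: complex" "of_nat m" "-s"]
        unfolding m f_def z_def w_def by simp
    qed auto
    also have "\<dots> = complex_of_real (\<Sum>d | d dvd n. mangoldt d) * of_nat n powr (-s)"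
      by (simp add: sum_distrib_right)
    also have "\<dots> = complex_of_real (ln (real n)) * of_nat n powr (-s)"
      using n by (subst mangoldt_sum) (auto simp: A_def)
    finally show "(\<Sum>d | d dvd n. f (d, n div d)) = complex_of_real (ln (real n)) * of_nat n powr (-s)" .
  qed
  also have "\<dots> \<longleftrightarrow> ((\<lambda>n. complex_of_real (ln (real n)) * of_nat n powr (-s)) has_sum (dser mangoldt s * dser (\<lambda>_. 1) s)) UNIV"
    by (rule has_sum_cong_neutral) (auto simp: A_def)
  finally have "(\<lambda>n. complex_of_real (ln (real n)) * of_nat n powr (-s)) sums (dser mangoldt s * dser (\<lambda>_. 1) s)"
    by (rule has_sum_imp_sums)
  thus ?thesis by (simp add: dser_def sums_iff mult.commute)
qed

lemma dser_of_real:
  assumes "absconv a" "\<sigma> > 1"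
  shows "dser a (of_real \<sigma>) = of_real (\<Sum>n. a n * real n powr (-\<sigma>))"
        and "summable (\<lambda>n. a n * real n powr (-\<sigma>))"
proof -
  show "summable (\<lambda>n. a n * real n powr (-\<sigma>))"
    using absconvD[OF assms] by (intro summable_norm_cancel[of "\<lambda>n. a n * real n powr (-\<sigma>)"]) (simp add: abs_mult)
  thus "dser a (of_real \<sigma>) = of_real (\<Sum>n. a n * real n powr (-\<sigma>))"
    unfolding dser_def by (subst suminf_of_real) (auto simp: powr_of_real[symmetric])
qed

lemma zeta_real_ge_1:
  assumes "\<sigma> > 1"
  shows "norm (dser (\<lambda>_. 1) (of_real \<sigma>)) \<ge> 1"
proof -
  note * = dser_of_real[OF absconv_one assms]
  have "sum (\<lambda>n. 1 * real n powr (-\<sigma>)) {1} \<le> (\<Sum>n. 1 * real n powr (-\<sigma>))"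
    by (rule sum_le_suminf[OF *(2)]) auto
  thus ?thesis unfolding *(1) by simp
qed

lemma mangoldt_div_ln_nonneg: "mangoldt n / ln (real n) \<ge> 0"
  by (cases "n = 0") (auto intro!: divide_nonneg_nonneg simp: mangoldt_nonneg)

lemma absconv_mangoldt_div_ln: "absconv (\<lambda>n. mangoldt n / ln (real n))"
proof (rule absconv_mono[OF absconv_one])
  fix n :: nat assume n: "n > 0"
  have "mangoldt n / ln (real n) \<le> 1"
    using mangoldt_le_ln[OF n] n mangoldt_nonneg[of n] by (auto simp: divide_le_eq_1)
  thus "\<bar>mangoldt n / ln (real n)\<bar> \<le> \<bar>1\<bar>" using mangoldt_div_ln_nonneg[of n] by simp
qed

text \<open>A substitute for the Euler product: both sides have the same logarithmic derivative, so
  their quotient is constant on the half-plane. The constant is left unevaluated and enters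
  \<open>zeta_341\<close> as its eighth power.\<close>

lemma zeta_eq_exp:
  obtains c where "c \<noteq> 0" 
    "\<And>s. Re s > 1 \<Longrightarrow> dser (\<lambda>_. 1) s = c * exp (dser (\<lambda>n. mangoldt n / ln (real n)) s)"
proof -
  define b where "b = (\<lambda>n. mangoldt n / ln (real n))"
  have b: "absconv b"
    unfolding b_def by (rule absconv_mangoldt_div_ln)
  have b': "(\<lambda>n. ln (real n) * b n) = mangoldt"
  proof
    fix n :: nat
    show "ln (real n) * b n = mangoldt n"
    proof (cases "n \<le> 1")
      case True thus ?thesis by (cases n) (auto simp: b_def)
    qed (auto simp: b_def)
  qed
  define f where "f = (\<lambda>s. dser (\<lambda>_. 1) s * exp (- dser b s))"
  have "(f has_field_derivative 0) (at s)" if s: "Re s > 1" for s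
  proof -
    have "(dser b has_field_derivative (- dser mangoldt s)) (at s)"
      using has_field_derivative_dser[OF b s] dser_uminus[OF absconv_ln[OF b] s] by (simp add: b')
    moreover have "(dser (\<lambda>_. 1) has_field_derivative (- (dser (\<lambda>_. 1) s * dser mangoldt s))) (at s)"
      using has_field_derivative_dser[OF absconv_one s] dser_uminus[OF absconv_ln[OF absconv_one] s]
      by (simp add: dser_mult_mangoldt[OF s])
    ultimately show ?thesis unfolding f_def
      by (auto intro!: derivative_eq_intros)
  qed
  hence "\<exists>c. \<forall>x\<in>{s. Re s > 1}. f x = c"
    by (intro has_field_derivative_zero_constant convex_halfspace_Re_gt) 
       (auto intro: has_field_derivative_at_within)
  then obtain c where c: "\<And>s. Re s > 1 \<Longrightarrow> f s = c" by auto
  have eq: "dser (\<lambda>_. 1) s = c * exp (dser b s)" if "Re s > 1" for s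
    using c[OF that] by (auto simp: f_def exp_minus field_simps)
  have "c \<noteq> 0"
    using zeta_real_ge_1[of 2] eq[of "of_real 2"] by auto
  with eq that show ?thesis unfolding b_def by blast
qed

lemma zeta_nonzero: "Re s > 1 \<Longrightarrow> dser (\<lambda>_. 1) s \<noteq> 0"
  using zeta_eq_exp by (metis exp_not_eq_zero mult_eq_0_iff)

lemma dser_mangoldt_eq:
  assumes "Re s > 1"
  shows "dser mangoldt s = - deriv (dser (\<lambda>_. 1)) s / dser (\<lambda>_. 1) s"
proof -
  have "deriv (dser (\<lambda>_. 1)) s = - dser (\<lambda>n. ln (real n)) s"
    using DERIV_imp_deriv[OF has_field_derivative_dser[OF absconv_one assms]]
      dser_uminus[OF absconv_ln[OF absconv_one] assms] by simp
  thus ?thesis using dser_mult_mangoldt[OF assms] zeta_nonzero[OF assms] by (simp add: field_simps)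
qed

section \<open>The 3-4-1 inequality\<close>

lemma Re_dser_sums:
  assumes "absconv a" "\<sigma> > 1"
  shows "(\<lambda>n. a n * real n powr (-\<sigma>) * cos (t * ln (real n))) sums Re (dser a (Complex \<sigma> t))"
proof -
  have "Re (complex_of_real (a n) * of_nat n powr (- Complex \<sigma> t)) = a n * real n powr (-\<sigma>) * cos (t * ln (real n))" for n
    by (cases "n = 0") (auto simp: powr_def Ln_of_nat exp_eq_polar Re_exp)
  moreover have "(\<lambda>n. Re (complex_of_real (a n) * of_nat n powr (- Complex \<sigma> t))) sums Re (dser a (Complex \<sigma> t))"
    using assms by (intro sums_Re absconv_sums) auto
  ultimately show ?thesis by (simp only:)
qed

lemma cos_341: "3 + 4 * cos x + cos (2 * x) \<ge> (0::real)"
proof -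
  have "3 + 4 * cos x + cos (2 * x) = 2 * (1 + cos x)\<^sup>2"
    using cos_double_cos[of x] by (simp add: power2_eq_square algebra_simps)
  thus ?thesis by simp
qed

text \<open>By \<open>zeta_eq_exp\<close>, the logarithm of the product is, up to a constant, a
  series with nonnegative coefficients times 3 + 4 cos \<theta> + cos 2\<theta> at \<theta> = t ln
  n. The exponents add up to 3 + 4 + 1 = 8, whence the bound \<open>norm c ^ 8\<close>.\<close>

lemma zeta_341:
  obtains c where "c > 0" "\<And>\<sigma> t. \<sigma> > 1 \<Longrightarrow>
    norm (dser (\<lambda>_. 1) (of_real \<sigma>)) ^ 3 * norm (dser (\<lambda>_. 1) (Complex \<sigma> t)) ^ 4 *
    norm (dser (\<lambda>_. 1) (Complex \<sigma> (2 * t))) \<ge> c"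
proof -
  define b where "b = (\<lambda>n. mangoldt n / ln (real n))"
  have b: "absconv b"
    unfolding b_def by (rule absconv_mangoldt_div_ln)
  have b_nonneg: "b n \<ge> 0" for n
    unfolding b_def by (rule mangoldt_div_ln_nonneg)
  obtain c where c: "c \<noteq> 0" "\<And>s. Re s > 1 \<Longrightarrow> dser (\<lambda>_. 1) s = c * exp (dser b s)"
    using zeta_eq_exp unfolding b_def by blast
  show ?thesis
  proof (rule that[of "norm c ^ 8"])
    show "norm c ^ 8 > 0" using c by simp
    fix \<sigma> t :: real assume \<sigma>: "\<sigma> > 1"
    have "0 \<le> 3 * Re (dser b (Complex \<sigma> 0)) + 4 * Re (dser b (Complex \<sigma> t)) + Re (dser b (Complex \<sigma> (2*t)))"
    proof (rule sums_le[OF _ sums_zero])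
      show "(\<lambda>n. 3 * (b n * real n powr (-\<sigma>) * cos (0 * ln (real n))) + 4 * (b n * real n powr (-\<sigma>) * cos (t * ln (real n)))
           + b n * real n powr (-\<sigma>) * cos (2 * t * ln (real n))) sums
         (3 * Re (dser b (Complex \<sigma> 0)) + 4 * Re (dser b (Complex \<sigma> t)) + Re (dser b (Complex \<sigma> (2*t))))"
        by (intro sums_add sums_mult Re_dser_sums b \<sigma>)
      show "0 \<le> 3 * (b n * real n powr (-\<sigma>) * cos (0 * ln (real n))) + 4 * (b n * real n powr (-\<sigma>) * cos (t * ln (real n)))
           + b n * real n powr (-\<sigma>) * cos (2 * t * ln (real n))" for n
      proof -
        have "0 \<le> b n * real n powr (-\<sigma>) * (3 + 4 * cos (t * ln (real n)) + cos (2 * (t * ln (real n))))"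
          using cos_341 b_nonneg by (intro mult_nonneg_nonneg) auto
        thus ?thesis by (simp add: algebra_simps)
      qed
    qed
    hence "1 \<le> exp (3 * Re (dser b (Complex \<sigma> 0)) + 4 * Re (dser b (Complex \<sigma> t)) + Re (dser b (Complex \<sigma> (2*t))))"
      by simp
    also have "\<dots> = norm (exp (dser b (Complex \<sigma> 0))) ^ 3 * norm (exp (dser b (Complex \<sigma> t))) ^ 4 * norm (exp (dser b (Complex \<sigma> (2*t))))"
      by (simp add: exp_add exp_of_nat_mult[symmetric])
    finally have *: "norm c ^ 8 * 1 \<le> norm c ^ 8 * (norm (exp (dser b (Complex \<sigma> 0))) ^ 3 * norm (exp (dser b (Complex \<sigma> t))) ^ 4 * norm (exp (dser b (Complex \<sigma> (2*t)))))"
      by (intro mult_left_mono) auto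
    have e: "norm c ^ 8 * (x ^ 3 * y ^ 4 * z) = (norm c * x) ^ 3 * (norm c * y) ^ 4 * (norm c * z)" for x y z
      by (simp add: power_mult_distrib eval_nat_numeral)
    have "of_real \<sigma> = Complex \<sigma> 0" by (simp add: complex_eq_iff)
    with * show "norm c ^ 8 \<le> norm (dser (\<lambda>_. 1) (of_real \<sigma>)) ^ 3 * norm (dser (\<lambda>_. 1) (Complex \<sigma> t)) ^ 4 *
      norm (dser (\<lambda>_. 1) (Complex \<sigma> (2 * t)))"
      using \<sigma> unfolding e by (simp add: c(2) norm_mult)
  qed
qed

subsection \<open>Continuation of the zeta function\<close>

text \<open>This is \<open>(s - 1)\<close> times the difference of \<open>n\<^bsup>-s\<^esup>\<close> and the integral of \<open>u\<^bsup>-s\<^esup>\<close> over \<open>[n, n + 1]\<close>,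
  evaluated so that it makes sense at \<open>s = 1\<close>.\<close>

definition zeta_term :: "nat \<Rightarrow> complex \<Rightarrow> complex" where
  "zeta_term n s = (s - 1) * of_nat n powr (-s) - of_nat n powr (1 - s) + of_nat (Suc n) powr (1 - s)"

text \<open>Two bounds with opposite virtues: the one from the mean value theorem gains a factor 1 /
  n but grows with the modulus of s, the trivial one does not depend on the imaginary part. They are
  interpolated in \<open>norm_zeta_term_bound\<close>.\<close>

lemma norm_powr_diff_bound:
  fixes s :: complex and n :: nat and u :: real
  assumes n: "n > 0" and \<sigma>: "Re s > 0" and u: "u \<in> {real n..real n + 1}"
  shows "norm (of_nat n powr (-s) - of_real u powr (-s) :: complex) \<le> norm s * real n powr (- Re s - 1)" (is "?th1")
    and "norm (of_nat n powr (-s) - of_real u powr (-s) :: complex) \<le> 2 * real n powr (- Re s)" (is "?th2")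
proof -
  have nrm: "norm (of_real v powr z :: complex) = v powr Re z" if "v > 0" for v z
    using that by (simp add: norm_powr_real_powr)
  define S where "S = closed_segment (of_real n :: complex) (of_real u)"
  have S: "S = of_real ` {real n..u}"
    unfolding S_def closed_segment_of_real using u by (simp add: closed_segment_eq_real_ivl)
  have "norm (of_real n powr (-s) - of_real u powr (-s) :: complex)
        \<le> (norm s * real n powr (- Re s - 1)) * norm (of_real n - of_real u :: complex)"
  proof (rule field_differentiable_bound[where f = "\<lambda>z. z powr (-s)" and S = S])
    show "convex S" by (simp add: S_def)
    fix z assume "z \<in> S"
    then obtain v where v: "z = of_real v" "v \<ge> real n" by (auto simp: S)
    have v0: "v > 0" using v n by linarith
    hence "z \<notin> \<real>\<^sub>\<le>\<^sub>0" using v by (simp add: complex_nonpos_Reals_iff)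
    thus "((\<lambda>z. z powr - s) has_field_derivative (-s * z powr (-s - 1))) (at z within S)"
      by (auto intro!: derivative_eq_intros)
    have "norm (z powr (-s - 1)) = v powr (- Re s - 1)"
      unfolding v by (subst nrm[OF v0]) simp
    also have "\<dots> \<le> real n powr (- Re s - 1)"
      using v n \<sigma> by (intro powr_mono2') auto
    finally show "norm (-s * z powr (-s - 1)) \<le> norm s * real n powr (- Re s - 1)"
      by (simp add: norm_mult mult_left_mono)
  qed (auto simp: S_def)
  also have "\<dots> \<le> (norm s * real n powr (- Re s - 1)) * 1"
  proof -
    have "norm (of_real n - of_real u :: complex) = \<bar>real n - u\<bar>"
      by (metis norm_of_real of_real_diff)
    thus ?thesis using u by (intro mult_left_mono) auto
  qed
  finally show ?th1 by simp
  have "norm (of_nat n powr (-s) - of_real u powr (-s) :: complex) \<le> norm (of_nat n powr (-s) :: complex) + norm (of_real u powr (-s) :: complex)"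
    by (rule norm_triangle_ineq4)
  also have "norm (of_nat n powr (-s) :: complex) = real n powr (- Re s)"
    by (simp add: norm_of_nat_powr)
  also have "norm (of_real u powr (-s) :: complex) = u powr (- Re s)"
    using u n by (subst nrm) auto
  also have "u powr (- Re s) \<le> real n powr (- Re s)"
    using u n \<sigma> by (intro powr_mono2') auto
  finally show ?th2 by simp
qed

text \<open>\<open>zeta_term n s\<close> is the increment over [n, n + 1] of a function with
  derivative (s - 1) (n^(-s) - z^(-s)), so the mean value inequality replaces the integral.\<close>

lemma norm_zeta_term_le:
  assumes n: "n > 0" and B: "\<And>u. u \<in> {real n..real n + 1} \<Longrightarrow> norm (of_nat n powr (-s) - of_real u powr (-s) :: complex) \<le> B"
  shows "norm (zeta_term n s) \<le> norm (s - 1) * B"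
proof -
  define S where "S = closed_segment (of_real n :: complex) (of_real (real n + 1))"
  have S: "S = of_real ` {real n..real n + 1}"
    unfolding S_def closed_segment_of_real by (simp add: closed_segment_eq_real_ivl)
  define f where "f = (\<lambda>z. (s - 1) * of_nat n powr (-s) * z + z powr (1 - s))"
  have "norm (f (of_real (real n + 1)) - f (of_real n)) \<le> (norm (s-1) * B) * norm (of_real (real n + 1) - of_real n :: complex)"
  proof (rule field_differentiable_bound[where f = f and S = S])
    show "convex S" by (simp add: S_def)
    fix z assume "z \<in> S"
    then obtain v where v: "z = of_real v" "v \<ge> real n" "v \<le> real n + 1" by (auto simp: S)
    have v0: "v > 0" using v n by linarith
    hence "z \<notin> \<real>\<^sub>\<le>\<^sub>0" using v by (simp add: complex_nonpos_Reals_iff)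
    thus "(f has_field_derivative ((s - 1) * (of_nat n powr (-s) - z powr (-s)))) (at z within S)"
      unfolding f_def by (auto intro!: derivative_eq_intros simp: algebra_simps)
    show "norm ((s - 1) * (of_nat n powr (-s) - z powr (-s))) \<le> norm (s - 1) * B"
      unfolding norm_mult v(1) using v by (intro mult_left_mono B) auto
  qed (auto simp: S_def)
  also have "f (of_real (real n + 1)) - f (of_real n) = zeta_term n s"
    by (simp add: f_def zeta_term_def algebra_simps)
  finally show ?thesis by simp
qed

lemma norm_zeta_term_bound1:
  assumes "n > 0" "Re s > 0"
  shows "norm (zeta_term n s) \<le> norm (s - 1) * (norm s * real n powr (- Re s - 1))"
  using assms by (intro norm_zeta_term_le norm_powr_diff_bound)

text \<open>Geometric interpolation: writing a as a^\<theta> a^(1-\<theta>) and bounding each factor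
  differently trades growth in s against decay in n. Small \<theta> gives slow growth, with
  convergence still a little to the left of real part 1.\<close>

lemma norm_zeta_term_bound:
  assumes n: "n > 0" and \<sigma>: "Re s > 0" and \<theta>: "0 \<le> \<theta>" "\<theta> \<le> 1"
  shows "norm (zeta_term n s) \<le> norm (s - 1) * (2 * norm s powr \<theta> * real n powr (- Re s - \<theta>))"
proof (intro norm_zeta_term_le n)
  fix u assume u: "u \<in> {real n..real n + 1}"
  define a where "a = norm (of_nat n powr (-s) - of_real u powr (-s) :: complex)"
  have a: "a \<ge> 0" "a \<le> norm s * real n powr (- Re s - 1)" "a \<le> 2 * real n powr (- Re s)"
    using norm_powr_diff_bound[OF n \<sigma>] u by (auto simp: a_def)
  show "a \<le> 2 * norm s powr \<theta> * real n powr (- Re s - \<theta>)"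
  proof (cases "a = 0")
    case False
    hence "a = a powr \<theta> * a powr (1 - \<theta>)" using a(1) by (simp add: powr_add[symmetric])
    also have "\<dots> \<le> (norm s * real n powr (- Re s - 1)) powr \<theta> * (2 * real n powr (- Re s)) powr (1 - \<theta>)"
      using a \<theta> by (intro mult_mono powr_mono2) auto
    also have "\<dots> = 2 powr (1 - \<theta>) * norm s powr \<theta> * (real n powr ((- Re s - 1) * \<theta>) * real n powr ((- Re s) * (1 - \<theta>)))"
      by (simp add: powr_mult powr_powr)
    also have "real n powr ((- Re s - 1) * \<theta>) * real n powr ((- Re s) * (1 - \<theta>)) = real n powr (- Re s - \<theta>)"
      unfolding powr_add[symmetric] by (simp add: algebra_simps)
    also have "2 powr (1 - \<theta>) * norm s powr \<theta> * real n powr (- Re s - \<theta>) \<le> 2 powr 1 * norm s powr \<theta> * real n powr (- Re s - \<theta>)"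
      using \<theta> by (intro mult_right_mono powr_mono) auto
    finally show ?thesis by simp
  qed auto
qed

text \<open>The function \<open>(s - 1) \<zeta>(s)\<close>, continued to the half-plane \<open>Re s > 0\<close>.\<close>

definition zeta_reg :: "complex \<Rightarrow> complex" where
  "zeta_reg s = 1 + (\<Sum>n. zeta_term (Suc n) s)"

lemma summable_Suc_powr: "a < -1 \<Longrightarrow> summable (\<lambda>n. real (Suc n) powr a)"
  by (subst summable_Suc_iff[of "\<lambda>n. real n powr a"]) (simp add: summable_real_powr_iff)

lemma summable_zeta_term:
  assumes "Re s > 0"
  shows "summable (\<lambda>n. norm (zeta_term (Suc n) s))"
proof (rule summable_comparison_test'[where N = 0])
  show "summable (\<lambda>n. norm (s - 1) * (norm s * real (Suc n) powr (- Re s - 1)))"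
    using assms by (intro summable_mult summable_Suc_powr) auto
  show "norm (norm (zeta_term (Suc n) s)) \<le> norm (s - 1) * (norm s * real (Suc n) powr (- Re s - 1))" for n
    using norm_zeta_term_bound1[OF _ assms, of "Suc n"] by (simp del: of_nat_Suc)
qed

lemma holomorphic_zeta_reg: "zeta_reg holomorphic_on {s. Re s > 0}"
proof -
  define S where "S = {s. Re s > 0}"
  have "\<exists>g g'. \<forall>x\<in>S. ((\<lambda>n. zeta_term (Suc n) x) sums g x) \<and> ((\<lambda>n. deriv (zeta_term (Suc n)) x) sums g' x) \<and> (g has_field_derivative g' x) (at x)"
  proof (rule series_and_derivative_comparison_local)
    show "open S" by (simp add: S_def open_halfplane)
    show "(zeta_term (Suc n) has_field_derivative deriv (zeta_term (Suc n)) x) (at x)" for n x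
    proof -
      have "zeta_term (Suc n) holomorphic_on UNIV"
        unfolding zeta_term_def by (intro holomorphic_intros) (auto simp del: of_nat_Suc)
      thus ?thesis by (intro holomorphic_derivI[of _ UNIV]) auto
    qed
    fix x assume x: "x \<in> S"
    define d where "d = Re x / 2"
    have d: "d > 0" using x by (auto simp: S_def d_def)
    define M where "M = norm x + d + 1"
    show "\<exists>d h. 0 < d \<and> summable h \<and> (\<forall>\<^sub>F n in sequentially. \<forall>y\<in>ball x d \<inter> S. norm (zeta_term (Suc n) y) \<le> h n)"
    proof (intro exI conjI always_eventually allI ballI)
      show "0 < d" by fact
      show "summable (\<lambda>n. M * (M * real (Suc n) powr (-d - 1)))" using d by (intro summable_mult summable_Suc_powr) auto
      fix n :: nat and y assume y: "y \<in> ball x d \<inter> S"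
      have "\<bar>Re x - Re y\<bar> \<le> norm (x - y)" by (metis abs_Re_le_cmod minus_complex.simps(1))
      hence "Re y \<ge> d" using y by (auto simp: dist_norm d_def field_simps)
      have "norm y \<le> norm x + norm (y - x)" by (metis add.commute diff_add_cancel norm_triangle_ineq)
      hence ny: "norm y + 1 \<le> M" using y by (simp add: M_def dist_norm norm_minus_commute)
      have "norm (y - 1) \<le> M" using ny norm_triangle_ineq4[of y 1] by simp
      have "norm (zeta_term (Suc n) y) \<le> norm (y - 1) * (norm y * real (Suc n) powr (- Re y - 1))"
        using y by (intro norm_zeta_term_bound1) (auto simp: S_def)
      also have "\<dots> \<le> M * (M * real (Suc n) powr (-d - 1))"
        using \<open>Re y \<ge> d\<close> \<open>norm (y - 1) \<le> M\<close> ny d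
        by (intro mult_mono powr_mono) (auto simp: M_def intro!: mult_nonneg_nonneg)
      finally show "norm (zeta_term (Suc n) y) \<le> M * (M * real (Suc n) powr (-d - 1))" .
    qed
  qed
  then obtain g g' where g: "\<And>x. x \<in> S \<Longrightarrow> (\<lambda>n. zeta_term (Suc n) x) sums g x" 
     "\<And>x. x \<in> S \<Longrightarrow> (g has_field_derivative g' x) (at x)" by blast
  have "g holomorphic_on S" using g(2) by (auto simp: holomorphic_on_open S_def open_halfplane)
  hence "(\<lambda>s. 1 + g s) holomorphic_on S" by (intro holomorphic_intros)
  also have "?this \<longleftrightarrow> zeta_reg holomorphic_on S"
    using g(1) by (intro holomorphic_cong) (auto simp: zeta_reg_def sums_iff)
  finally show ?thesis by (simp add: S_def)
qed

lemma zeta_reg_1: "zeta_reg 1 = 1"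
  by (simp add: zeta_reg_def zeta_term_def del: of_nat_Suc)

text \<open>The differences of n^(1-s) telescope to -1, which the leading 1 of
  \<open>zeta_reg\<close> offsets.\<close>

lemma zeta_reg_eq:
  assumes "Re s > 1"
  shows "zeta_reg s = (s - 1) * dser (\<lambda>_. 1) s"
proof -
  have 1: "(\<lambda>n. of_nat (Suc n) powr (-s)) sums dser (\<lambda>_. 1) s"
    using absconv_sums[OF absconv_one assms] by (subst sums_Suc_iff[of "\<lambda>n. of_nat n powr (-s)"]) auto
  have "((\<lambda>n. of_nat (Suc n) powr (1 - s) :: complex) \<longlongrightarrow> 0) sequentially"
  proof (rule tendsto_norm_zero_cancel)
    have "((\<lambda>n. real (Suc n) powr (1 - Re s)) \<longlongrightarrow> 0) sequentially"
      using assms by real_asymp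
    thus "((\<lambda>n. norm (of_nat (Suc n) powr (1 - s) :: complex)) \<longlongrightarrow> 0) sequentially"
      by (simp add: norm_of_nat_powr del: of_nat_Suc)
  qed
  from telescope_sums[OF this] have 2: "(\<lambda>n. of_nat (Suc (Suc n)) powr (1 - s) - of_nat (Suc n) powr (1 - s)) sums (-1 :: complex)"
    by simp
  have "(\<lambda>n. (s - 1) * of_nat (Suc n) powr (-s) + (of_nat (Suc (Suc n)) powr (1 - s) - of_nat (Suc n) powr (1 - s)))
           sums ((s - 1) * dser (\<lambda>_. 1) s + (-1))"
    by (intro sums_add sums_mult 1 2)
  thus ?thesis by (simp add: zeta_reg_def zeta_term_def sums_iff algebra_simps)
qed

section \<open>The zeta function without its pole\<close>

definition zeta_diff :: "complex \<Rightarrow> complex" where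
  "zeta_diff s = (if s = 1 then deriv zeta_reg 1 else (zeta_reg s - 1) / (s - 1))"

lemma zeta_reg_eq': "zeta_reg s = (s - 1) * zeta_diff s + 1"
  by (auto simp: zeta_diff_def zeta_reg_1)

lemma holomorphic_zeta_diff: "zeta_diff holomorphic_on {s. Re s > 0}"
  using pole_lemma_open[OF holomorphic_zeta_reg open_halfplane, of 1]
  unfolding zeta_diff_def[abs_def] zeta_reg_1 .

lemma zeta_eq:
  assumes "Re s > 1"
  shows "dser (\<lambda>_. 1) s = zeta_diff s + 1 / (s - 1)"
proof -
  have "s \<noteq> 1" using assms by auto
  thus ?thesis using zeta_reg_eq[OF assms] by (simp add: zeta_diff_def field_simps)
qed

text \<open>Half of \<theta> is spent on moving to the left of real part 1, the other half on
  summability: the exponent of n is at most -1 - \<theta>/2 throughout.\<close>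

lemma zeta_diff_bound:
  assumes \<theta>: "0 < \<theta>" "\<theta> \<le> 1"
  obtains C where "C > 0" "\<And>s. Re s \<ge> 1 - \<theta> / 2 \<Longrightarrow> norm (zeta_diff s) \<le> C * norm s powr \<theta>"
proof -
  define S where "S = (\<Sum>n. real (Suc n) powr (-1 - \<theta>/2))"
  have summ: "summable (\<lambda>n. real (Suc n) powr (-1 - \<theta>/2))" using \<theta> by (intro summable_Suc_powr) auto
  hence S: "S \<ge> 0" unfolding S_def by (intro suminf_nonneg) auto
  \<comment> \<open>At s = 1 the estimate cannot be divided by s - 1, so the value
    \<open>zeta_diff 1\<close> is built into the constant.\<close>
  show ?thesis
  proof (rule that[of "2 * S + norm (zeta_diff 1) + 1"])
    show "2 * S + norm (zeta_diff 1) + 1 > 0" using S norm_ge_zero[of "zeta_diff 1"] by linarith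
    fix s assume s: "Re s \<ge> 1 - \<theta> / 2"
    have Re: "Re s > 0" using s \<theta> by auto
    show "norm (zeta_diff s) \<le> (2 * S + norm (zeta_diff 1) + 1) * norm s powr \<theta>"
    proof (cases "s = 1")
      case True thus ?thesis using S by simp
    next
      case False
      have "norm (zeta_reg s - 1) \<le> (\<Sum>n. norm (zeta_term (Suc n) s))"
        unfolding zeta_reg_def using summable_norm[OF summable_zeta_term[OF Re]] by simp
      also have "\<dots> \<le> (\<Sum>n. norm (s - 1) * (2 * norm s powr \<theta> * real (Suc n) powr (-1 - \<theta>/2)))"
      proof (rule suminf_le)
        show "norm (zeta_term (Suc n) s) \<le> norm (s - 1) * (2 * norm s powr \<theta> * real (Suc n) powr (-1 - \<theta>/2))" for n
        proof -
          have "norm (zeta_term (Suc n) s) \<le> norm (s - 1) * (2 * norm s powr \<theta> * real (Suc n) powr (- Re s - \<theta>))"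
            using Re \<theta> by (intro norm_zeta_term_bound) auto
          also have "\<dots> \<le> norm (s - 1) * (2 * norm s powr \<theta> * real (Suc n) powr (-1 - \<theta>/2))"
            using s by (intro mult_left_mono powr_mono) auto
          finally show ?thesis .
        qed
      qed (intro summable_zeta_term Re summable_mult summ)+
      also have "\<dots> = norm (s - 1) * (2 * norm s powr \<theta> * S)"
        unfolding S_def using summ by (simp only: suminf_mult summable_mult mult.assoc)
      finally have "norm (zeta_diff s) \<le> 2 * norm s powr \<theta> * S"
        using False by (simp add: zeta_diff_def norm_divide field_simps)
      also have "\<dots> \<le> (2 * S + norm (zeta_diff 1) + 1) * norm s powr \<theta>"
        by (simp add: algebra_simps)
      finally show ?thesis .
    qed
  qed
qed

subsection \<open>Lower bounds near the line of real part 1\<close>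

definition zeta_cont :: "complex \<Rightarrow> complex" where
  "zeta_cont s = zeta_diff s + 1 / (s - 1)"

text \<open>The exponent is chosen so that a function of size \<open>growth\<^sup>5\<close> on discs of radius \<open>growth\<^bsup>-5\<^esup>\<close> has its
  third derivative bounded by \<open>growth\<^bsup>20\<^esup> = 2 + \<bar>t\<bar>\<close>.\<close>

definition growth :: "real \<Rightarrow> real" where
  "growth t = (2 + \<bar>t\<bar>) powr (1/20)"

lemma growth_ge_1: "growth t \<ge> 1"
  unfolding growth_def by (rule ge_one_powr_ge_zero) auto

lemma growth_pos: "growth t > 0"
  using growth_ge_1[of t] by linarith

lemma growth_power_20: "growth t ^ 20 = 2 + \<bar>t\<bar>"
  by (simp add: growth_def powr_power)

lemma growth_le: "growth t \<le> 2 + \<bar>t\<bar>"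
  using self_le_power[OF growth_ge_1[of t], of 20] by (simp add: growth_power_20)

lemma powr_le_2_growth:
  assumes "0 \<le> x" "x \<le> 2 * (2 + \<bar>t\<bar>)"
  shows "x powr (1/20) \<le> 2 * growth t"
proof -
  have "x powr (1/20) \<le> (2 * (2 + \<bar>t\<bar>)) powr (1/20)"
    using assms by (intro powr_mono2) auto
  also have "\<dots> = 2 powr (1/20) * growth t" unfolding growth_def by (subst powr_mult) auto
  also have "\<dots> \<le> 2 powr 1 * growth t" using growth_pos[of t] by (intro mult_right_mono powr_mono) auto
  finally show ?thesis by simp
qed

lemma growth_near: "\<bar>u - t\<bar> \<le> 1 \<Longrightarrow> growth u \<le> 2 * growth t"
  unfolding growth_def[of u] by (rule powr_le_2_growth) auto

lemma growth_double: "growth (2 * t) \<le> 2 * growth t"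
  unfolding growth_def[of "2*t"] by (rule powr_le_2_growth) auto

text \<open>With \<theta> = 1/20, \<open>zeta_diff_bound\<close> reaches 1/40 to the left of real
  part 1. This fixes the strip widths 1/40 and 1/80 below, the smaller one leaving room for Cauchy
  discs.\<close>

lemma zeta_diff_le_growth:
  obtains C where "C > 0" "\<And>s. Re s \<ge> 1 - 1/40 \<Longrightarrow> Re s \<le> 3 \<Longrightarrow> norm (zeta_diff s) \<le> C * growth (Im s)"
proof -
  obtain C where C: "C > 0" "\<And>s. Re s \<ge> 1 - (1/20) / 2 \<Longrightarrow> norm (zeta_diff s) \<le> C * norm s powr (1/20)"
    using zeta_diff_bound[of "1/20"] by auto
  show ?thesis
  proof (rule that[of "C * 2"])
    fix s assume s: "Re s \<ge> 1 - 1/40" "Re s \<le> 3"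
    have "norm s \<le> \<bar>Re s\<bar> + \<bar>Im s\<bar>" by (rule cmod_le)
    also have "\<dots> \<le> 2 * (2 + \<bar>Im s\<bar>)" using s by auto
    finally have "norm s powr (1/20) \<le> 2 * growth (Im s)" by (intro powr_le_2_growth) auto
    hence "C * norm s powr (1/20) \<le> C * (2 * growth (Im s))" using C by (intro mult_left_mono) auto
    thus "norm (zeta_diff s) \<le> C * 2 * growth (Im s)" using C(2)[of s] s by auto
  qed (use C in auto)
qed

lemma zeta_cont_bound:
  assumes "\<tau> > 0"
  obtains C where "C \<ge> 1" 
    "\<And>s. Re s \<ge> 1 - 1/40 \<Longrightarrow> Re s \<le> 3 \<Longrightarrow> norm (s - 1) \<ge> \<tau> \<Longrightarrow> norm (zeta_cont s) \<le> C * growth (Im s)"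
proof -
  obtain C where C: "C > 0" "\<And>s. Re s \<ge> 1 - 1/40 \<Longrightarrow> Re s \<le> 3 \<Longrightarrow> norm (zeta_diff s) \<le> C * growth (Im s)"
    using zeta_diff_le_growth by auto
  show ?thesis
  proof (rule that[of "C + 1/\<tau> + 1"])
    fix s assume s: "Re s \<ge> 1 - 1/40" "Re s \<le> 3" "norm (s - 1) \<ge> \<tau>"
    have "norm (1 / (s - 1)) \<le> 1 / \<tau>" using s assms by (auto simp: norm_divide intro!: divide_left_mono mult_pos_pos)
    also have "\<dots> \<le> (1 / \<tau>) * growth (Im s)" 
      using assms mult_left_mono[OF growth_ge_1[of "Im s"], of "1/\<tau>"] by auto
    finally have "norm (zeta_cont s) \<le> C * growth (Im s) + (1 / \<tau>) * growth (Im s)"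
      unfolding zeta_cont_def using C(2)[OF s(1,2)] norm_triangle_ineq[of "zeta_diff s" "1 / (s - 1)"] by linarith
    thus "norm (zeta_cont s) \<le> (C + 1/\<tau> + 1) * growth (Im s)"
      using growth_pos[of "Im s"] by (simp add: algebra_simps)
  qed (use C assms in auto)
qed

lemma holomorphic_zeta_cont: "zeta_cont holomorphic_on ({s. Re s > 0} - {1})"
  unfolding zeta_cont_def
  by (intro holomorphic_intros holomorphic_on_subset[OF holomorphic_zeta_diff]) auto

lemma open_zeta_cont: "open ({s. Re s > 0} - {1})"
  by (intro open_Diff open_halfplane) auto

lemma Re_Im_near: "norm (z - s) \<le> r \<Longrightarrow> \<bar>Re z - Re s\<bar> \<le> r" "norm (z - s) \<le> r \<Longrightarrow> \<bar>Im z - Im s\<bar> \<le> r"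
  by (metis abs_Re_le_cmod minus_complex.simps(1) order_trans)
     (metis abs_Im_le_cmod minus_complex.simps(2) order_trans)

lemma deriv_zeta_cont_bound:
  assumes "\<tau> > 0"
  obtains C where "C \<ge> 1" 
    "\<And>s. Re s \<ge> 1 - 1/80 \<Longrightarrow> Re s \<le> 5/2 \<Longrightarrow> norm (s - 1) \<ge> \<tau> \<Longrightarrow> norm (deriv zeta_cont s) \<le> C * growth (Im s)"
proof -
  \<comment> \<open>A disc of radius r about s keeps distance \<tau>/2 from the pole and stays in
    the strip where \<zeta> itself is bounded.\<close>
  define r where "r = min (\<tau> / 2) (1 / 80)"
  have r: "r > 0" "r \<le> \<tau> / 2" "r \<le> 1 / 80" using assms by (auto simp: r_def)
  obtain C where C: "C \<ge> 1" "\<And>s. Re s \<ge> 1 - 1/40 \<Longrightarrow> Re s \<le> 3 \<Longrightarrow> norm (s - 1) \<ge> \<tau> / 2 \<Longrightarrow> norm (zeta_cont s) \<le> C * growth (Im s)"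
    using zeta_cont_bound[of "\<tau> / 2"] assms by auto
  show ?thesis
  proof (rule that[of "2 * C / r"])
    have "r \<le> C" using C r by linarith
    thus "2 * C / r \<ge> 1" using r C by simp
    fix s assume s: "Re s \<ge> 1 - 1/80" "Re s \<le> 5/2" "norm (s - 1) \<ge> \<tau>"
    have 1: "Re z \<ge> 1 - 1/40 \<and> Re z \<le> 3 \<and> norm (z - 1) \<ge> \<tau> / 2 \<and> \<bar>Im z - Im s\<bar> \<le> 1" if "norm (z - s) \<le> r" for z
    proof -
      have "norm (s - 1) \<le> norm (z - s) + norm (z - 1)" by norm
      thus ?thesis using Re_Im_near[OF that] s r that by auto
    qed
    have hol: "zeta_cont holomorphic_on cball s r"
      by (rule holomorphic_on_subset[OF holomorphic_zeta_cont])
         (use 1 assms in \<open>fastforce simp: dist_norm norm_minus_commute\<close>)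
    have "norm ((deriv ^^ 1) zeta_cont s) \<le> fact 1 * (2 * C * growth (Im s)) / r ^ 1"
    proof (rule Cauchy_inequality)
      show "zeta_cont holomorphic_on ball s r" using hol by (rule holomorphic_on_subset) auto
      show "continuous_on (cball s r) zeta_cont" using hol by (rule holomorphic_on_imp_continuous_on)
      fix z assume z: "norm (s - z) = r"
      hence "norm (z - s) \<le> r" by (simp add: norm_minus_commute)
      note z1 = 1[OF this]
      have "norm (zeta_cont z) \<le> C * growth (Im z)" using z1 by (intro C(2)) auto
      also have "\<dots> \<le> C * (2 * growth (Im s))" using C z1 by (intro mult_left_mono growth_near) auto
      finally show "norm (zeta_cont z) \<le> 2 * C * growth (Im s)" by simp
    qed fact
    thus "norm (deriv zeta_cont s) \<le> 2 * C / r * growth (Im s)" by simp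
  qed
qed

lemma zeta_cont_eq: "Re s > 1 \<Longrightarrow> zeta_cont s = dser (\<lambda>_. 1) s"
  by (simp add: zeta_cont_def zeta_eq)

lemma zeta_real_bound:
  obtains A where "A > 0" "\<And>\<sigma>. 1 < \<sigma> \<Longrightarrow> \<sigma> \<le> 2 \<Longrightarrow> norm (dser (\<lambda>_. 1) (of_real \<sigma>)) \<le> A / (\<sigma> - 1)"
proof -
  obtain C where C: "C > 0" "\<And>s. Re s \<ge> 1 - 1/40 \<Longrightarrow> Re s \<le> 3 \<Longrightarrow> norm (zeta_diff s) \<le> C * growth (Im s)"
    using zeta_diff_le_growth by auto
  show ?thesis
  proof (rule that[of "C * growth 0 + 1"])
    show "C * growth 0 + 1 > 0" using C growth_pos[of 0] by (intro add_pos_pos mult_pos_pos) auto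
    fix \<sigma> :: real assume \<sigma>: "1 < \<sigma>" "\<sigma> \<le> 2"
    have "norm (dser (\<lambda>_. 1) (of_real \<sigma>)) \<le> norm (zeta_diff (of_real \<sigma>)) + norm (1 / (of_real \<sigma> - 1) :: complex)"
      using \<sigma> by (subst zeta_eq) (auto intro: norm_triangle_ineq)
    also have "1 / (of_real \<sigma> - 1) = complex_of_real (1 / (\<sigma> - 1))" by simp
    also have "norm \<dots> = 1 / (\<sigma> - 1)" using \<sigma> by (simp only: norm_of_real) auto
    also have "norm (zeta_diff (of_real \<sigma>)) \<le> C * growth 0" using C(2)[of "of_real \<sigma>"] \<sigma> by simp
    also have "C * growth 0 \<le> C * growth 0 / (\<sigma> - 1)" 
      using C growth_pos[of 0] \<sigma> by (subst pos_le_divide_eq) (auto intro!: mult_left_le mult_pos_pos)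
    finally show "norm (dser (\<lambda>_. 1) (of_real \<sigma>)) \<le> (C * growth 0 + 1) / (\<sigma> - 1)"
      by (simp add: add_divide_distrib)
  qed
qed

text \<open>In \<open>zeta_341\<close> the other two factors are bounded above, by the simple pole
  at 1 and by the growth at 2t; solving for the middle factor gives the claim.\<close>

lemma zeta_lower_pow4:
  assumes "\<tau> > 0"
  obtains c where "c > 0"
    "\<And>\<sigma> t. 1 < \<sigma> \<Longrightarrow> \<sigma> \<le> 2 \<Longrightarrow> \<bar>t\<bar> \<ge> \<tau> \<Longrightarrow> norm (zeta_cont (Complex \<sigma> t)) ^ 4 \<ge> c * (\<sigma> - 1) ^ 3 / growth t"
proof -
  obtain c0 where c0: "c0 > 0" "\<And>\<sigma> t. \<sigma> > 1 \<Longrightarrow>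
    norm (dser (\<lambda>_. 1) (of_real \<sigma>)) ^ 3 * norm (dser (\<lambda>_. 1) (Complex \<sigma> t)) ^ 4 *
    norm (dser (\<lambda>_. 1) (Complex \<sigma> (2 * t))) \<ge> c0" using zeta_341 by blast
  obtain A where A: "A > 0" "\<And>\<sigma>. 1 < \<sigma> \<Longrightarrow> \<sigma> \<le> 2 \<Longrightarrow> norm (dser (\<lambda>_. 1) (of_real \<sigma>)) \<le> A / (\<sigma> - 1)"
    using zeta_real_bound by blast
  obtain C where C: "C \<ge> 1" "\<And>s. Re s \<ge> 1 - 1/40 \<Longrightarrow> Re s \<le> 3 \<Longrightarrow> norm (s - 1) \<ge> \<tau> \<Longrightarrow> norm (zeta_cont s) \<le> C * growth (Im s)"
    using zeta_cont_bound[OF assms] by blast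
  show ?thesis
  proof (rule that[of "c0 / (A ^ 3 * (2 * C))"])
    show "c0 / (A ^ 3 * (2 * C)) > 0" using c0 A C by simp
    fix \<sigma> t :: real assume \<sigma>: "1 < \<sigma>" "\<sigma> \<le> 2" and t: "\<bar>t\<bar> \<ge> \<tau>"
    define y where "y = norm (zeta_cont (Complex \<sigma> t)) ^ 4"
    have "\<bar>2 * t\<bar> \<le> norm (Complex \<sigma> (2 * t) - 1)"
      using abs_Im_le_cmod[of "Complex \<sigma> (2 * t) - 1"] by simp
    hence "norm (zeta_cont (Complex \<sigma> (2 * t))) \<le> C * growth (2 * t)"
      using C(2)[of "Complex \<sigma> (2 * t)"] \<sigma> t by simp
    also have "\<dots> \<le> C * (2 * growth t)" using C by (intro mult_left_mono growth_double) auto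
    finally have 1: "norm (dser (\<lambda>_. 1) (Complex \<sigma> (2 * t))) \<le> 2 * C * growth t" using \<sigma> by (simp add: zeta_cont_eq)
    have "c0 \<le> norm (dser (\<lambda>_. 1) (of_real \<sigma>)) ^ 3 * y * norm (dser (\<lambda>_. 1) (Complex \<sigma> (2 * t)))"
      using c0(2)[OF \<sigma>(1), of t] \<sigma> by (simp add: y_def zeta_cont_eq)
    also have "\<dots> \<le> (A / (\<sigma> - 1)) ^ 3 * y * (2 * C * growth t)"
      using \<sigma> A by (intro mult_mono power_mono A 1) (auto simp: y_def)
    finally show "c0 / (A ^ 3 * (2 * C)) * (\<sigma> - 1) ^ 3 / growth t \<le> norm (zeta_cont (Complex \<sigma> t)) ^ 4"
      unfolding y_def[symmetric] using \<sigma> A C growth_pos[of t] by (simp add: field_simps)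
  qed
qed

lemma zeta_cont_diff_bound:
  assumes "\<And>z. z \<in> closed_segment a b \<Longrightarrow> Re z > 0 \<and> z \<noteq> 1 \<and> norm (deriv zeta_cont z) \<le> B"
  shows "norm (zeta_cont a - zeta_cont b) \<le> B * norm (a - b)"
proof (rule field_differentiable_bound[where S = "closed_segment a b" and f' = "deriv zeta_cont"])
  fix z assume z: "z \<in> closed_segment a b"
  have "(zeta_cont has_field_derivative deriv zeta_cont z) (at z)"
    by (rule holomorphic_derivI[OF holomorphic_zeta_cont open_zeta_cont]) (use assms[OF z] in auto)
  thus "(zeta_cont has_field_derivative deriv zeta_cont z) (at z within closed_segment a b)"
    by (rule has_field_derivative_at_within)
qed (use assms in auto)

text \<open>The bound on \<open>\<bar>\<zeta>\<bar>\<^sup>4\<close> degenerates at \<open>\<sigma> = 1\<close>. It is used at distance \<open>\<delta>\<close> from that line and carried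
  over to smaller \<open>\<sigma>\<close> by the bound on \<open>\<zeta>'\<close>; with \<open>\<delta> = \<kappa> growth\<^bsup>-5\<^esup>\<close> both effects have the same order.\<close>

lemma zeta_lower_bound:
  assumes "\<tau> > 0"
  obtains c where "c > 0"
    "\<And>\<sigma> t. 1 < \<sigma> \<Longrightarrow> \<sigma> \<le> 2 \<Longrightarrow> \<bar>t\<bar> \<ge> \<tau> \<Longrightarrow> norm (zeta_cont (Complex \<sigma> t)) \<ge> c / growth t ^ 4"
proof -
  obtain c1 where c1: "c1 > 0"
    "\<And>\<sigma> t. 1 < \<sigma> \<Longrightarrow> \<sigma> \<le> 2 \<Longrightarrow> \<bar>t\<bar> \<ge> \<tau> \<Longrightarrow> norm (zeta_cont (Complex \<sigma> t)) ^ 4 \<ge> c1 * (\<sigma> - 1) ^ 3 / growth t"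
    using zeta_lower_pow4[OF assms] by blast
  obtain C where C: "C \<ge> 1" 
    "\<And>s. Re s \<ge> 1 - 1/80 \<Longrightarrow> Re s \<le> 5/2 \<Longrightarrow> norm (s - 1) \<ge> \<tau> \<Longrightarrow> norm (deriv zeta_cont s) \<le> C * growth (Im s)"
    using deriv_zeta_cont_bound[OF assms] by blast
  \<comment> \<open>In \<open>far\<close> the fourth power of the desired bound has order \<kappa>^4
    while the available one has order \<kappa>^3, so a small \<kappa> wins; 16 C^4 is the fourth
    power of 2 C.\<close>
  define \<kappa> where "\<kappa> = min 1 (c1 / (16 * C ^ 4))"
  have \<kappa>: "\<kappa> > 0" "\<kappa> \<le> 1" "\<kappa> \<le> c1 / (16 * C ^ 4)" using c1 C by (auto simp: \<kappa>_def)
  have \<kappa>3: "16 * C ^ 4 * \<kappa> \<le> c1" using \<kappa>(3) C by (simp add: field_simps)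
  show ?thesis
  proof (rule that[of "C * \<kappa>"])
    show "C * \<kappa> > 0" using C \<kappa> by simp
    fix \<sigma> t :: real assume \<sigma>: "1 < \<sigma>" "\<sigma> \<le> 2" and t: "\<bar>t\<bar> \<ge> \<tau>"
    define Y where "Y = growth t"
    have Y: "Y \<ge> 1" unfolding Y_def by (rule growth_ge_1)
    define \<delta> where "\<delta> = \<kappa> / Y ^ 5"
    have \<delta>: "\<delta> > 0" using Y \<kappa> by (simp add: \<delta>_def)
    have "\<delta> \<le> \<kappa>" unfolding \<delta>_def using Y \<kappa> by (simp add: divide_le_eq mult_left_le one_le_power)
    hence \<delta>1: "\<delta> \<le> 1" using \<kappa> by linarith
    \<comment> \<open>Twice the final bound, because moving from 1 + \<delta> to a smaller \<sigma>
      loses up to C \<kappa> / Y^4.\<close>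
    have far: "2 * C * \<kappa> / Y ^ 4 \<le> norm (zeta_cont (Complex x t))" if x: "x \<ge> 1 + \<delta>" "x \<le> 2" for x
    proof -
      have "(2 * C * \<kappa> / Y ^ 4) ^ 4 = 16 * C ^ 4 * \<kappa> * \<kappa> ^ 3 / Y ^ 16"
        by (simp add: power_divide power_mult_distrib power_mult[symmetric] eval_nat_numeral mult_ac)
      also have "\<dots> \<le> c1 * \<kappa> ^ 3 / Y ^ 16"
        using \<kappa>3 \<kappa> Y by (intro divide_right_mono mult_right_mono) auto
      also have "\<dots> = c1 * \<delta> ^ 3 / Y"
        using Y by (simp add: \<delta>_def power_divide power_mult[symmetric] eval_nat_numeral)
      also have "\<dots> \<le> c1 * (x - 1) ^ 3 / Y"
        using x \<delta> c1 Y by (intro divide_right_mono mult_left_mono power_mono) auto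
      also have "\<dots> \<le> norm (zeta_cont (Complex x t)) ^ 4"
        unfolding Y_def using x \<delta> t by (intro c1(2)) auto
      finally show ?thesis by (rule power_le_imp_le_base[of _ 3, simplified]) auto
    qed
    show "C * \<kappa> / growth t ^ 4 \<le> norm (zeta_cont (Complex \<sigma> t))"
    proof (cases "\<sigma> \<ge> 1 + \<delta>")
      case True
      have "C * \<kappa> / Y ^ 4 \<le> 2 * C * \<kappa> / Y ^ 4" using C \<kappa> Y by (intro divide_right_mono) auto
      thus ?thesis using far[OF True \<sigma>(2)] by (simp add: Y_def)
    next
      case False
      have "norm (zeta_cont (Complex (1 + \<delta>) t) - zeta_cont (Complex \<sigma> t)) \<le> (C * Y) * norm (Complex (1 + \<delta>) t - Complex \<sigma> t)"
      proof (rule zeta_cont_diff_bound)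
        fix z assume "z \<in> closed_segment (Complex (1 + \<delta>) t) (Complex \<sigma> t)"
        then obtain u where u: "0 \<le> u" "u \<le> 1" "z = (1 - u) *\<^sub>R Complex (1 + \<delta>) t + u *\<^sub>R Complex \<sigma> t"
          by (auto simp: in_segment)
        have Im: "Im z = t" unfolding u(3) by simp (simp add: algebra_simps)
        have "Re z = (1 - u) * (1 + \<delta>) + u * \<sigma>" using u by simp
        moreover have "(1 - u) * 1 + u * 1 \<le> (1 - u) * (1 + \<delta>) + u * \<sigma>" using u \<delta> \<sigma> by (intro add_mono mult_left_mono) auto
        moreover have "(1 - u) * (1 + \<delta>) + u * \<sigma> \<le> (1 - u) * 2 + u * 2" using u \<delta>1 \<sigma> by (intro add_mono mult_left_mono) auto
        ultimately have Re: "Re z \<ge> 1" "Re z \<le> 2" by auto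
        have "norm (z - 1) \<ge> \<bar>Im (z - 1)\<bar>" by (rule abs_Im_le_cmod)
        hence z1: "norm (z - 1) \<ge> \<tau>" using Im t by simp
        show "Re z > 0 \<and> z \<noteq> 1 \<and> norm (deriv zeta_cont z) \<le> C * Y"
          using C(2)[of z] Re z1 assms Im by (auto simp: Y_def)
      qed
      also have "Complex (1 + \<delta>) t - Complex \<sigma> t = of_real (1 + \<delta> - \<sigma>)" by (simp add: complex_eq_iff)
      also have "norm \<dots> \<le> \<delta>" using False \<sigma> unfolding norm_of_real by simp
      finally have "norm (zeta_cont (Complex (1 + \<delta>) t) - zeta_cont (Complex \<sigma> t)) \<le> C * Y * \<delta>"
        using C Y by (simp add: mult_left_mono)
      also have "C * Y * \<delta> = C * \<kappa> / Y ^ 4" using Y by (simp add: \<delta>_def eval_nat_numeral)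
      finally have "norm (zeta_cont (Complex \<sigma> t)) \<ge> norm (zeta_cont (Complex (1 + \<delta>) t)) - C * \<kappa> / Y ^ 4"
        using norm_triangle_ineq2[of "zeta_cont (Complex (1 + \<delta>) t)" "zeta_cont (Complex \<sigma> t)"] by linarith
      moreover have "2 * C * \<kappa> / Y ^ 4 \<le> norm (zeta_cont (Complex (1 + \<delta>) t))" using \<delta>1 by (intro far) auto
      ultimately show ?thesis by (simp add: Y_def)
    qed
  qed
qed

text \<open>On the line of real part 1 the lower bound survives because it does not depend on
  \<sigma>: let \<sigma> tend to 1 from the right with t fixed. At s = 1 itself the value is
  1.\<close>

lemma zeta_reg_nonzero:
  assumes "Re s \<ge> 1"
  shows "zeta_reg s \<noteq> 0"
proof (cases "Re s > 1")
  case True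
  thus ?thesis using zeta_reg_eq[OF True] zeta_nonzero[OF True] by auto
next
  case False
  hence Re: "Re s = 1" using assms by simp
  show ?thesis
  proof (cases "s = 1")
    case True thus ?thesis by (simp add: zeta_reg_1)
  next
    case False
    define t where "t = Im s"
    have t: "\<bar>t\<bar> > 0" using False Re by (auto simp: t_def complex_eq_iff)
    obtain c where c: "c > 0"
      "\<And>\<sigma> u. 1 < \<sigma> \<Longrightarrow> \<sigma> \<le> 2 \<Longrightarrow> \<bar>u\<bar> \<ge> \<bar>t\<bar> \<Longrightarrow> norm (zeta_cont (Complex \<sigma> u)) \<ge> c / growth u ^ 4"
      using zeta_lower_bound[OF t] by blast
    have "isCont zeta_cont s"
      using holomorphic_on_imp_continuous_on[OF holomorphic_zeta_cont] open_zeta_cont False Re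
      by (auto simp: continuous_on_eq_continuous_at)
    moreover have "s = Complex 1 t" by (simp add: t_def complex_eq_iff Re)
    moreover have "((\<lambda>\<sigma>. Complex \<sigma> t) \<longlongrightarrow> Complex 1 t) (at_right 1)"
      by (intro tendsto_intros)
    ultimately have "((\<lambda>\<sigma>. norm (zeta_cont (Complex \<sigma> t))) \<longlongrightarrow> norm (zeta_cont s)) (at_right 1)"
      by (intro tendsto_norm) (auto intro: isCont_tendsto_compose)
    moreover have "eventually (\<lambda>\<sigma>. norm (zeta_cont (Complex \<sigma> t)) \<ge> c / growth t ^ 4) (at_right 1)"
      using eventually_at_right_real[of 1 2] by (auto elim!: eventually_mono intro!: c(2))
    ultimately have "norm (zeta_cont s) \<ge> c / growth t ^ 4"
      by (rule tendsto_lowerbound) auto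
    moreover have "c / growth t ^ 4 > 0" using c growth_pos[of t] by simp
    ultimately have "zeta_cont s \<noteq> 0" by auto
    moreover have "zeta_reg s = (s - 1) * zeta_cont s" using False by (simp add: zeta_reg_eq' zeta_cont_def field_simps)
    ultimately show ?thesis using False by simp
  qed
qed

subsection \<open>Third derivatives\<close>

lemma Cauchy_third_deriv:
  assumes "f holomorphic_on cball s r" "r > 0" "\<And>z. norm (z - s) \<le> r \<Longrightarrow> norm (f z) \<le> B"
  shows "norm ((deriv ^^ 3) f s) \<le> 6 * B / r ^ 3"
proof -
  have "norm ((deriv ^^ 3) f s) \<le> fact 3 * B / r ^ 3"
  proof (rule Cauchy_inequality)
    show "f holomorphic_on ball s r" using assms(1) by (rule holomorphic_on_subset) auto
    show "continuous_on (cball s r) f" using assms(1) by (rule holomorphic_on_imp_continuous_on)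
    show "norm (f z) \<le> B" if "norm (s - z) = r" for z
      using that by (intro assms(3)) (simp add: norm_minus_commute)
  qed fact
  thus ?thesis by (simp add: fact_numeral)
qed

text \<open>Used for the window around the cut-off, where absolute values destroy the cancellation
  of the poles. The regular part is handled on discs of fixed radius.\<close>

lemma zeta_third_deriv_bound:
  obtains C where "C > 0"
    "\<And>s. 1 < Re s \<Longrightarrow> Re s \<le> 2 \<Longrightarrow> 
       norm (dser (\<lambda>n. ln (real n) ^ 3) s) \<le> 96 / norm (s - 1) ^ 4 + C * (2 + \<bar>Im s\<bar>)"
proof -
  obtain C where C: "C > 0" "\<And>s. Re s \<ge> 1 - 1/40 \<Longrightarrow> Re s \<le> 3 \<Longrightarrow> norm (zeta_diff s) \<le> C * growth (Im s)"
    using zeta_diff_le_growth by auto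
  show ?thesis
  proof (rule that[of "6 * (C * 2) / (1/40) ^ 3"])
    fix s assume s: "1 < Re s" "Re s \<le> 2"
    have s1: "norm (s - 1) > 0" using s by auto
    have "norm ((deriv ^^ 3) zeta_diff s) \<le> 6 * (C * (2 * growth (Im s))) / (1/40) ^ 3"
    proof (rule Cauchy_third_deriv)
      show "zeta_diff holomorphic_on cball s (1/40)"
      proof (rule holomorphic_on_subset[OF holomorphic_zeta_diff])
        show "cball s (1/40) \<subseteq> {s. 0 < Re s}"
        proof
          fix z assume "z \<in> cball s (1/40)"
          hence "norm (z - s) \<le> 1/40" by (simp add: dist_norm norm_minus_commute)
          from Re_Im_near(1)[OF this] s show "z \<in> {s. 0 < Re s}" unfolding mem_Collect_eq by linarith
        qed
      qed
      fix z assume z: "norm (z - s) \<le> 1/40"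
      have "norm (zeta_diff z) \<le> C * growth (Im z)" using Re_Im_near(1)[OF z] s by (intro C(2)) linarith+
      also have "\<dots> \<le> C * (2 * growth (Im s))" using Re_Im_near(2)[OF z] C by (intro mult_left_mono growth_near) auto
      finally show "norm (zeta_diff z) \<le> C * (2 * growth (Im s))" .
    qed auto
    also have "\<dots> \<le> 6 * (C * (2 * (2 + \<bar>Im s\<bar>))) / (1/40) ^ 3"
      using C by (intro divide_right_mono mult_left_mono growth_le) auto
    finally have 1: "norm ((deriv ^^ 3) zeta_diff s) \<le> 6 * (C * 2) / (1/40) ^ 3 * (2 + \<bar>Im s\<bar>)"
      by (simp add: algebra_simps)
    \<comment> \<open>On the disc of half the distance to the pole, 1 / (s - 1) at most doubles, so
      Cauchy's inequality gives 6 * 2 * 2^3 = 96.\<close>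
    have 2: "norm ((deriv ^^ 3) (\<lambda>s. 1 / (s - 1)) s) \<le> 6 * (2 / norm (s - 1)) / (norm (s - 1) / 2) ^ 3"
    proof (rule Cauchy_third_deriv)
      have *: "norm (z - 1) \<ge> norm (s - 1) / 2" if "norm (z - s) \<le> norm (s - 1) / 2" for z
      proof -
        have "norm (s - 1) \<le> norm (z - s) + norm (z - 1)" by norm
        thus ?thesis using that by linarith
      qed
      show "(\<lambda>s. 1 / (s - 1)) holomorphic_on cball s (norm (s - 1) / 2)"
        using * s1 by (intro holomorphic_intros) (fastforce simp: dist_norm norm_minus_commute)
      fix z assume "norm (z - s) \<le> norm (s - 1) / 2"
      from *[OF this] have "1 / norm (z - 1) \<le> 1 / (norm (s - 1) / 2)"
        using s1 by (intro divide_left_mono mult_pos_pos) auto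
      thus "norm (1 / (z - 1)) \<le> 2 / norm (s - 1)" by (simp add: norm_divide)
    qed (use s1 in auto)
    have "(deriv ^^ 3) (dser (\<lambda>_. 1)) s = (deriv ^^ 3) (\<lambda>s. zeta_diff s + 1 / (s - 1)) s"
      using s by (intro higher_deriv_transform_within_open[where S = "{s. Re s > 1}"] open_halfplane holomorphic_dser absconv_one
           holomorphic_intros holomorphic_on_subset[OF holomorphic_zeta_diff]) (auto simp: zeta_eq)
    also have "\<dots> = (deriv ^^ 3) zeta_diff s + (deriv ^^ 3) (\<lambda>s. 1 / (s - 1)) s"
      using s by (intro higher_deriv_add[where S = "{s. Re s > 1}"] open_halfplane
           holomorphic_intros holomorphic_on_subset[OF holomorphic_zeta_diff]) auto
    also have "(deriv ^^ 3) (dser (\<lambda>_. 1)) s = - dser (\<lambda>n. ln (real n) ^ 3) s"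
      using s by (subst higher_deriv_dser[OF absconv_one]) auto
    finally have "norm (dser (\<lambda>n. ln (real n) ^ 3) s) \<le> norm ((deriv ^^ 3) zeta_diff s) + norm ((deriv ^^ 3) (\<lambda>s. 1 / (s - 1)) s)"
      by (metis norm_minus_cancel norm_triangle_ineq)
    also have "\<dots> \<le> 6 * (C * 2) / (1/40) ^ 3 * (2 + \<bar>Im s\<bar>) + 6 * (2 / norm (s - 1)) / (norm (s - 1) / 2) ^ 3"
      using 1 2 by (rule add_mono)
    also have "6 * (2 / norm (s - 1)) / (norm (s - 1) / 2) ^ 3 = 96 / norm (s - 1) ^ 4"
      using s1 by (simp add: power_divide eval_nat_numeral)
    finally show "norm (dser (\<lambda>n. ln (real n) ^ 3) s) \<le> 96 / norm (s - 1) ^ 4 + 6 * (C * 2) / (1/40) ^ 3 * (2 + \<bar>Im s\<bar>)"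
      by linarith
  qed (use C in auto)
qed

section \<open>Bounds for the series of \<Lambda> - 1, weighted by the cube of ln\<close>

lemma absconv_mangoldt_minus_1: "absconv (\<lambda>n. mangoldt n - 1)"
  by (intro absconv_diff absconv_mangoldt absconv_one)

lemma dser_mangoldt_minus_1:
  assumes "Re s > 1"
  shows "dser (\<lambda>n. mangoldt n - 1) s = - deriv (dser (\<lambda>_. 1)) s / dser (\<lambda>_. 1) s - dser (\<lambda>_. 1) s"
  by (simp add: dser_diff absconv_mangoldt absconv_one assms dser_mangoldt_eq)

lemma higher_deriv_mangoldt_minus_1:
  assumes "Re s > 1"
  shows "(deriv ^^ 3) (dser (\<lambda>n. mangoldt n - 1)) s = - dser (\<lambda>n. ln (real n) ^ 3 * (mangoldt n - 1)) s"
  using assms by (subst higher_deriv_dser[OF absconv_mangoldt_minus_1]) auto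

text \<open>The poles of -\<zeta>'/\<zeta> and of \<zeta> at 1 cancel. Written through
  \<open>zeta_reg\<close> and \<open>zeta_diff\<close>, the difference is holomorphic near a closed
  rectangle touching the line of real part 1, because \<open>zeta_reg\<close> has no zero there;
  compactness then bounds the third derivative.\<close>

lemma mangoldt_minus_1_bound_near_real_axis:
  obtains C where "C > 0"
    "\<And>s. 1 < Re s \<Longrightarrow> Re s \<le> 2 \<Longrightarrow> \<bar>Im s\<bar> \<le> 1 \<Longrightarrow>
       norm (dser (\<lambda>n. ln (real n) ^ 3 * (mangoldt n - 1)) s) \<le> C"
proof -
  define U where "U = {s. Re s > 0} \<inter> zeta_reg -` (-{0})"
  define F where "F = (\<lambda>s. - deriv zeta_reg s / zeta_reg s - zeta_diff s)"
  have U: "open U"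
    unfolding U_def
    by (rule continuous_open_preimage[OF holomorphic_on_imp_continuous_on[OF holomorphic_zeta_reg] open_halfplane]) auto
  have hol: "F holomorphic_on U"
    unfolding F_def
    by (intro holomorphic_intros holomorphic_on_subset[OF holomorphic_zeta_diff] 
          holomorphic_on_subset[OF holomorphic_zeta_reg] 
          holomorphic_on_subset[OF holomorphic_deriv[OF holomorphic_zeta_reg open_halfplane]]) (auto simp: U_def)
  define K where "K = cbox (Complex 1 (-1)) (Complex 2 1)"
  have K: "s \<in> K \<longleftrightarrow> 1 \<le> Re s \<and> Re s \<le> 2 \<and> -1 \<le> Im s \<and> Im s \<le> 1" for s
    by (auto simp: K_def in_cbox_complex_iff)
  have KU: "K \<subseteq> U" using zeta_reg_nonzero by (auto simp: U_def K)
  have "continuous_on K ((deriv ^^ 3) F)"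
    by (intro holomorphic_on_imp_continuous_on holomorphic_on_subset[OF holomorphic_higher_deriv[OF hol U] KU])
  hence "bounded ((deriv ^^ 3) F ` K)"
    by (intro compact_imp_bounded compact_continuous_image) (auto simp: K_def)
  then obtain B where B: "B > 0" "\<And>s. s \<in> K \<Longrightarrow> norm ((deriv ^^ 3) F s) \<le> B"
    by (auto simp: bounded_pos)
  show ?thesis
  proof (rule that[of B])
    fix s assume s: "1 < Re s" "Re s \<le> 2" "\<bar>Im s\<bar> \<le> 1"
    define S where "S = {s. Re s > 1}"
    have "(deriv ^^ 3) (dser (\<lambda>n. mangoldt n - 1)) s = (deriv ^^ 3) F s"
    proof (rule higher_deriv_transform_within_open[where S = S])
      show "dser (\<lambda>n. mangoldt n - 1) holomorphic_on S" unfolding S_def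
        by (intro holomorphic_dser absconv_mangoldt_minus_1)
      show "F holomorphic_on S" using hol by (rule holomorphic_on_subset) (auto simp: S_def U_def dest: zeta_reg_nonzero[OF less_imp_le])
      show "open S" "s \<in> S" using s by (auto simp: S_def open_halfplane)
      fix w assume "w \<in> S"
      hence w: "Re w > 1" by (simp add: S_def)
      hence w1: "w \<noteq> 1" by auto
      have "deriv zeta_reg w = deriv (\<lambda>w. (w - 1) * dser (\<lambda>_. 1) w) w"
        by (rule complex_derivative_transform_within_open[where s = S])
           (use w in \<open>auto simp: S_def open_halfplane zeta_reg_eq intro!: holomorphic_intros holomorphic_dser absconv_one
              intro: holomorphic_on_subset[OF holomorphic_zeta_reg]\<close>)
      also have "\<dots> = dser (\<lambda>_. 1) w + (w - 1) * deriv (dser (\<lambda>_. 1)) w"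
        using holomorphic_derivI[OF holomorphic_dser[OF absconv_one] open_halfplane, of w] w
        by (intro DERIV_imp_deriv) (auto intro!: derivative_eq_intros)
      \<comment> \<open>The factor w - 1 adds 1 / (w - 1) to the logarithmic derivative, exactly the
        summand by which \<zeta> exceeds \<open>zeta_diff\<close>.\<close>
      finally have d: "deriv zeta_reg w / zeta_reg w = 1 / (w - 1) + deriv (dser (\<lambda>_. 1)) w / dser (\<lambda>_. 1) w"
        using w1 zeta_nonzero[OF w] by (simp add: zeta_reg_eq[OF w] add_divide_distrib)
      show "dser (\<lambda>n. mangoldt n - 1) w = F w"
        unfolding dser_mangoldt_minus_1[OF w] F_def using d zeta_eq[OF w] by simp
    qed
    moreover have "norm ((deriv ^^ 3) F s) \<le> B" using s by (intro B) (auto simp: K)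
    ultimately show "norm (dser (\<lambda>n. ln (real n) ^ 3 * (mangoldt n - 1)) s) \<le> B"
      using higher_deriv_mangoldt_minus_1[OF s(1)] by (metis norm_minus_cancel)
  qed fact
qed

text \<open>The lower bound for \<zeta> extends to a disc of radius r about s, even across the line
  of real part 1, at the cost of a factor 2. There F is O(Y^5), and r^3 in the denominator
  contributes Y^15.\<close>

lemma mangoldt_minus_1_bound_away_from_real_axis:
  obtains C where "C > 0"
    "\<And>s. 1 < Re s \<Longrightarrow> Re s \<le> 2 \<Longrightarrow> \<bar>Im s\<bar> \<ge> 1 \<Longrightarrow>
       norm (dser (\<lambda>n. ln (real n) ^ 3 * (mangoldt n - 1)) s) \<le> C * (2 + \<bar>Im s\<bar>)"
proof -
  obtain c where c: "c > 0"
    "\<And>\<sigma> t. 1 < \<sigma> \<Longrightarrow> \<sigma> \<le> 2 \<Longrightarrow> \<bar>t\<bar> \<ge> 1 \<Longrightarrow> norm (zeta_cont (Complex \<sigma> t)) \<ge> c / growth t ^ 4"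
    using zeta_lower_bound[of 1] by auto
  obtain C1 where C1: "C1 \<ge> 1" 
    "\<And>s. Re s \<ge> 1 - 1/40 \<Longrightarrow> Re s \<le> 3 \<Longrightarrow> norm (s - 1) \<ge> 1/2 \<Longrightarrow> norm (zeta_cont s) \<le> C1 * growth (Im s)"
    using zeta_cont_bound[of "1/2"] by auto
  obtain C2 where C2: "C2 \<ge> 1" 
    "\<And>s. Re s \<ge> 1 - 1/80 \<Longrightarrow> Re s \<le> 5/2 \<Longrightarrow> norm (s - 1) \<ge> 1/2 \<Longrightarrow> norm (deriv zeta_cont s) \<le> C2 * growth (Im s)"
    using deriv_zeta_cont_bound[of "1/2"] by auto
  \<comment> \<open>On the disc \<zeta> varies by at most 2 C2 Y r = 2 C2 \<kappa> / Y^4, which must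
    not exceed half of c / Y^4.\<close>
  define \<kappa> where "\<kappa> = min (1/80) (c / (4 * C2))"
  have \<kappa>: "\<kappa> > 0" "\<kappa> \<le> 1/80" "\<kappa> \<le> c / (4 * C2)" using c C2 by (auto simp: \<kappa>_def)
  have \<kappa>3: "2 * C2 * \<kappa> \<le> c / 2" using \<kappa>(3) C2 by (simp add: field_simps)
  define M where "M = 4 * C2 / c + 2 * C1"
  have M: "M > 0" using C1 C2 c by (simp add: M_def add_pos_pos)
  show ?thesis
  proof (rule that[of "6 * M / \<kappa> ^ 3"])
    show "6 * M / \<kappa> ^ 3 > 0" using M \<kappa> by simp
    fix s assume s: "1 < Re s" "Re s \<le> 2" "\<bar>Im s\<bar> \<ge> 1"
    define Y where "Y = growth (Im s)"
    have Y: "Y \<ge> 1" unfolding Y_def by (rule growth_ge_1)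
    define r where "r = \<kappa> / Y ^ 5"
    have r: "r > 0" using Y \<kappa> by (simp add: r_def)
    have "r \<le> \<kappa>" unfolding r_def using Y \<kappa> by (simp add: divide_le_eq mult_left_le one_le_power)
    hence r1: "r \<le> 1/80" using \<kappa> by linarith
    have near: "Re z \<ge> 1 - 1/80 \<and> Re z \<le> 5/2 \<and> norm (z - 1) \<ge> 1/2 \<and> growth (Im z) \<le> 2 * Y" if "norm (z - s) \<le> r" for z
    proof -
      have "\<bar>Im z\<bar> \<ge> 1/2" using Re_Im_near(2)[OF that] s r1 by auto
      moreover have "\<bar>Im (z - 1)\<bar> \<le> norm (z - 1)" by (rule abs_Im_le_cmod)
      ultimately have "norm (z - 1) \<ge> 1/2" by simp
      moreover have "growth (Im z) \<le> 2 * Y" unfolding Y_def using Re_Im_near(2)[OF that] r1 by (intro growth_near) auto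
      ultimately show ?thesis using Re_Im_near(1)[OF that] s r1 by auto
    qed
    have near': "Re z > 0 \<and> z \<noteq> 1" if "norm (z - s) \<le> r" for z using near[OF that] by auto
    have d: "norm (deriv zeta_cont z) \<le> 2 * C2 * Y" if "norm (z - s) \<le> r" for z
    proof -
      have "norm (deriv zeta_cont z) \<le> C2 * growth (Im z)" using near[OF that] by (intro C2) auto
      also have "\<dots> \<le> C2 * (2 * Y)" using near[OF that] C2 by (intro mult_left_mono) auto
      finally show ?thesis by simp
    qed
    have low: "norm (zeta_cont z) \<ge> c / 2 / Y ^ 4" if z: "norm (z - s) \<le> r" for z
    proof -
      have "norm (zeta_cont s - zeta_cont z) \<le> (2 * C2 * Y) * norm (s - z)"
      proof (rule zeta_cont_diff_bound)
        fix w assume "w \<in> closed_segment s z"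
        also have "closed_segment s z \<subseteq> cball s r"
          using z r by (intro closed_segment_subset) (auto simp: dist_norm norm_minus_commute)
        finally have "norm (w - s) \<le> r" by (simp add: dist_norm norm_minus_commute)
        thus "0 < Re w \<and> w \<noteq> 1 \<and> norm (deriv zeta_cont w) \<le> 2 * C2 * Y"
          using near' d by auto
      qed
      also have "\<dots> \<le> (2 * C2 * Y) * r" using z C2 Y by (intro mult_left_mono) (auto simp: norm_minus_commute)
      also have "\<dots> = (2 * C2 * \<kappa>) / Y ^ 4" using Y by (simp add: r_def eval_nat_numeral)
      also have "\<dots> \<le> (c / 2) / Y ^ 4" using \<kappa>3 Y by (intro divide_right_mono) auto
      finally have "norm (zeta_cont z) \<ge> norm (zeta_cont s) - c / 2 / Y ^ 4"
        using norm_triangle_ineq2[of "zeta_cont s" "zeta_cont z"] by linarith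
      moreover have "norm (zeta_cont s) \<ge> c / Y ^ 4"
        using c(2)[of "Re s" "Im s"] s by (simp add: Y_def)
      ultimately show ?thesis by simp
    qed
    have nz: "zeta_cont z \<noteq> 0" if "norm (z - s) \<le> r" for z
    proof -
      have "c / 2 / Y ^ 4 > 0" using c Y by simp
      with low[OF that] show ?thesis by auto
    qed
    define F where "F = (\<lambda>s. - deriv zeta_cont s / zeta_cont s - zeta_cont s)"
    have "norm ((deriv ^^ 3) F s) \<le> 6 * (M * Y ^ 5) / r ^ 3"
    proof (rule Cauchy_third_deriv)
      have sub: "cball s r \<subseteq> {s. 0 < Re s} - {1}"
      proof
        fix z assume "z \<in> cball s r"
        hence "norm (z - s) \<le> r" by (simp add: dist_norm norm_minus_commute)
        from near'[OF this] show "z \<in> {s. 0 < Re s} - {1}" by simp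
      qed
      show "F holomorphic_on cball s r"
        unfolding F_def
        by (intro holomorphic_intros holomorphic_on_subset[OF holomorphic_zeta_cont sub] 
             holomorphic_on_subset[OF holomorphic_deriv[OF holomorphic_zeta_cont open_zeta_cont] sub])
           (use nz in \<open>auto simp: dist_norm norm_minus_commute\<close>)
      show "r > 0" by fact
      fix z assume z: "norm (z - s) \<le> r"
      have "norm (deriv zeta_cont z / zeta_cont z) \<le> (2 * C2 * Y) / (c / 2 / Y ^ 4)"
        unfolding norm_divide using d[OF z] low[OF z] c Y C2 by (intro frac_le) auto
      also have "\<dots> = 4 * C2 / c * Y ^ 5" using Y c by (simp add: eval_nat_numeral)
      finally have 1: "norm (deriv zeta_cont z / zeta_cont z) \<le> 4 * C2 / c * Y ^ 5" .
      have "norm (zeta_cont z) \<le> C1 * growth (Im z)" using near[OF z] by (intro C1) auto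
      also have "\<dots> \<le> C1 * (2 * Y)" using near[OF z] C1 by (intro mult_left_mono) auto
      also have "\<dots> \<le> C1 * (2 * Y ^ 5)" using C1 Y self_le_power[of Y 5] by (intro mult_left_mono) auto
      finally have 2: "norm (zeta_cont z) \<le> C1 * (2 * Y ^ 5)" .
      have "norm (F z) \<le> norm (deriv zeta_cont z / zeta_cont z) + norm (zeta_cont z)"
        unfolding F_def using norm_triangle_ineq4[of "- deriv zeta_cont z / zeta_cont z" "zeta_cont z"] by simp
      thus "norm (F z) \<le> M * Y ^ 5" using 1 2 by (simp add: M_def algebra_simps)
    qed
    also have "\<dots> = 6 * M / \<kappa> ^ 3 * Y ^ 20"
      using Y \<kappa> by (simp add: r_def power_divide power_mult[symmetric] eval_nat_numeral)
    also have "Y ^ 20 = 2 + \<bar>Im s\<bar>" by (simp add: Y_def growth_power_20)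
    finally have bd: "norm ((deriv ^^ 3) F s) \<le> 6 * M / \<kappa> ^ 3 * (2 + \<bar>Im s\<bar>)" .
    define S where "S = {s. Re s > 1}"
    have dz: "deriv zeta_cont w = deriv (dser (\<lambda>_. 1)) w" if "w \<in> S" for w
      by (rule complex_derivative_transform_within_open[where s = S])
         (use that in \<open>auto simp: S_def open_halfplane zeta_cont_eq intro!: holomorphic_dser absconv_one
              intro: holomorphic_on_subset[OF holomorphic_zeta_cont]\<close>)
    have "(deriv ^^ 3) (dser (\<lambda>n. mangoldt n - 1)) s = (deriv ^^ 3) F s"
    proof (rule higher_deriv_transform_within_open[where S = S])
      show "dser (\<lambda>n. mangoldt n - 1) holomorphic_on S" unfolding S_def
        by (intro holomorphic_dser absconv_mangoldt_minus_1)
      show "F holomorphic_on S" unfolding F_def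
        by (intro holomorphic_intros holomorphic_on_subset[OF holomorphic_zeta_cont] 
             holomorphic_on_subset[OF holomorphic_deriv[OF holomorphic_zeta_cont open_zeta_cont]])
           (auto simp: S_def zeta_cont_eq zeta_nonzero)
      show "open S" "s \<in> S" using s by (auto simp: S_def open_halfplane)
      show "dser (\<lambda>n. mangoldt n - 1) w = F w" if "w \<in> S" for w
        using that unfolding F_def dz[OF that] by (simp add: S_def dser_mangoldt_minus_1 zeta_cont_eq)
    qed
    with bd show "norm (dser (\<lambda>n. ln (real n) ^ 3 * (mangoldt n - 1)) s) \<le> 6 * M / \<kappa> ^ 3 * (2 + \<bar>Im s\<bar>)"
      using higher_deriv_mangoldt_minus_1[OF s(1)] by (metis norm_minus_cancel)
  qed
qed

lemma mangoldt_minus_1_bound: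
  obtains C where "C > 0"
    "\<And>s. 1 < Re s \<Longrightarrow> Re s \<le> 2 \<Longrightarrow>
       norm (dser (\<lambda>n. ln (real n) ^ 3 * (mangoldt n - 1)) s) \<le> C * (2 + \<bar>Im s\<bar>)"
proof -
  obtain C1 where C1: "C1 > 0" "\<And>s. 1 < Re s \<Longrightarrow> Re s \<le> 2 \<Longrightarrow> \<bar>Im s\<bar> \<le> 1 \<Longrightarrow>
       norm (dser (\<lambda>n. ln (real n) ^ 3 * (mangoldt n - 1)) s) \<le> C1"
    using mangoldt_minus_1_bound_near_real_axis by blast
  obtain C2 where C2: "C2 > 0" "\<And>s. 1 < Re s \<Longrightarrow> Re s \<le> 2 \<Longrightarrow> \<bar>Im s\<bar> \<ge> 1 \<Longrightarrow>
       norm (dser (\<lambda>n. ln (real n) ^ 3 * (mangoldt n - 1)) s) \<le> C2 * (2 + \<bar>Im s\<bar>)"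
    using mangoldt_minus_1_bound_away_from_real_axis by blast
  show ?thesis
  proof (rule that[of "C1 + C2"])
    fix s assume s: "1 < Re s" "Re s \<le> 2"
    show "norm (dser (\<lambda>n. ln (real n) ^ 3 * (mangoldt n - 1)) s) \<le> (C1 + C2) * (2 + \<bar>Im s\<bar>)"
    proof (cases "\<bar>Im s\<bar> \<le> 1")
      case True
      have "C1 * 1 \<le> C1 * (2 + \<bar>Im s\<bar>)" using C1 by (intro mult_left_mono) auto
      moreover have "0 \<le> C2 * (2 + \<bar>Im s\<bar>)" using C2 by (intro mult_nonneg_nonneg) auto
      ultimately show ?thesis using C1(2)[OF s True] by (simp only: distrib_right)
    next
      case False
      have "0 \<le> C1 * (2 + \<bar>Im s\<bar>)" using C1 by (intro mult_nonneg_nonneg) auto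
      thus ?thesis using C2(2)[OF s] False by (simp only: distrib_right) linarith
    qed
  qed (use C1 C2 in auto)
qed

subsection \<open>Gaussian averages\<close>

abbreviation gauss :: "real measure" where "gauss \<equiv> std_normal_distribution"

interpretation gauss: prob_space gauss
  using real_dist_normal_dist by (simp add: real_distribution_def)

text \<open>The phase turns n^(-iTt) into exp (i u t) with u = T ln (y / n), whose mean is the
  characteristic function exp (- u^2 / 2) of the standard normal distribution. Sum and mean may be
  swapped since \<sigma> > 1 and the phases have modulus 1.\<close>

lemma gauss_series:
  assumes b: "absconv b" and \<sigma>: "\<sigma> > 1" and y: "y > 0"
  shows "complex_of_real (\<Sum>n. b n * real n powr (-\<sigma>) * exp (- (T * ln (y / real n))\<^sup>2 / 2)) =
           (LINT t|gauss. dser b (Complex \<sigma> (T * t)) * iexp (T * ln y * t))" (is ?th1)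
    and "integrable gauss (\<lambda>t. dser b (Complex \<sigma> (T * t)) * iexp (T * ln y * t))" (is ?th2)
    and "summable (\<lambda>n. b n * real n powr (-\<sigma>) * exp (- (T * ln (y / real n))\<^sup>2 / 2))" (is ?th3)
proof -
  define w where "w = (\<lambda>n. b n * real n powr (-\<sigma>))"
  define u where "u = (\<lambda>n. T * ln (y / real n))"
  define f where "f = (\<lambda>n t. complex_of_real (w n) * iexp (u n * t))"
  have f_eq: "complex_of_real (b n) * of_nat n powr (- Complex \<sigma> (T * t)) * iexp (T * ln y * t) = f n t" for n t
  proof (cases "n = 0")
    case False
    have "of_nat n powr (- Complex \<sigma> (T * t)) = exp (of_real (-\<sigma> * ln (real n)) + \<i> * of_real (- T * t * ln (real n)))"
      using False by (simp add: powr_def Ln_of_nat Complex_eq algebra_simps)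
    also have "\<dots> = of_real (exp (-\<sigma> * ln (real n))) * iexp (- T * t * ln (real n))"
      by (simp only: exp_add exp_of_real)
    also have "exp (-\<sigma> * ln (real n)) = real n powr (-\<sigma>)" using False by (simp add: powr_def)
    finally have "of_nat n powr (- Complex \<sigma> (T * t)) * iexp (T * ln y * t) = 
        of_real (real n powr (-\<sigma>)) * (iexp (- T * t * ln (real n)) * iexp (T * ln y * t))" by simp
    also have "iexp (- T * t * ln (real n)) * iexp (T * ln y * t) = iexp (u n * t)"
      using False y by (simp add: u_def ln_div exp_add[symmetric] algebra_simps)
    finally show ?thesis by (simp add: f_def w_def)
  qed (simp add: f_def w_def)
  have norm_f: "norm (f n t) = \<bar>w n\<bar>" for n t
    by (simp add: f_def norm_mult)
  have summ: "summable (\<lambda>n. \<bar>w n\<bar>)"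
    using absconvD[OF b \<sigma>] by (simp add: w_def abs_mult)
  have int: "integrable gauss (f n)" for n
    by (rule gauss.integrable_const_bound[of _ "\<bar>w n\<bar>"]) (auto simp: norm_f, simp add: f_def)
  have 1: "integrable gauss (\<lambda>t. \<Sum>n. f n t)" "(\<lambda>n. LINT t|gauss. f n t) sums (LINT t|gauss. (\<Sum>n. f n t))"
    using summ int by (auto intro!: integrable_suminf sums_integral simp: norm_f gauss.prob_space)
  have dser: "dser b (Complex \<sigma> (T * t)) * iexp (T * ln y * t) = (\<Sum>n. f n t)" for t
  proof -
    have "(\<lambda>n. f n t) sums (dser b (Complex \<sigma> (T * t)) * iexp (T * ln y * t))"
      using sums_mult2[OF absconv_sums[OF b, of "Complex \<sigma> (T * t)"], of "iexp (T * ln y * t)"] \<sigma>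
      unfolding f_eq by simp
    thus ?thesis by (rule sums_unique)
  qed
  have int_f: "(LINT t|gauss. f n t) = complex_of_real (w n * exp (- (u n)\<^sup>2 / 2))" for n
    using fun_cong[OF char_std_normal_distribution, of "u n"] unfolding char_def by (simp add: f_def)
  have "(\<lambda>n. Re (complex_of_real (w n * exp (- (u n)\<^sup>2 / 2)))) sums Re (LINT t|gauss. (\<Sum>n. f n t))"
    using 1(2) unfolding int_f by (rule sums_Re)
  thus ?th3 by (simp add: w_def u_def sums_iff)
  have "complex_of_real (\<Sum>n. w n * exp (- (u n)\<^sup>2 / 2)) = (LINT t|gauss. (\<Sum>n. f n t))"
    using 1(2) \<open>?th3\<close> unfolding int_f sums_iff w_def u_def by (subst suminf_of_real) auto
  thus ?th1 unfolding dser w_def u_def by (simp only:)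
  show ?th2 using 1(1) unfolding dser .
qed

text \<open>The point y enters only through a phase of modulus 1, so the bound is uniform in
  y.\<close>

lemma gauss_series_bound:
  assumes b: "absconv b" and \<sigma>: "\<sigma> > 1" and y: "y > 0"
    and G: "integrable gauss G" "\<And>t. norm (dser b (Complex \<sigma> (T * t))) \<le> G t"
  shows "\<bar>\<Sum>n. b n * real n powr (-\<sigma>) * exp (- (T * ln (y / real n))\<^sup>2 / 2)\<bar> \<le> (LINT t|gauss. G t)"
proof -
  have "\<bar>\<Sum>n. b n * real n powr (-\<sigma>) * exp (- (T * ln (y / real n))\<^sup>2 / 2)\<bar> = 
     norm (LINT t|gauss. dser b (Complex \<sigma> (T * t)) * iexp (T * ln y * t))"
    unfolding gauss_series(1)[OF b \<sigma> y, symmetric] by (simp only: norm_of_real)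
  also have "\<dots> \<le> (LINT t|gauss. norm (dser b (Complex \<sigma> (T * t)) * iexp (T * ln y * t)))"
    by (rule integral_norm_bound)
  also have "\<dots> \<le> (LINT t|gauss. G t)"
    using G(2) by (intro integral_mono integrable_norm gauss_series(2) b \<sigma> y G(1)) (auto simp: norm_mult)
  finally show ?thesis .
qed

section \<open>Gaussian means of linear growth and of the pole\<close>

lemma integrable_gauss_abs: "integrable gauss (\<lambda>t. \<bar>t\<bar>)"
  using integrable_abs[OF integrable_std_normal_distribution_moment[of 1]] by simp

lemma gauss_abs_le: "(LINT t|gauss. \<bar>t\<bar>) \<le> 2"
proof -
  have "(LINT t|gauss. \<bar>t\<bar>) \<le> (LINT t|gauss. 1 + t ^ 2)"
  proof (rule integral_mono)
    show "\<bar>t\<bar> \<le> 1 + t ^ 2" for t :: real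
      using zero_le_power2[of "\<bar>t\<bar> - 1"] unfolding power2_diff power2_abs by simp
  qed (intro integrable_gauss_abs Bochner_Integration.integrable_add integrable_std_normal_distribution_moment gauss.integrable_const)+
  also have "\<dots> = (LINT t|gauss. 1) + (LINT t|gauss. t ^ 2)"
    by (intro Bochner_Integration.integral_add gauss.integrable_const integrable_std_normal_distribution_moment)
  also have "\<dots> = 2"
    using std_normal_distribution_even_moments(1)[of 1]
    by (simp only: gauss.prob_space lebesgue_integral_const) simp
  finally show ?thesis .
qed

text \<open>The density is at most 1, and one of the two factors \<delta>^2 + T^2 t^2 is lowered to
  \<delta>^2. What remains is 1 / (1 + u^2) at u = T t / \<delta>, with integral \<pi>; the
  substitution turns \<delta>^(-4) into \<delta>^(-3) / T.\<close>

lemma gauss_pole_bound: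
  assumes "\<delta> > 0" "T > 0"
  shows "integrable gauss (\<lambda>t. 1 / norm (Complex \<delta> (T * t)) ^ 4)"
    and "(LINT t|gauss. 1 / norm (Complex \<delta> (T * t)) ^ 4) \<le> pi / (\<delta> ^ 3 * T)"
proof -
  define K where "K = (\<lambda>x::real. inverse (1 + x\<^sup>2))"
  have K: "integrable lborel K" "(LINT x|lborel. K x) = pi"
    using integrable_inverse_1_plus_square LBINT_inverse_1_plus_square
    unfolding K_def by (simp_all add: set_integrable_def interval_lebesgue_integral_def set_lebesgue_integral_def)
  define c where "c = T / \<delta>"
  have c: "c > 0" using assms by (simp add: c_def)
  have "pi = c * (LINT t|lborel. K (0 + c * t))"
    using lborel_integral_real_affine[of c K 0] c K(2) by simp
  hence K': "integrable lborel (\<lambda>t. K (0 + c * t))" "(LINT t|lborel. K (0 + c * t)) = pi / c"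
    using lborel_integrable_real_affine[OF K(1), of c 0] c by (auto simp: eq_divide_eq mult.commute)
  have meas: "(\<lambda>t. 1 / norm (Complex \<delta> (T * t)) ^ 4) \<in> borel_measurable borel"
    unfolding cmod_def by simp
  have le: "std_normal_density t * (1 / norm (Complex \<delta> (T * t)) ^ 4) \<le> 1 / \<delta> ^ 4 * K (0 + c * t)" for t
  proof -
    have "std_normal_density t \<le> 1 * exp 0"
      unfolding std_normal_density_def using pi_ge_two by (intro mult_mono) (auto simp: real_le_rsqrt)
    hence d: "std_normal_density t \<le> 1" by simp
    have e: "norm (Complex \<delta> (T * t)) ^ 4 = (\<delta>\<^sup>2 + (T * t)\<^sup>2)\<^sup>2"
      unfolding cmod_power2[symmetric, of "Complex \<delta> (T * t)", simplified complex.sel] by (simp flip: power_mult)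
    have "std_normal_density t * (1 / norm (Complex \<delta> (T * t)) ^ 4) \<le> 1 * (1 / (\<delta>\<^sup>2 + (T * t)\<^sup>2)\<^sup>2)"
      unfolding e using d by (intro mult_right_mono) auto
    also have "\<dots> \<le> 1 / (\<delta>\<^sup>2 * (\<delta>\<^sup>2 + (T * t)\<^sup>2))"
      using assms by (auto simp: power2_eq_square intro!: divide_left_mono mult_right_mono mult_pos_pos add_pos_nonneg)
    also have "\<delta>\<^sup>2 * (\<delta>\<^sup>2 + (T * t)\<^sup>2) = \<delta> ^ 4 * (1 + (c * t)\<^sup>2)"
      using assms by (simp add: c_def power_mult_distrib power_divide field_simps eval_nat_numeral)
    finally show ?thesis by (simp add: K_def divide_inverse)
  qed
  have int: "integrable lborel (\<lambda>t. std_normal_density t * (1 / norm (Complex \<delta> (T * t)) ^ 4))"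
  proof (rule Bochner_Integration.integrable_bound)
    show "integrable lborel (\<lambda>t. 1 / \<delta> ^ 4 * K (0 + c * t))" using K'(1) by (rule integrable_mult_right)
    show "AE t in lborel. norm (std_normal_density t * (1 / norm (Complex \<delta> (T * t)) ^ 4)) \<le> norm (1 / \<delta> ^ 4 * K (0 + c * t))"
    proof (rule AE_I2)
      fix t
      have "norm (std_normal_density t * (1 / norm (Complex \<delta> (T * t)) ^ 4)) = std_normal_density t * (1 / norm (Complex \<delta> (T * t)) ^ 4)"
        by (simp add: normal_density_nonneg)
      also note le
      also have "1 / \<delta> ^ 4 * K (0 + c * t) \<le> norm (1 / \<delta> ^ 4 * K (0 + c * t))"
        by (simp only: real_norm_def abs_ge_self)
      finally show "norm (std_normal_density t * (1 / norm (Complex \<delta> (T * t)) ^ 4)) \<le> norm (1 / \<delta> ^ 4 * K (0 + c * t))" .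
    qed
    show "(\<lambda>t. std_normal_density t * (1 / norm (Complex \<delta> (T * t)) ^ 4)) \<in> borel_measurable lborel"
      using meas by (intro borel_measurable_times) auto
  qed
  thus "integrable gauss (\<lambda>t. 1 / norm (Complex \<delta> (T * t)) ^ 4)"
    using meas by (subst integrable_real_density) (auto simp: normal_density_nonneg)
  have "(LINT t|gauss. 1 / norm (Complex \<delta> (T * t)) ^ 4) = (LINT t|lborel. std_normal_density t * (1 / norm (Complex \<delta> (T * t)) ^ 4))"
    using meas by (subst integral_real_density) (auto simp: normal_density_nonneg)
  also have "\<dots> \<le> (LINT t|lborel. 1 / \<delta> ^ 4 * K (0 + c * t))"
    using int K'(1) le by (intro integral_mono integrable_mult_right) auto
  also have "\<dots> = 1 / \<delta> ^ 4 * (pi / c)" using K' by (subst integral_mult_right_zero) auto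
  also have "\<dots> = pi / (\<delta> ^ 3 * T)" using assms by (simp add: c_def eval_nat_numeral)
  finally show "(LINT t|gauss. 1 / norm (Complex \<delta> (T * t)) ^ 4) \<le> pi / (\<delta> ^ 3 * T)" .
qed

lemma gauss_lin_integral:
  assumes "T \<ge> 1" "C \<ge> 0"
  shows "integrable gauss (\<lambda>t. C * (2 + \<bar>T * t\<bar>))" "(LINT t|gauss. C * (2 + \<bar>T * t\<bar>)) \<le> 4 * C * T"
proof -
  have eq: "\<bar>T * t\<bar> = T * \<bar>t\<bar>" for t using assms by (simp add: abs_mult)
  show "integrable gauss (\<lambda>t. C * (2 + \<bar>T * t\<bar>))"
    unfolding eq
    by (intro integrable_mult_right Bochner_Integration.integrable_add gauss.integrable_const integrable_gauss_abs)
  have "(LINT t|gauss. 2 + T * \<bar>t\<bar>) = (LINT t|gauss. 2) + (LINT t|gauss. T * \<bar>t\<bar>)"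
    by (intro Bochner_Integration.integral_add integrable_mult_right gauss.integrable_const integrable_gauss_abs)
  also have "\<dots> = 2 + T * (LINT t|gauss. \<bar>t\<bar>)"
    by (simp only: integral_mult_right_zero gauss.prob_space lebesgue_integral_const) simp
  finally have "(LINT t|gauss. 2 + T * \<bar>t\<bar>) = 2 + T * (LINT t|gauss. \<bar>t\<bar>)" .
  hence "(LINT t|gauss. C * (2 + \<bar>T * t\<bar>)) = C * (2 + T * (LINT t|gauss. \<bar>t\<bar>))"
    unfolding eq by (simp only: integral_mult_right_zero)
  also have "\<dots> \<le> C * (2 * T + T * 2)"
    using assms gauss_abs_le by (intro mult_left_mono add_mono) auto
  finally show "(LINT t|gauss. C * (2 + \<bar>T * t\<bar>)) \<le> 4 * C * T" by simp
qed

lemma mangoldt_minus_1_gauss: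
  obtains C where "C > 0" "\<And>\<sigma> T y. 1 < \<sigma> \<Longrightarrow> \<sigma> \<le> 2 \<Longrightarrow> T \<ge> 1 \<Longrightarrow> y > 0 \<Longrightarrow>
    \<bar>\<Sum>n. ln (real n) ^ 3 * (mangoldt n - 1) * real n powr (-\<sigma>) * exp (- (T * ln (y / real n))\<^sup>2 / 2)\<bar> \<le> C * T"
proof -
  obtain C where C: "C > 0" "\<And>s. 1 < Re s \<Longrightarrow> Re s \<le> 2 \<Longrightarrow>
       norm (dser (\<lambda>n. ln (real n) ^ 3 * (mangoldt n - 1)) s) \<le> C * (2 + \<bar>Im s\<bar>)"
    using mangoldt_minus_1_bound by blast
  show ?thesis
  proof (rule that[of "4 * C"])
    fix \<sigma> T y :: real assume *: "1 < \<sigma>" "\<sigma> \<le> 2" "T \<ge> 1" "y > 0"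
    have "\<bar>\<Sum>n. ln (real n) ^ 3 * (mangoldt n - 1) * real n powr (-\<sigma>) * exp (- (T * ln (y / real n))\<^sup>2 / 2)\<bar> \<le>
       (LINT t|gauss. C * (2 + \<bar>T * t\<bar>))"
      using * C gauss_lin_integral[of T C]
      by (intro gauss_series_bound absconv_ln_power absconv_mangoldt_minus_1) (auto intro: order_trans[OF C(2)])
    also have "\<dots> \<le> 4 * C * T" using * C by (intro gauss_lin_integral) auto
    finally show "\<bar>\<Sum>n. ln (real n) ^ 3 * (mangoldt n - 1) * real n powr (-\<sigma>) * exp (- (T * ln (y / real n))\<^sup>2 / 2)\<bar> \<le> 4 * C * T" .
  qed (use C in auto)
qed

lemma absconv_mangoldt_plus_1: "absconv (\<lambda>n. mangoldt n + 1)"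
  by (intro absconv_add absconv_mangoldt absconv_one)

text \<open>A majorant for the absolute values of the coefficients. Since \<Lambda> + 1 = (\<Lambda>
  - 1) + 2, the previous bound serves for the first part and the pole enters only through two copies
  of the third derivative of \<zeta>, whence 192 = 2 * 96.\<close>

lemma mangoldt_plus_1_gauss:
  obtains C where "C > 0" "\<And>\<sigma> T y. 1 < \<sigma> \<Longrightarrow> \<sigma> \<le> 2 \<Longrightarrow> T \<ge> 1 \<Longrightarrow> y > 0 \<Longrightarrow>
    (\<Sum>n. ln (real n) ^ 3 * (mangoldt n + 1) * real n powr (-\<sigma>) * exp (- (T * ln (y / real n))\<^sup>2 / 2)) 
      \<le> C * (T + 1 / ((\<sigma> - 1) ^ 3 * T))"
proof -
  obtain C1 where C1: "C1 > 0" "\<And>s. 1 < Re s \<Longrightarrow> Re s \<le> 2 \<Longrightarrow>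
       norm (dser (\<lambda>n. ln (real n) ^ 3 * (mangoldt n - 1)) s) \<le> C1 * (2 + \<bar>Im s\<bar>)"
    using mangoldt_minus_1_bound by blast
  obtain C2 where C2: "C2 > 0" "\<And>s. 1 < Re s \<Longrightarrow> Re s \<le> 2 \<Longrightarrow> 
       norm (dser (\<lambda>n. ln (real n) ^ 3) s) \<le> 96 / norm (s - 1) ^ 4 + C2 * (2 + \<bar>Im s\<bar>)"
    using zeta_third_deriv_bound by blast
  define D where "D = C1 + 2 * C2"
  have D: "D > 0" using C1 C2 by (simp add: D_def)
  show ?thesis
  proof (rule that[of "4 * D + 192 * pi"])
    show "4 * D + 192 * pi > 0" using D by (simp add: add_pos_pos)
    fix \<sigma> T y :: real assume *: "1 < \<sigma>" "\<sigma> \<le> 2" "T \<ge> 1" "y > 0"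
    define G where "G = (\<lambda>t. D * (2 + \<bar>T * t\<bar>) + 192 * (1 / norm (Complex (\<sigma> - 1) (T * t)) ^ 4))"
    have int1: "integrable gauss (\<lambda>t. D * (2 + \<bar>T * t\<bar>))" using * D by (intro gauss_lin_integral) auto
    have int2: "integrable gauss (\<lambda>t. 192 * (1 / norm (Complex (\<sigma> - 1) (T * t)) ^ 4))"
      using * by (intro integrable_mult_right gauss_pole_bound) auto
    have "\<bar>\<Sum>n. ln (real n) ^ 3 * (mangoldt n + 1) * real n powr (-\<sigma>) * exp (- (T * ln (y / real n))\<^sup>2 / 2)\<bar> \<le> (LINT t|gauss. G t)"
    proof (intro gauss_series_bound absconv_ln_power absconv_mangoldt_plus_1)
      show "integrable gauss G" unfolding G_def using int1 int2 by (rule Bochner_Integration.integrable_add)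
      fix t
      define s where "s = Complex \<sigma> (T * t)"
      have s: "Re s > 1" "Re s \<le> 2" using * by (auto simp: s_def)
      have ac: "absconv (\<lambda>n. ln (real n) ^ 3)" using absconv_ln_power[OF absconv_one, of 3] by simp
      have "dser (\<lambda>n. ln (real n) ^ 3 * (mangoldt n + 1)) s = 
            dser (\<lambda>n. ln (real n) ^ 3 * (mangoldt n - 1) + (ln (real n) ^ 3 + ln (real n) ^ 3)) s"
        by (intro arg_cong2[where f = dser] ext) (simp_all add: algebra_simps)
      also have "\<dots> = dser (\<lambda>n. ln (real n) ^ 3 * (mangoldt n - 1)) s + (dser (\<lambda>n. ln (real n) ^ 3) s + dser (\<lambda>n. ln (real n) ^ 3) s)"
        unfolding dser_add[OF absconv_ln_power[OF absconv_mangoldt_minus_1] absconv_add[OF ac ac] s(1)]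
          dser_add[OF ac ac s(1)] ..
      finally have "norm (dser (\<lambda>n. ln (real n) ^ 3 * (mangoldt n + 1)) s) \<le> 
          norm (dser (\<lambda>n. ln (real n) ^ 3 * (mangoldt n - 1)) s) + (norm (dser (\<lambda>n. ln (real n) ^ 3) s) + norm (dser (\<lambda>n. ln (real n) ^ 3) s))"
        by (simp only:) (meson add_left_mono norm_triangle_ineq order_trans)
      also have "\<dots> \<le> C1 * (2 + \<bar>Im s\<bar>) + ((96 / norm (s - 1) ^ 4 + C2 * (2 + \<bar>Im s\<bar>)) + (96 / norm (s - 1) ^ 4 + C2 * (2 + \<bar>Im s\<bar>)))"
        using s by (intro add_mono C1 C2)
      also have "s - 1 = Complex (\<sigma> - 1) (T * t)" by (simp add: s_def complex_eq_iff)
      finally show "norm (dser (\<lambda>n. ln (real n) ^ 3 * (mangoldt n + 1)) (Complex \<sigma> (T * t))) \<le> G t"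
        by (simp add: s_def G_def D_def algebra_simps)
    qed (use * in auto)
    also have "(LINT t|gauss. G t) = (LINT t|gauss. D * (2 + \<bar>T * t\<bar>)) + (LINT t|gauss. 192 * (1 / norm (Complex (\<sigma> - 1) (T * t)) ^ 4))"
      unfolding G_def using int1 int2 by (rule Bochner_Integration.integral_add)
    also have "(LINT t|gauss. 192 * (1 / norm (Complex (\<sigma> - 1) (T * t)) ^ 4)) = 192 * (LINT t|gauss. 1 / norm (Complex (\<sigma> - 1) (T * t)) ^ 4)"
      by (rule integral_mult_right_zero)
    also have "(LINT t|gauss. D * (2 + \<bar>T * t\<bar>)) + \<dots> \<le> 4 * D * T + 192 * (pi / ((\<sigma> - 1) ^ 3 * T))"
      using * D by (intro add_mono mult_left_mono gauss_lin_integral(2) gauss_pole_bound(2)) auto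
    also have "\<dots> \<le> (4 * D + 192 * pi) * (T + 1 / ((\<sigma> - 1) ^ 3 * T))"
    proof -
      have "0 \<le> 4 * D * (1 / ((\<sigma> - 1) ^ 3 * T))" "0 \<le> 192 * pi * T" using D * by auto
      thus ?thesis by (simp add: algebra_simps)
    qed
    finally show "(\<Sum>n. ln (real n) ^ 3 * (mangoldt n + 1) * real n powr (-\<sigma>) * exp (- (T * ln (y / real n))\<^sup>2 / 2)) 
      \<le> (4 * D + 192 * pi) * (T + 1 / ((\<sigma> - 1) ^ 3 * T))" by linarith
  qed
qed

subsection \<open>From Gaussian averages to sharp cut-offs\<close>

text \<open>Logarithmic coordinates: with w = ln (x / n) and y = x exp (- v), the Gaussian factor of
  the average at y is centred at v = w. The factor exp (- \<sigma> v) weights the integration over y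
  < x, that is, v > 0.\<close>

definition gkernel :: "real \<Rightarrow> real \<Rightarrow> real \<Rightarrow> real \<Rightarrow> real" where
  "gkernel \<sigma> T w v = exp (- \<sigma> * v - (T * (w - v))\<^sup>2 / 2)"

text \<open>The integral of \<open>gkernel \<sigma> T 0\<close> over the real line.\<close>

definition gmass :: "real \<Rightarrow> real \<Rightarrow> real" where
  "gmass \<sigma> T = exp (\<sigma>\<^sup>2 / (2 * T\<^sup>2)) * sqrt (2 * pi) / T"

text \<open>Completing the square: the exponential weight moves the centre of the Gaussian by
  \<sigma> / T^2 and leaves \<open>gmass\<close> as a constant.\<close>

lemma gkernel_eq_density:
  assumes "T > 0"
  shows "gkernel \<sigma> T w v = exp (- \<sigma> * w) * gmass \<sigma> T * normal_density (w - \<sigma> / T\<^sup>2) (1 / T) v"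
proof -
  have "sqrt (2 * pi * (1 / T)\<^sup>2) = sqrt (2 * pi) / T"
    using assms by (simp add: real_sqrt_mult real_sqrt_divide power_divide)
  hence "exp (- \<sigma> * w) * gmass \<sigma> T * normal_density (w - \<sigma> / T\<^sup>2) (1 / T) v =
        exp (- \<sigma> * w) * exp (\<sigma>\<^sup>2 / (2 * T\<^sup>2)) * exp (- (v - (w - \<sigma> / T\<^sup>2))\<^sup>2 / (2 * (1 / T)\<^sup>2))"
    using assms by (simp add: normal_density_def gmass_def)
  also have "\<dots> = exp (- \<sigma> * w + \<sigma>\<^sup>2 / (2 * T\<^sup>2) + - (v - (w - \<sigma> / T\<^sup>2))\<^sup>2 / (2 * (1 / T)\<^sup>2))"
    by (simp only: exp_add)
  also have "- \<sigma> * w + \<sigma>\<^sup>2 / (2 * T\<^sup>2) + - (v - (w - \<sigma> / T\<^sup>2))\<^sup>2 / (2 * (1 / T)\<^sup>2) = - \<sigma> * v - (T * (w - v))\<^sup>2 / 2"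
    using assms by (simp add: field_simps power2_eq_square)
  finally show ?thesis by (simp add: gkernel_def)
qed

lemma gmass_pos: "T > 0 \<Longrightarrow> gmass \<sigma> T > 0"
  by (simp add: gmass_def)

text \<open>Dividing by the mass therefore costs at most a factor T, the price of undoing the
  smoothing in \<open>gauss_to_sharp\<close>.\<close>

lemma gmass_ge: 
  assumes "T > 0"
  shows "gmass \<sigma> T \<ge> 1 / T"
proof -
  have "1 * 1 \<le> exp (\<sigma>\<^sup>2 / (2 * T\<^sup>2)) * sqrt (2 * pi)"
    using pi_ge_two by (intro mult_mono) auto
  thus ?thesis using assms by (simp add: gmass_def divide_right_mono)
qed

lemma integrable_gkernel:
  assumes "T > 0"
  shows "integrable lborel (gkernel \<sigma> T w)"
  unfolding gkernel_eq_density[OF assms, abs_def] using assms by (intro integrable_mult_right integrable_normal_density) auto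

lemma integral_gkernel:
  assumes "T > 0"
  shows "(LINT v|lborel. gkernel \<sigma> T w v) = exp (- \<sigma> * w) * gmass \<sigma> T"
  unfolding gkernel_eq_density[OF assms] integral_mult_right_zero using assms by (subst integral_normal_density) auto

text \<open>For v and w on opposite sides of 0, the square of w - v is at least the sum of the
  squares.\<close>

lemma gkernel_le:
  assumes "v * w \<le> 0"
  shows "gkernel \<sigma> T w v \<le> exp (- (T * w)\<^sup>2 / 2) * gkernel \<sigma> T 0 v"
proof -
  have "- (T * (w - v))\<^sup>2 / 2 = - (T * w)\<^sup>2 / 2 - (T * v)\<^sup>2 / 2 + T\<^sup>2 * (v * w)"
    by (simp add: power2_eq_square field_simps)
  moreover have "T\<^sup>2 * (v * w) \<le> 0" by (rule mult_nonneg_nonpos[OF zero_le_power2 assms])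
  ultimately have "- \<sigma> * v - (T * (w - v))\<^sup>2 / 2 \<le> - (T * w)\<^sup>2 / 2 + (- \<sigma> * v - (T * (0 - v))\<^sup>2 / 2)"
    by (simp add: power2_eq_square)
  thus ?thesis unfolding gkernel_def exp_add[symmetric] by simp
qed

lemma integrable_gkernel_indicator:
  assumes "T > 0" "A \<in> sets borel"
  shows "integrable lborel (\<lambda>v. indicator A v * gkernel \<sigma> T w v)"
  using integrable_mult_indicator[of A lborel "gkernel \<sigma> T w"] integrable_gkernel[OF assms(1)] assms(2) by simp

text \<open>The half-line integral is a smoothed indicator of w \<ge> 0, the condition n \<le> x.
  The error is in either case the integral over the side of 0 opposite to w, where
  \<open>gkernel_le\<close> splits off the Gaussian in w.\<close>

lemma gkernel_integral_bound:
  assumes T: "T > 0"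
  shows "\<bar>(LINT v|lborel. indicator {0..} v * gkernel \<sigma> T w v) - (if w \<ge> 0 then exp (- \<sigma> * w) * gmass \<sigma> T else 0)\<bar>
          \<le> gmass \<sigma> T * exp (- (T * w)\<^sup>2 / 2)"
proof -
  have *: "(LINT v|lborel. indicator A v * gkernel \<sigma> T w v) \<le> gmass \<sigma> T * exp (- (T * w)\<^sup>2 / 2)"
    if A: "A \<in> sets borel" "\<And>v. v \<in> A \<Longrightarrow> v * w \<le> 0" for A
  proof -
    have "(LINT v|lborel. indicator A v * gkernel \<sigma> T w v) \<le> (LINT v|lborel. exp (- (T * w)\<^sup>2 / 2) * gkernel \<sigma> T 0 v)"
    proof (rule integral_mono)
      show "indicator A v * gkernel \<sigma> T w v \<le> exp (- (T * w)\<^sup>2 / 2) * gkernel \<sigma> T 0 v" for v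
        using gkernel_le[of v w \<sigma> T] A(2)[of v] by (auto simp: indicator_def gkernel_def)
    qed (use T A in \<open>auto intro!: integrable_gkernel integrable_gkernel_indicator integrable_mult_right\<close>)
    also have "\<dots> = exp (- (T * w)\<^sup>2 / 2) * gmass \<sigma> T"
      unfolding integral_mult_right_zero integral_gkernel[OF T] by simp
    finally show ?thesis by (simp add: mult.commute)
  qed
  have nonneg: "(LINT v|lborel. indicator A v * gkernel \<sigma> T w v) \<ge> 0" for A
    by (intro Bochner_Integration.integral_nonneg) (auto simp: gkernel_def)
  show ?thesis
  proof (cases "w \<ge> 0")
    case True
    have "exp (- \<sigma> * w) * gmass \<sigma> T = (LINT v|lborel. indicator {0..} v * gkernel \<sigma> T w v + indicator {..<0} v * gkernel \<sigma> T w v)"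
      unfolding integral_gkernel[OF T, symmetric] by (intro Bochner_Integration.integral_cong) (auto simp: indicator_def)
    also have "\<dots> = (LINT v|lborel. indicator {0..} v * gkernel \<sigma> T w v) + (LINT v|lborel. indicator {..<0} v * gkernel \<sigma> T w v)"
      by (intro Bochner_Integration.integral_add integrable_gkernel_indicator T) auto
    finally have "(LINT v|lborel. indicator {0..} v * gkernel \<sigma> T w v) - exp (- \<sigma> * w) * gmass \<sigma> T = 
       - (LINT v|lborel. indicator {..<0} v * gkernel \<sigma> T w v)" by simp
    moreover have "(LINT v|lborel. indicator {..<0} v * gkernel \<sigma> T w v) \<le> gmass \<sigma> T * exp (- (T * w)\<^sup>2 / 2)"
      using True by (intro *) (auto simp: mult_le_0_iff)
    ultimately show ?thesis using True nonneg[of "{..<0}"] by simp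
  next
    case False
    have "(LINT v|lborel. indicator {0..} v * gkernel \<sigma> T w v) \<le> gmass \<sigma> T * exp (- (T * w)\<^sup>2 / 2)"
      using False by (intro *) (auto simp: mult_le_0_iff)
    thus ?thesis using False nonneg[of "{0..}"] by simp
  qed
qed

lemma exp_half_line:
  assumes "\<sigma> > (0::real)"
  shows "integrable lborel (\<lambda>v. indicator {0..} v * exp (- \<sigma> * v))" "(LINT v|lborel. indicator {0..} v * exp (- \<sigma> * v)) = 1 / \<sigma>"
proof -
  have "(\<integral>\<^sup>+v. ennreal (exp (- \<sigma> * v)) * indicator {0..} v \<partial>lborel) = ennreal (0 - (- exp (- \<sigma> * 0) / \<sigma>))"
  proof (rule nn_integral_FTC_atLeast)
    show "((\<lambda>v. - exp (- \<sigma> * v) / \<sigma>) has_real_derivative exp (- \<sigma> * v)) (at v)" for v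
      using assms by (auto intro!: derivative_eq_intros)
    show "((\<lambda>v. - exp (- \<sigma> * v) / \<sigma>) \<longlongrightarrow> 0) at_top" using assms by real_asymp
  qed auto
  also have "(\<integral>\<^sup>+v. ennreal (exp (- \<sigma> * v)) * indicator {0..} v \<partial>lborel) = (\<integral>\<^sup>+v. ennreal (indicator {0..} v * exp (- \<sigma> * v)) \<partial>lborel)"
    by (intro nn_integral_cong) (auto simp: indicator_def)
  finally have "has_bochner_integral lborel (\<lambda>v. indicator {0..} v * exp (- \<sigma> * v)) (1 / \<sigma>)"
    using assms by (intro has_bochner_integral_nn_integral) auto
  thus "integrable lborel (\<lambda>v. indicator {0..} v * exp (- \<sigma> * v))" "(LINT v|lborel. indicator {0..} v * exp (- \<sigma> * v)) = 1 / \<sigma>"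
    by (auto simp: has_bochner_integral_iff)
qed

text \<open>The double expression \<open>f n v\<close> is evaluated in both orders. Summing over n
  first gives the average at x exp (- v), hence at most W / \<sigma> after integration. Integrating
  over v first gives the sharp sum times x^(-\<sigma>) and the mass, up to Gaussian windows around
  x, which V controls.\<close>

lemma gauss_to_sharp:
  fixes b :: "nat \<Rightarrow> real" and x :: nat
  assumes b: "absconv b" and \<sigma>: "\<sigma> > 1" and T: "T > 0" and x: "x > 0"
    and W: "\<And>y. y > 0 \<Longrightarrow> \<bar>\<Sum>n. b n * real n powr (-\<sigma>) * exp (- (T * ln (y / real n))\<^sup>2 / 2)\<bar> \<le> W"
    and V: "(\<Sum>n. \<bar>b n\<bar> * real n powr (-\<sigma>) * exp (- (T * ln (real x / real n))\<^sup>2 / 2)) \<le> V"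
  shows "\<bar>\<Sum>n=1..x. b n\<bar> \<le> real x powr \<sigma> * (T * W + V)"
proof -
  define c where "c = (\<lambda>n. b n * real n powr (-\<sigma>))"
  define w where "w = (\<lambda>n. ln (real x / real n))"
  define J where "J = gmass \<sigma> T"
  have J: "J > 0" "J \<ge> 1 / T" using gmass_pos gmass_ge T by (auto simp: J_def)
  have summ: "summable (\<lambda>n. \<bar>c n\<bar>)"
    using absconvD[OF b \<sigma>] by (simp add: c_def abs_mult)
  define f where "f = (\<lambda>n v. c n * (indicator {0..} v * gkernel \<sigma> T (w n) v))"
  have norm_f: "norm (f n v) \<le> \<bar>c n\<bar> * (indicator {0..} v * exp (- \<sigma> * v))" for n v
    by (auto simp: f_def abs_mult gkernel_def indicator_def intro!: mult_left_mono)
  have int_f: "integrable lborel (f n)" for n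
    unfolding f_def by (intro integrable_mult_right integrable_gkernel_indicator T) auto
  have int_e: "integrable lborel (\<lambda>v. indicator {0..} v * exp (- \<sigma> * v))" 
              "(LINT v|lborel. indicator {0..} v * exp (- \<sigma> * v)) = 1 / \<sigma>"
    using exp_half_line[of \<sigma>] \<sigma> by auto
  have summ_f: "summable (\<lambda>n. norm (f n v))" for v
    by (rule summable_comparison_test'[OF summable_mult2[OF summ, of "indicator {0..} v * exp (- \<sigma> * v)"], of 0]) 
       (use norm_f in auto)
  have summ_int: "summable (\<lambda>n. LINT v|lborel. norm (f n v))"
  proof (rule summable_comparison_test'[OF summable_mult2[OF summ, of "1 / \<sigma>"], of 0])
    fix n
    have "(LINT v|lborel. norm (f n v)) \<le> (LINT v|lborel. \<bar>c n\<bar> * (indicator {0..} v * exp (- \<sigma> * v)))"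
      by (intro integral_mono integrable_norm int_f integrable_mult_right int_e norm_f)
    also have "\<dots> = \<bar>c n\<bar> * (1 / \<sigma>)" unfolding integral_mult_right_zero int_e(2) ..
    finally show "norm (LINT v|lborel. norm (f n v)) \<le> \<bar>c n\<bar> * (1 / \<sigma>)" by simp
  qed
  define M where "M = (LINT v|lborel. (\<Sum>n. f n v))"
  have M: "(\<lambda>n. LINT v|lborel. f n v) sums M" "integrable lborel (\<lambda>v. \<Sum>n. f n v)"
    unfolding M_def using summ_f summ_int int_f by (auto intro!: sums_integral integrable_suminf)
  have sum_f: "\<bar>\<Sum>n. f n v\<bar> \<le> W * (indicator {0..} v * exp (- \<sigma> * v))" for v
  proof (cases "v \<ge> 0")
    case True
    have "f n v = exp (- \<sigma> * v) * (c n * exp (- (T * ln (real x * exp (-v) / real n))\<^sup>2 / 2))" for n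
    proof (cases "n = 0")
      case False
      hence "ln (real x * exp (-v) / real n) = w n - v" using x by (simp add: w_def ln_div ln_mult)
      note L = this
      have "exp (- \<sigma> * v - (T * (w n - v))\<^sup>2 / 2) = exp (- \<sigma> * v) * exp (- (T * (w n - v))\<^sup>2 / 2)"
        unfolding exp_add[symmetric] by simp
      thus ?thesis unfolding L f_def gkernel_def using True by simp
    qed (simp add: f_def c_def)
    hence "(\<Sum>n. f n v) = (\<Sum>n. exp (- \<sigma> * v) * (c n * exp (- (T * ln (real x * exp (-v) / real n))\<^sup>2 / 2)))" by simp
    also have "\<dots> = exp (- \<sigma> * v) * (\<Sum>n. c n * exp (- (T * ln (real x * exp (-v) / real n))\<^sup>2 / 2))"
    proof (rule suminf_mult)
      show "summable (\<lambda>n. c n * exp (- (T * ln (real x * exp (-v) / real n))\<^sup>2 / 2))"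
        by (rule summable_comparison_test'[OF summ, of 0]) (auto simp: abs_mult intro!: mult_left_le)
    qed
    finally have "\<bar>\<Sum>n. f n v\<bar> = exp (- \<sigma> * v) * \<bar>\<Sum>n. c n * exp (- (T * ln (real x * exp (-v) / real n))\<^sup>2 / 2)\<bar>"
      by (simp only: abs_mult abs_exp_cancel)
    also have "\<dots> \<le> exp (- \<sigma> * v) * W"
      unfolding c_def using x by (intro mult_left_mono W) auto
    finally show ?thesis using True by (simp add: mult.commute)
  qed (simp add: f_def)
  have W0: "W \<ge> 0" using W[of 1] by (meson abs_ge_zero order_trans zero_less_one)
  have "\<bar>M\<bar> \<le> (LINT v|lborel. \<bar>\<Sum>n. f n v\<bar>)" unfolding M_def by (rule integral_abs_bound)
  also have "\<dots> \<le> (LINT v|lborel. W * (indicator {0..} v * exp (- \<sigma> * v)))"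
    by (intro integral_mono integrable_abs M integrable_mult_right int_e sum_f)
  also have "\<dots> = W * (1 / \<sigma>)" unfolding integral_mult_right_zero int_e(2) ..
  also have "\<dots> \<le> W" using \<sigma> W0 mult_left_mono[of "1 / \<sigma>" 1 W] by simp
  finally have M_le: "\<bar>M\<bar> \<le> W" .
  have 1: "(\<lambda>n. if n \<in> {1..x} then b n * (real x powr (-\<sigma>) * J) else 0) sums (\<Sum>n=1..x. b n * (real x powr (-\<sigma>) * J))"
    by (rule sums_If_finite_set) auto
  have 2: "(if n \<in> {1..x} then b n * (real x powr (-\<sigma>) * J) else 0) = c n * (if w n \<ge> 0 then exp (- \<sigma> * w n) * J else 0)" for n
  proof (cases "n = 0")
    case False
    have "w n \<ge> 0 \<longleftrightarrow> n \<le> x" unfolding w_def using False x by (subst ln_ge_zero_iff) (auto simp: field_simps)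
    \<comment> \<open>The purpose of the weight exp (- \<sigma> v): it cancels the damping
      n^(-\<sigma>), so all n \<le> x receive the same factor.\<close>
    moreover have "real n powr (-\<sigma>) * exp (- \<sigma> * w n) = real x powr (-\<sigma>)"
      using False x by (simp add: w_def powr_def ln_div exp_add[symmetric] algebra_simps)
    ultimately show ?thesis using False by (auto simp: c_def)
  qed (simp add: c_def)
  define e where "e = (\<lambda>n. exp (- (T * w n)\<^sup>2 / 2))"
  have summ_ce: "summable (\<lambda>n. \<bar>c n\<bar> * e n)"
    by (intro summable_comparison_test'[OF summ, of 0]) (auto simp: abs_mult e_def intro!: mult_left_le)
  have summ_e: "summable (\<lambda>n. J * (\<bar>c n\<bar> * e n))" by (rule summable_mult[OF summ_ce])
  have "(\<lambda>n. (LINT v|lborel. f n v) - (if n \<in> {1..x} then b n * (real x powr (-\<sigma>) * J) else 0)) sums 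
           (M - (\<Sum>n=1..x. b n * (real x powr (-\<sigma>) * J)))"
    by (intro sums_diff M 1)
  moreover have dif: "norm ((LINT v|lborel. f n v) - (if n \<in> {1..x} then b n * (real x powr (-\<sigma>) * J) else 0)) \<le> J * (\<bar>c n\<bar> * e n)" for n
  proof -
    have "(LINT v|lborel. f n v) - (if n \<in> {1..x} then b n * (real x powr (-\<sigma>) * J) else 0) =
       c n * ((LINT v|lborel. indicator {0..} v * gkernel \<sigma> T (w n) v) - (if w n \<ge> 0 then exp (- \<sigma> * w n) * J else 0))"
      unfolding 2 f_def integral_mult_right_zero by (simp only: right_diff_distrib)
    also have "norm \<dots> \<le> \<bar>c n\<bar> * (J * e n)"
      unfolding real_norm_def abs_mult J_def e_def by (intro mult_left_mono gkernel_integral_bound T) auto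
    finally show ?thesis by (simp only: mult_ac)
  qed
  ultimately have "norm (M - (\<Sum>n=1..x. b n * (real x powr (-\<sigma>) * J))) \<le> (\<Sum>n. J * (\<bar>c n\<bar> * e n))"
    using norm_suminf_le[OF dif summ_e] by (simp only: sums_iff)
  also have "\<dots> = J * (\<Sum>n. \<bar>c n\<bar> * e n)"
    by (rule suminf_mult[OF summ_ce])
  also have "(\<Sum>n. \<bar>c n\<bar> * e n) \<le> V"
    using V by (simp add: c_def e_def w_def abs_mult)
  finally have "\<bar>M - (\<Sum>n=1..x. b n * (real x powr (-\<sigma>) * J))\<bar> \<le> J * V" using J by simp
  hence "\<bar>\<Sum>n=1..x. b n * (real x powr (-\<sigma>) * J)\<bar> \<le> W + J * V" using M_le by linarith
  also have "W \<le> J * (T * W)"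
  proof -
    have "1 \<le> J * T" using J T by (simp add: field_simps)
    thus ?thesis using mult_right_mono[OF _ W0, of 1 "J * T"] by (simp add: mult.assoc)
  qed
  also have "(\<Sum>n=1..x. b n * (real x powr (-\<sigma>) * J)) = (\<Sum>n=1..x. b n) * (real x powr (-\<sigma>) * J)"
    by (rule sum_distrib_right[symmetric])
  finally have "J * (real x powr (-\<sigma>) * \<bar>\<Sum>n=1..x. b n\<bar>) \<le> J * (T * W + V)"
    using J by (simp add: abs_mult algebra_simps)
  hence "real x powr (-\<sigma>) * \<bar>\<Sum>n=1..x. b n\<bar> \<le> T * W + V" using J by simp
  thus ?thesis using x by (simp add: powr_minus field_simps)
qed

subsection \<open>The prime number theorem with error term\<close>

lemma ln_ge_1: "n \<ge> 3 \<Longrightarrow> ln (real n) \<ge> 1"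
proof -
  assume n: "n \<ge> 3"
  have "exp 1 \<le> (3::real)" by (rule exp_le)
  hence "exp 1 \<le> real n" using n by linarith
  thus ?thesis using n by (subst ln_ge_iff) auto
qed

lemma sum_ln3_mangoldt_bound:
  obtains C where "C > 0" 
    "\<And>x. x \<ge> 3 \<Longrightarrow> \<bar>\<Sum>n=1..x. ln (real n) ^ 3 * (mangoldt n - 1)\<bar> \<le> C * (real x * ln (real x) ^ 2)"
proof -
  obtain C1 where C1: "C1 > 0" "\<And>\<sigma> T y. 1 < \<sigma> \<Longrightarrow> \<sigma> \<le> 2 \<Longrightarrow> T \<ge> 1 \<Longrightarrow> y > 0 \<Longrightarrow>
    \<bar>\<Sum>n. ln (real n) ^ 3 * (mangoldt n - 1) * real n powr (-\<sigma>) * exp (- (T * ln (y / real n))\<^sup>2 / 2)\<bar> \<le> C1 * T"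
    using mangoldt_minus_1_gauss by blast
  obtain C2 where C2: "C2 > 0" "\<And>\<sigma> T y. 1 < \<sigma> \<Longrightarrow> \<sigma> \<le> 2 \<Longrightarrow> T \<ge> 1 \<Longrightarrow> y > 0 \<Longrightarrow>
    (\<Sum>n. ln (real n) ^ 3 * (mangoldt n + 1) * real n powr (-\<sigma>) * exp (- (T * ln (y / real n))\<^sup>2 / 2)) 
      \<le> C2 * (T + 1 / ((\<sigma> - 1) ^ 3 * T))"
    using mangoldt_plus_1_gauss by blast
  show ?thesis
  proof (rule that[of "exp 1 * (C1 + 2 * C2)"])
    fix x :: nat assume x: "x \<ge> 3"
    define L where "L = ln (real x)"
    have L: "L \<ge> 1" unfolding L_def using x by (rule ln_ge_1)
    \<comment> \<open>Then x^\<sigma> = e x, while the window term (\<sigma> - 1)^(-3) / L is L^2,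
      the same order as T W with T = L.\<close>
    define \<sigma> where "\<sigma> = 1 + 1 / L"
    have \<sigma>: "\<sigma> > 1" "\<sigma> \<le> 2" using L by (auto simp: \<sigma>_def)
    have "\<bar>\<Sum>n=1..x. ln (real n) ^ 3 * (mangoldt n - 1)\<bar> \<le> real x powr \<sigma> * (L * (C1 * L) + C2 * (L + 1 / ((\<sigma> - 1) ^ 3 * L)))"
    proof (rule gauss_to_sharp)
      have sm: "summable (\<lambda>n. \<bar>ln (real n) ^ 3 * (mangoldt n - 1)\<bar> * real n powr (-\<sigma>) * exp (- (L * ln (real x / real n))\<^sup>2 / 2))"
        by (rule summable_comparison_test'[OF absconvD[OF absconv_ln_power[OF absconv_mangoldt_minus_1] \<sigma>(1), of 3], of 0])
           (auto simp: abs_mult intro!: mult_left_le)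
      have "(\<Sum>n. \<bar>ln (real n) ^ 3 * (mangoldt n - 1)\<bar> * real n powr (-\<sigma>) * exp (- (L * ln (real x / real n))\<^sup>2 / 2))
         \<le> (\<Sum>n. ln (real n) ^ 3 * (mangoldt n + 1) * real n powr (-\<sigma>) * exp (- (L * ln (real x / real n))\<^sup>2 / 2))"
      proof (intro suminf_le sm gauss_series(3) absconv_ln_power absconv_mangoldt_plus_1 \<sigma>)
        fix n
        show "\<bar>ln (real n) ^ 3 * (mangoldt n - 1)\<bar> * real n powr (-\<sigma>) * exp (- (L * ln (real x / real n))\<^sup>2 / 2)
             \<le> ln (real n) ^ 3 * (mangoldt n + 1) * real n powr (-\<sigma>) * exp (- (L * ln (real x / real n))\<^sup>2 / 2)"
        proof (cases "n = 0")
          case False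
          hence "\<bar>ln (real n) ^ 3 * (mangoldt n - 1)\<bar> \<le> ln (real n) ^ 3 * (mangoldt n + 1)"
            using mangoldt_nonneg[of n] by (auto simp: abs_mult intro!: mult_left_mono)
          thus ?thesis by (intro mult_right_mono) auto
        qed auto
      qed (use x in auto)
      also have "\<dots> \<le> C2 * (L + 1 / ((\<sigma> - 1) ^ 3 * L))"
        using x by (intro C2 \<sigma> L) auto
      finally show "(\<Sum>n. \<bar>ln (real n) ^ 3 * (mangoldt n - 1)\<bar> * real n powr (-\<sigma>) * exp (- (L * ln (real x / real n))\<^sup>2 / 2)) 
        \<le> C2 * (L + 1 / ((\<sigma> - 1) ^ 3 * L))" .
    qed (use C1(2) \<sigma> L x in \<open>auto intro!: absconv_ln_power absconv_mangoldt_minus_1\<close>)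
    also have "real x powr \<sigma> = exp 1 * real x"
      using x L by (simp add: \<sigma>_def powr_add) (simp add: powr_def L_def)
    also have "1 / ((\<sigma> - 1) ^ 3 * L) = L ^ 2"
      using L by (simp add: \<sigma>_def power_divide eval_nat_numeral)
    also have "exp 1 * real x * (L * (C1 * L) + C2 * (L + L ^ 2)) \<le> exp 1 * real x * (L * (C1 * L) + C2 * (L ^ 2 + L ^ 2))"
      using self_le_power[of L 2] L C1(1) C2(1) by (intro mult_left_mono add_mono) auto
    finally show "\<bar>\<Sum>n=1..x. ln (real n) ^ 3 * (mangoldt n - 1)\<bar> \<le> exp 1 * (C1 + 2 * C2) * (real x * ln (real x) ^ 2)"
      unfolding L_def[symmetric] by (simp add: algebra_simps power2_eq_square)
  qed (use C1 C2 in auto)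
qed

section \<open>Elementary estimates and partial summation\<close>

lemma ln_power_le_sqrt:
  assumes "N \<ge> 1"
  shows "ln (real N) ^ 2 \<le> 16 * sqrt (real N)" "ln (real N) ^ 3 \<le> 216 * sqrt (real N)"
proof -
  have N: "real N > 0" "ln (real N) \<ge> 0" using assms by auto
  \<comment> \<open>The exponents 1/4 and 1/6 make the square and the cube a square root; the
    constants are 4^2 and 6^3.\<close>
  have "ln (real N) \<le> real N powr (1/4) / (1/4)" using assms by (intro ln_powr_bound) auto
  hence "ln (real N) ^ 2 \<le> (real N powr (1/4) / (1/4)) ^ 2" using N by (intro power_mono) auto
  also have "\<dots> = 16 * sqrt (real N)" using N by (simp add: power_mult_distrib powr_power powr_half_sqrt)
  finally show "ln (real N) ^ 2 \<le> 16 * sqrt (real N)" .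
  have "ln (real N) \<le> real N powr (1/6) / (1/6)" using assms by (intro ln_powr_bound) auto
  hence "ln (real N) ^ 3 \<le> (real N powr (1/6) / (1/6)) ^ 3" using N by (intro power_mono) auto
  also have "\<dots> = 216 * sqrt (real N)" using N by (simp add: power_mult_distrib powr_power powr_half_sqrt)
  finally show "ln (real N) ^ 3 \<le> 216 * sqrt (real N)" .
qed

lemma card_le_sqrt: "real (card {n \<in> {1..N}. real n \<le> sqrt (real N)}) \<le> sqrt (real N)"
proof -
  have "{n \<in> {1..N}. real n \<le> sqrt (real N)} \<subseteq> {1..nat \<lfloor>sqrt (real N)\<rfloor>}"
    by (auto simp: le_nat_floor)
  hence "card {n \<in> {1..N}. real n \<le> sqrt (real N)} \<le> nat \<lfloor>sqrt (real N)\<rfloor>"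
    by (metis card_atLeastAtMost card_mono diff_Suc_1 finite_atLeastAtMost)
  also have "real (nat \<lfloor>sqrt (real N)\<rfloor>) \<le> sqrt (real N)" by simp
  finally show ?thesis by simp
qed

lemma sqrt_le_div_ln2: "N \<ge> 3 \<Longrightarrow> sqrt (real N) \<le> 16 * (real N / ln (real N) ^ 2)"
proof -
  assume N: "N \<ge> 3"
  have "sqrt (real N) * ln (real N) ^ 2 \<le> sqrt (real N) * (16 * sqrt (real N))"
    using N by (intro mult_left_mono ln_power_le_sqrt) auto
  also have "\<dots> = 16 * real N" by simp
  finally show ?thesis using ln_ge_1[OF N] by (simp add: field_simps)
qed

text \<open>Split at sqrt N: below, each summand is at most 1; above, ln n is at least half of ln N.
  The two parts give 16 and 4.\<close>

lemma sum_inverse_ln2: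
  assumes N: "N \<ge> 3"
  shows "(\<Sum>n=3..N. 1 / ln (real n) ^ 2) \<le> 20 * (real N / ln (real N) ^ 2)"
proof -
  have L: "ln (real N) \<ge> 1" by (rule ln_ge_1[OF N])
  have "(\<Sum>n=3..N. 1 / ln (real n) ^ 2) \<le> (\<Sum>n=3..N. (if real n \<le> sqrt (real N) then 1 else 0) + 4 / ln (real N) ^ 2)"
  proof (rule sum_mono)
    fix n assume n: "n \<in> {3..N}"
    have l: "ln (real n) \<ge> 1" using n by (intro ln_ge_1) auto
    show "1 / ln (real n) ^ 2 \<le> (if real n \<le> sqrt (real N) then 1 else 0) + 4 / ln (real N) ^ 2"
    proof (cases "real n \<le> sqrt (real N)")
      case True
      have "1 / ln (real n) ^ 2 \<le> 1" using one_le_power[OF l, of 2] by (simp add: divide_le_eq_1)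
      moreover have "0 \<le> 4 / ln (real N) ^ 2" by simp
      ultimately show ?thesis unfolding if_P[OF True] by linarith
    next
      case False
      have "ln (real N) / 2 = ln (sqrt (real N))" using N by (simp add: ln_sqrt)
      also have "\<dots> \<le> ln (real n)" using False N n by (subst ln_le_cancel_iff) auto
      finally have "(ln (real N) / 2) ^ 2 \<le> ln (real n) ^ 2" using L by (intro power_mono) auto
      hence "1 / ln (real n) ^ 2 \<le> 1 / (ln (real N) / 2) ^ 2" using L l by (intro divide_left_mono) auto
      thus ?thesis using False by (simp add: power_divide)
    qed
  qed
  also have "\<dots> = (\<Sum>n=3..N. (if real n \<le> sqrt (real N) then 1 else 0)) + real (card {3..N}) * (4 / ln (real N) ^ 2)"
    by (simp add: sum.distrib)
  also have "(\<Sum>n=3..N. (if real n \<le> sqrt (real N) then 1 else 0)) \<le> sqrt (real N)"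
  proof -
    have "(\<Sum>n=3..N. (if real n \<le> sqrt (real N) then 1 else 0)) = real (card {n \<in> {3..N}. real n \<le> sqrt (real N)})"
      by (subst sum.inter_filter[symmetric]) auto
    also have "\<dots> \<le> real (card {n \<in> {1..N}. real n \<le> sqrt (real N)})"
      by (intro of_nat_mono card_mono) auto
    also note card_le_sqrt
    finally show ?thesis .
  qed
  also have "sqrt (real N) \<le> 16 * (real N / ln (real N) ^ 2)" by (rule sqrt_le_div_ln2[OF N])
  also have "real (card {3..N}) * (4 / ln (real N) ^ 2) \<le> real N * (4 / ln (real N) ^ 2)"
    by (intro mult_right_mono) auto
  finally show ?thesis by simp
qed

text \<open>The weighted sum starts at m because the weights 1 / ln n make no sense at n = 1,
  whereas the partial sums of b are known from 1 on.\<close>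

lemma summation_by_parts:
  fixes b g :: "nat \<Rightarrow> real"
  assumes "m \<ge> 1" "N \<ge> m"
  shows "(\<Sum>n=m..N. b n * g n) = (\<Sum>n=1..N. b n) * g N - (\<Sum>n=1..m-1. b n) * g m + (\<Sum>n=m..<N. (\<Sum>k=1..n. b k) * (g n - g (Suc n)))"
  using assms(2)
proof (induction N rule: dec_induct)
  case base
  have "{1..m} = insert m {1..m-1}" using assms(1) by auto
  hence "(\<Sum>n=1..m. b n) = b m + (\<Sum>n=1..m-1. b n)" using assms(1) by simp
  thus ?case by (simp add: algebra_simps)
next
  case (step N)
  thus ?case using assms(1) by (simp add: algebra_simps)
qed

lemma inverse_ln_power_diff:
  assumes n: "n \<ge> 3"
  shows "0 \<le> 1 / ln (real n) ^ k - 1 / ln (real (Suc n)) ^ k"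
    and "1 / ln (real n) ^ k - 1 / ln (real (Suc n)) ^ k \<le> real k / (real n * ln (real n) ^ Suc k)"
proof -
  have l: "ln (real n) \<ge> 1" by (rule ln_ge_1[OF n])
  have "ln (real n) \<le> ln (real (Suc n))" using n by simp
  hence "1 / ln (real (Suc n)) ^ k \<le> 1 / ln (real n) ^ k"
    using l by (intro divide_left_mono power_mono mult_pos_pos zero_less_power) linarith+
  thus "0 \<le> 1 / ln (real n) ^ k - 1 / ln (real (Suc n)) ^ k" by simp
  have "\<exists>z. z > real n \<and> z < real (Suc n) \<and> 1 / ln (real (Suc n)) ^ k - 1 / ln (real n) ^ k = 
          (real (Suc n) - real n) * (- real k / (z * ln z ^ Suc k))"
  proof (rule MVT2)
    fix z assume z: "real n \<le> z" "z \<le> real (Suc n)"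
    have z0: "z > 0" using z n by linarith
    have "ln (real n) \<le> ln z" using z n by (subst ln_le_cancel_iff) auto
    hence lz: "ln z > 0" using l by linarith
    show "((\<lambda>z. 1 / ln z ^ k) has_real_derivative (- real k / (z * ln z ^ Suc k))) (at z)"
    proof (cases k)
      case (Suc j)
      have "((\<lambda>z. ln z ^ Suc j) has_real_derivative (real (Suc j) * ln z ^ j * (1 / z))) (at z)"
        using DERIV_power[OF DERIV_ln_divide[OF z0], of "Suc j"] by (simp del: power_Suc add: mult.commute)
      from DERIV_inverse_fun[OF this] lz
      have "((\<lambda>z. inverse (ln z ^ Suc j)) has_real_derivative
              - (real (Suc j) * ln z ^ j * (1 / z) * inverse ((ln z ^ Suc j) ^ Suc (Suc 0)))) (at z)" by simp
      moreover have "- (real (Suc j) * ln z ^ j * (1 / z) * inverse ((ln z ^ Suc j) ^ Suc (Suc 0))) = - real k / (z * ln z ^ Suc k)"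
        using lz z0 unfolding Suc by (simp add: field_simps)
      ultimately show ?thesis unfolding Suc by (simp add: inverse_eq_divide del: power_Suc)
    qed simp
  qed auto
  then obtain z where z: "z > real n" "z < real (Suc n)"
     "1 / ln (real (Suc n)) ^ k - 1 / ln (real n) ^ k = - real k / (z * ln z ^ Suc k)" by auto
  have "ln (real n) \<le> ln z" using z n by (subst ln_le_cancel_iff) auto
  hence "real n * ln (real n) ^ Suc k \<le> z * ln z ^ Suc k"
    using z l by (intro mult_mono power_mono) auto
  hence "real k / (z * ln z ^ Suc k) \<le> real k / (real n * ln (real n) ^ Suc k)"
    using n l z \<open>ln (real n) \<le> ln z\<close> by (intro divide_left_mono mult_pos_pos zero_less_power) auto
  thus "1 / ln (real n) ^ k - 1 / ln (real (Suc n)) ^ k \<le> real k / (real n * ln (real n) ^ Suc k)"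
    using z(3) by linarith
qed

text \<open>The partial sums carry n ln^j n and the weight differences 1 / (n ln^(j+2) n), so the
  error has the same shape for every j. It is applied with j = 2 to strip the cube of ln and with j
  = 0 to pass from \<Lambda> to primes.\<close>

lemma partial_summation_ln_power:
  fixes b :: "nat \<Rightarrow> real"
  assumes S: "\<And>n. n \<ge> 3 \<Longrightarrow> \<bar>\<Sum>k=1..n. b k\<bar> \<le> C * (real n * ln (real n) ^ j)"
  obtains D where "D > 0" "\<And>N. N \<ge> 3 \<Longrightarrow> \<bar>(\<Sum>n=3..N. b n / ln (real n) ^ Suc j) - (\<Sum>n=1..N. b n) / ln (real N) ^ Suc j\<bar> \<le> D * (real N / ln (real N) ^ 2)"
proof -
  define K where "K = \<bar>(\<Sum>n=1..2. b n) / ln 3 ^ Suc j\<bar>"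
  have C: "C \<ge> 0" 
  proof -
    have "0 \<le> C * (real 3 * ln (real 3) ^ j)" using S[of 3] by linarith
    moreover have "real 3 * ln (real 3) ^ j > 0" using ln_ge_1[of 3] by (intro mult_pos_pos zero_less_power) auto
    ultimately show ?thesis by (meson mult_neg_pos not_le)
  qed
  show ?thesis
  proof (rule that[of "16 * K + 20 * (C * real (Suc j)) + 1"])
    show "16 * K + 20 * (C * real (Suc j)) + 1 > 0" using C unfolding K_def by (intro add_nonneg_pos add_nonneg_nonneg) auto
    fix N :: nat assume N: "N \<ge> 3"
    define Q where "Q = real N / ln (real N) ^ 2"
    have Q: "Q \<ge> 0" by (simp add: Q_def)
    define g where "g = (\<lambda>n. 1 / ln (real n) ^ Suc j)"
    have "\<bar>\<Sum>n=3..<N. (\<Sum>k=1..n. b k) * (g n - g (Suc n))\<bar> \<le> (\<Sum>n=3..<N. \<bar>(\<Sum>k=1..n. b k) * (g n - g (Suc n))\<bar>)"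
      by (rule sum_abs)
    also have "\<dots> \<le> (\<Sum>n=3..<N. C * real (Suc j) * (1 / ln (real n) ^ 2))"
    proof (rule sum_mono)
      fix n assume "n \<in> {3..<N}"
      hence n: "n \<ge> 3" by simp
      have l: "ln (real n) \<ge> 1" by (rule ln_ge_1[OF n])
      have "\<bar>(\<Sum>k=1..n. b k) * (g n - g (Suc n))\<bar> = \<bar>\<Sum>k=1..n. b k\<bar> * (g n - g (Suc n))"
        using inverse_ln_power_diff(1)[OF n, of "Suc j"] by (simp only: abs_mult g_def abs_of_nonneg)
      also have "\<dots> \<le> (C * (real n * ln (real n) ^ j)) * (real (Suc j) / (real n * ln (real n) ^ Suc (Suc j)))"
        using inverse_ln_power_diff[OF n, of "Suc j"] l n C unfolding g_def by (intro mult_mono S) auto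
      also have "\<dots> = C * real (Suc j) * (1 / ln (real n) ^ 2)"
        using n l by (simp add: field_simps power2_eq_square)
      finally show "\<bar>(\<Sum>k=1..n. b k) * (g n - g (Suc n))\<bar> \<le> C * real (Suc j) * (1 / ln (real n) ^ 2)" .
    qed
    also have "\<dots> = C * real (Suc j) * (\<Sum>n=3..<N. 1 / ln (real n) ^ 2)" by (rule sum_distrib_left[symmetric])
    also have "\<dots> \<le> C * real (Suc j) * (\<Sum>n=3..N. 1 / ln (real n) ^ 2)"
      using C by (intro mult_left_mono sum_mono2) auto
    also have "\<dots> \<le> C * real (Suc j) * (20 * Q)"
      unfolding Q_def using C by (intro mult_left_mono sum_inverse_ln2[OF N]) auto
    finally have 1: "\<bar>\<Sum>n=3..<N. (\<Sum>k=1..n. b k) * (g n - g (Suc n))\<bar> \<le> 20 * (C * real (Suc j)) * Q" by simp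
    \<comment> \<open>The boundary term at n = 3 is a constant; it is absorbed by Q via the square
      root.\<close>
    have "1 \<le> sqrt (real N)" using N by simp
    also have "\<dots> \<le> 16 * Q" unfolding Q_def by (rule sqrt_le_div_ln2[OF N])
    finally have "K * 1 \<le> K * (16 * Q)" by (intro mult_left_mono) (auto simp: K_def)
    moreover have "(\<Sum>n=3..N. b n * g n) = (\<Sum>n=1..N. b n) * g N - (\<Sum>n=1..3-1. b n) * g 3 + (\<Sum>n=3..<N. (\<Sum>k=1..n. b k) * (g n - g (Suc n)))"
      using N by (intro summation_by_parts) auto
    moreover have "\<bar>(\<Sum>n=1..3-1. b n) * g 3\<bar> = K" by (simp add: K_def g_def)
    ultimately have "\<bar>(\<Sum>n=3..N. b n * g n) - (\<Sum>n=1..N. b n) * g N\<bar> \<le> K * (16 * Q) + 20 * (C * real (Suc j)) * Q"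
      using 1 by linarith
    also have "\<dots> \<le> (16 * K + 20 * (C * real (Suc j)) + 1) * Q" using Q by (simp add: algebra_simps)
    finally show "\<bar>(\<Sum>n=3..N. b n / ln (real n) ^ Suc j) - (\<Sum>n=1..N. b n) / ln (real N) ^ Suc j\<bar> \<le> (16 * K + 20 * (C * real (Suc j)) + 1) * (real N / ln (real N) ^ 2)"
      by (simp add: g_def Q_def)
  qed
qed

section \<open>The summatory function of \<Lambda>\<close>

lemma psi_bound:
  obtains C where "C > 0" "\<And>N. N \<ge> 3 \<Longrightarrow> \<bar>(\<Sum>n=1..N. mangoldt n) - real N\<bar> \<le> C * (real N / ln (real N))"
proof -
  obtain C where C: "C > 0" 
    "\<And>x. x \<ge> 3 \<Longrightarrow> \<bar>\<Sum>n=1..x. ln (real n) ^ 3 * (mangoldt n - 1)\<bar> \<le> C * (real x * ln (real x) ^ 2)"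
    using sum_ln3_mangoldt_bound by blast
  obtain D where D: "D > 0" "\<And>N. N \<ge> 3 \<Longrightarrow> 
      \<bar>(\<Sum>n=3..N. ln (real n) ^ 3 * (mangoldt n - 1) / ln (real n) ^ Suc 2) - (\<Sum>n=1..N. ln (real n) ^ 3 * (mangoldt n - 1)) / ln (real N) ^ Suc 2\<bar> 
       \<le> D * (real N / ln (real N) ^ 2)"
    using partial_summation_ln_power[OF C(2)] by blast
  define K where "K = \<bar>mangoldt 2 - 2 :: real\<bar>"
  show ?thesis
  proof (rule that[of "C + D + 16 * K"])
    show "C + D + 16 * K > 0" using C D by (simp add: K_def add_pos_nonneg)
    fix N :: nat assume N: "N \<ge> 3"
    define L where "L = ln (real N)"
    have L: "L \<ge> 1" unfolding L_def by (rule ln_ge_1[OF N])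
    \<comment> \<open>The indices 1 and 2 contribute -1 and \<Lambda>(2) - 1; they are split off as
      the weighted sums start at 3.\<close>
    have N3: "(\<Sum>n=1..N. mangoldt n - 1 :: real) = (mangoldt 2 - 2) + (\<Sum>n=3..N. mangoldt n - 1)"
    proof -
      have "{1..N} = {1,2} \<union> {3..N}" using N by auto
      thus ?thesis by (simp add: sum.union_disjoint)
    qed
    have "(\<Sum>n=3..N. ln (real n) ^ 3 * (mangoldt n - 1) / ln (real n) ^ Suc 2) = (\<Sum>n=3..N. mangoldt n - 1)"
    proof (rule sum.cong)
      fix n assume "n \<in> {3..N}"
      hence "ln (real n) \<ge> 1" by (intro ln_ge_1) auto
      thus "ln (real n) ^ 3 * (mangoldt n - 1) / ln (real n) ^ Suc 2 = mangoldt n - 1" by (simp add: eval_nat_numeral)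
    qed auto
    with D(2)[OF N] have 1: "\<bar>(\<Sum>n=3..N. mangoldt n - 1) - (\<Sum>n=1..N. ln (real n) ^ 3 * (mangoldt n - 1)) / L ^ 3\<bar> \<le> D * (real N / L ^ 2)"
      by (simp add: L_def eval_nat_numeral)
    have 2: "\<bar>(\<Sum>n=1..N. ln (real n) ^ 3 * (mangoldt n - 1)) / L ^ 3\<bar> \<le> C * (real N / L)"
    proof -
      have "\<bar>(\<Sum>n=1..N. ln (real n) ^ 3 * (mangoldt n - 1)) / L ^ 3\<bar> = \<bar>\<Sum>n=1..N. ln (real n) ^ 3 * (mangoldt n - 1)\<bar> / L ^ 3"
        using L by simp
      also have "\<dots> \<le> C * (real N * L ^ 2) / L ^ 3"
        unfolding L_def using L N by (intro divide_right_mono C(2)) (auto simp: L_def)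
      also have "\<dots> = C * (real N / L)" using L by (simp add: field_simps eval_nat_numeral)
      finally show ?thesis .
    qed
    have 3: "real N / L ^ 2 \<le> real N / L" using L self_le_power[of L 2] by (intro divide_left_mono) auto
    have "1 \<le> sqrt (real N)" using N by simp
    also have "\<dots> \<le> 16 * (real N / L ^ 2)" unfolding L_def by (rule sqrt_le_div_ln2[OF N])
    also have "\<dots> \<le> 16 * (real N / L)" using 3 by simp
    finally have 4: "K * 1 \<le> K * (16 * (real N / L))" by (intro mult_left_mono) (auto simp: K_def)
    have 5: "D * (real N / L ^ 2) \<le> D * (real N / L)" using D 3 by (intro mult_left_mono) auto
    have "\<bar>(\<Sum>n=1..N. mangoldt n - 1 :: real)\<bar> \<le> K + (C * (real N / L) + D * (real N / L))"
      unfolding N3 K_def using 1 2 5 by linarith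
    also have "\<dots> \<le> (C + D + 16 * K) * (real N / L)" using 4 by (simp add: algebra_simps)
    also have "(\<Sum>n=1..N. mangoldt n - 1 :: real) = (\<Sum>n=1..N. mangoldt n) - real N" by (simp add: sum_subtractf)
    finally show "\<bar>(\<Sum>n=1..N. mangoldt n) - real N\<bar> \<le> (C + D + 16 * K) * (real N / ln (real N))" by (simp add: L_def)
  qed
qed

section \<open>From prime powers to primes\<close>

definition prime_count :: "nat \<Rightarrow> nat" where
  "prime_count N = card {p. prime p \<and> p \<le> N}"

text \<open>Such a number is p^k with k \<ge> 2, so p is at most sqrt N, and 2^k \<le> N leaves at
  most 2 ln N exponents.\<close>

lemma card_proper_prime_powers:
  assumes N: "N \<ge> 3"
  shows "real (card {n \<in> {3..N}. primepow n \<and> \<not> prime n}) \<le> 432 * (real N / ln (real N) ^ 2)"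
proof -
  define A where "A = {n \<in> {1..N}. real n \<le> sqrt (real N)}"
  define B where "B = {1..nat \<lfloor>2 * ln (real N)\<rfloor>}"
  have L: "ln (real N) \<ge> 1" by (rule ln_ge_1[OF N])
  have "{n \<in> {3..N}. primepow n \<and> \<not> prime n} \<subseteq> (\<lambda>(p,k). p ^ k) ` (A \<times> B)"
  proof
    fix n assume "n \<in> {n \<in> {3..N}. primepow n \<and> \<not> prime n}"
    hence n: "n \<le> N" "primepow n" "\<not> prime n" by auto
    then obtain p k where pk: "prime p" "k > 0" "n = p ^ k" by (auto simp: primepow_def)
    have "k \<noteq> 1" using n(3) pk by auto
    hence k: "k \<ge> 2" using pk by linarith
    have p: "p \<ge> 2" using pk(1) by (rule prime_ge_2_nat)
    have "p ^ 2 \<le> p ^ k" using k p by (intro power_increasing) auto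
    hence "p ^ 2 \<le> N" using n pk by linarith
    hence "real p ^ 2 \<le> real N" by (metis of_nat_le_iff of_nat_power)
    hence ps: "real p \<le> sqrt (real N)" by (rule real_le_rsqrt)
    have "p \<le> p ^ k" using p pk by (intro self_le_power) auto
    hence "p \<in> A" using ps p n pk by (auto simp: A_def)
    have "2 ^ k \<le> p ^ k" using p by (intro power_mono) auto
    hence "2 ^ k \<le> N" using n pk by linarith
    hence "2 ^ k \<le> real N" by (metis of_nat_le_iff of_nat_numeral of_nat_power)
    hence "ln (2 ^ k) \<le> ln (real N)" using N by (subst ln_le_cancel_iff) auto
    hence "real k * ln 2 \<le> ln (real N)" by (simp add: ln_realpow)
    moreover have "1 / 2 \<le> ln (2::real)" using ln2_ge_two_thirds by simp
    hence "real k * (1 / 2) \<le> real k * ln 2" by (intro mult_left_mono) auto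
    ultimately have "real k \<le> 2 * ln (real N)" by linarith
    hence "k \<in> B" using k by (auto simp: B_def le_nat_floor)
    show "n \<in> (\<lambda>(p,k). p ^ k) ` (A \<times> B)" using \<open>p \<in> A\<close> \<open>k \<in> B\<close> pk by auto
  qed
  moreover have fin: "finite A" "finite B" by (auto simp: A_def B_def)
  ultimately have "card {n \<in> {3..N}. primepow n \<and> \<not> prime n} \<le> card (A \<times> B)"
    by (meson card_image_le card_mono finite_SigmaI finite_imageI le_trans)
  hence "real (card {n \<in> {3..N}. primepow n \<and> \<not> prime n}) \<le> real (card A) * real (card B)"
    by (metis card_cartesian_product of_nat_le_iff of_nat_mult)
  also have "\<dots> \<le> sqrt (real N) * (2 * ln (real N))"
  proof (intro mult_mono)
    show "real (card A) \<le> sqrt (real N)" unfolding A_def by (rule card_le_sqrt)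
    show "real (card B) \<le> 2 * ln (real N)" unfolding B_def using L by simp
  qed auto
  also have "\<dots> \<le> 432 * (real N / ln (real N) ^ 2)"
  proof -
    have "sqrt (real N) * (2 * ln (real N)) * ln (real N) ^ 2 = 2 * sqrt (real N) * ln (real N) ^ 3"
      by (simp add: eval_nat_numeral)
    also have "\<dots> \<le> 2 * sqrt (real N) * (216 * sqrt (real N))"
      using N by (intro mult_left_mono ln_power_le_sqrt) auto
    also have "\<dots> = 432 * real N" by simp
    finally show ?thesis using L by (simp add: field_simps)
  qed
  finally show ?thesis .
qed

text \<open>The weight \<Lambda>(n) / ln n is 1 at primes and at most 1 at the few proper prime
  powers, so its sum counts primes; partial summation compares this sum with the summatory function
  of \<Lambda> divided by ln N.\<close>

lemma prime_count_bound:
  obtains C where "C > 0" "\<And>N. N \<ge> 3 \<Longrightarrow> \<bar>real (prime_count N) - real N / ln (real N)\<bar> \<le> C * (real N / ln (real N) ^ 2)"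
proof -
  obtain C where C: "C > 0" "\<And>N. N \<ge> 3 \<Longrightarrow> \<bar>(\<Sum>n=1..N. mangoldt n) - real N\<bar> \<le> C * (real N / ln (real N))"
    using psi_bound by blast
  have C': "\<bar>\<Sum>n=1..N. mangoldt n\<bar> \<le> (C + 1) * (real N * ln (real N) ^ 0)" if N: "N \<ge> 3" for N
  proof -
    have "C * (real N / ln (real N)) \<le> C * (real N / 1)"
      using C ln_ge_1[OF N] by (intro mult_left_mono divide_left_mono) auto
    thus ?thesis using C(2)[OF N] by (simp add: algebra_simps)
  qed
  obtain D where D: "D > 0" "\<And>N. N \<ge> 3 \<Longrightarrow> 
      \<bar>(\<Sum>n=3..N. mangoldt n / ln (real n) ^ Suc 0) - (\<Sum>n=1..N. mangoldt n) / ln (real N) ^ Suc 0\<bar> \<le> D * (real N / ln (real N) ^ 2)"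
    using partial_summation_ln_power[OF C'] by blast
  show ?thesis
  proof (rule that[of "C + D + 432 + 16"])
    show "C + D + 432 + 16 > 0" using C D by simp
    fix N :: nat assume N: "N \<ge> 3"
    define L where "L = ln (real N)"
    define Q where "Q = real N / L ^ 2"
    have L: "L \<ge> 1" unfolding L_def by (rule ln_ge_1[OF N])
    have 1: "\<bar>(\<Sum>n=3..N. mangoldt n / ln (real n)) - (\<Sum>n=1..N. mangoldt n) / L\<bar> \<le> D * Q"
      using D(2)[OF N] by (simp add: L_def Q_def)
    have "\<bar>((\<Sum>n=1..N. mangoldt n) - real N) / L\<bar> = \<bar>(\<Sum>n=1..N. mangoldt n) - real N\<bar> / L"
      using L by simp
    also have "\<dots> \<le> C * (real N / L) / L"
      using C(2)[OF N] L unfolding L_def by (intro divide_right_mono) auto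
    finally have "\<bar>((\<Sum>n=1..N. mangoldt n) - real N) / L\<bar> \<le> C * (real N / L) / L" .
    hence 2: "\<bar>(\<Sum>n=1..N. mangoldt n) / L - real N / L\<bar> \<le> C * Q"
      by (simp add: diff_divide_distrib Q_def power2_eq_square)
    define P where "P = {n \<in> {3..N}. prime n}"
    define R where "R = {n \<in> {3..N}. primepow n \<and> \<not> prime n}"
    have "(\<Sum>n=3..N. mangoldt n / ln (real n)) = (\<Sum>n\<in>P \<union> R. mangoldt n / ln (real n))"
      by (rule sum.mono_neutral_right) (auto simp: P_def R_def mangoldt_def primepow_prime)
    also have "\<dots> = (\<Sum>n\<in>P. mangoldt n / ln (real n)) + (\<Sum>n\<in>R. mangoldt n / ln (real n))"
      by (rule sum.union_disjoint) (auto simp: P_def R_def)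
    also have "(\<Sum>n\<in>P. mangoldt n / ln (real n)) = (\<Sum>n\<in>P. 1)"
    proof (rule sum.cong)
      fix n assume "n \<in> P"
      hence "prime n" "ln (real n) \<ge> 1" by (auto simp: P_def intro: ln_ge_1)
      thus "mangoldt n / ln (real n) = (1::real)" by simp
    qed auto
    also have "\<dots> = real (card P)" by simp
    finally have 3: "(\<Sum>n=3..N. mangoldt n / ln (real n)) = real (card P) + (\<Sum>n\<in>R. mangoldt n / ln (real n))" .
    \<comment> \<open>The sums start at 3, so the prime 2 has to be added.\<close>
    have "{p. prime p \<and> p \<le> N} = insert 2 P" using N by (auto simp: P_def not_less_eq_eq dest: prime_ge_2_nat intro: antisym)
    hence 4: "real (prime_count N) = real (card P) + 1" by (simp add: prime_count_def P_def)
    have "(\<Sum>n\<in>R. mangoldt n / ln (real n)) \<le> (\<Sum>n\<in>R. 1)"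
      by (intro sum_mono) (use mangoldt_le_ln in \<open>auto simp: R_def divide_le_eq_1\<close>)
    also have "\<dots> \<le> 432 * Q" using card_proper_prime_powers[OF N] by (simp add: R_def Q_def L_def)
    finally have 5: "(\<Sum>n\<in>R. mangoldt n / ln (real n)) \<le> 432 * Q" .
    have 6: "(\<Sum>n\<in>R. mangoldt n / ln (real n)) \<ge> 0" by (intro sum_nonneg mangoldt_div_ln_nonneg)
    have "1 \<le> sqrt (real N)" using N by simp
    also have "\<dots> \<le> 16 * Q" unfolding L_def Q_def by (rule sqrt_le_div_ln2[OF N])
    finally have 7: "1 \<le> 16 * Q" .
    have "\<bar>real (prime_count N) - real N / L\<bar> \<le> D * Q + C * Q + 432 * Q + 16 * Q"
      using 1 2 3 4 5 6 7 by linarith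
    thus "\<bar>real (prime_count N) - real N / ln (real N)\<bar> \<le> (C + D + 432 + 16) * (real N / ln (real N) ^ 2)"
      by (simp add: Q_def L_def algebra_simps)
  qed
qed

subsection \<open>Counting Lemoine--Levy partitions\<close>

lemma finite_primes_le: "finite {p::nat. prime p \<and> p \<le> N}"
  by (rule finite_subset[of _ "{..N}"]) auto

lemma prime_count_mono: "m \<le> n \<Longrightarrow> prime_count m \<le> prime_count n"
  unfolding prime_count_def by (intro card_mono finite_primes_le) auto

lemma prime_count_le: "prime_count n \<le> n"
proof -
  have "card {p. prime p \<and> p \<le> n} \<le> card {1..n}"
    by (intro card_mono) (auto dest: prime_ge_1_nat)
  thus ?thesis by (simp add: prime_count_def)
qed

text \<open>The origin of ln ln x. For y \<ge> x / ln x, the logarithms of y and x differ by at most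
  ln ln x. For smaller y, both terms are small: \<pi>(y) is at most its value at the rounded-up x /
  ln x, to which the first case applies.\<close>

lemma prime_count_uniform:
  obtains C N where "C > 0" "\<And>x y. x \<ge> N \<Longrightarrow> y \<le> x \<Longrightarrow>
    \<bar>real (prime_count y) - real y / ln (real x)\<bar> \<le> C * (real x * ln (ln (real x)) / ln (real x) ^ 2)"
proof -
  obtain C where C: "C > 0" "\<And>N. N \<ge> 3 \<Longrightarrow> \<bar>real (prime_count N) - real N / ln (real N)\<bar> \<le> C * (real N / ln (real N) ^ 2)"
    using prime_count_bound by blast
  \<comment> \<open>In the notation below: K \<ge> 1 gives x / L^2 \<le> E, K \<le> L / 2 gives ln y
    \<ge> L / 2, x / L \<ge> 3 admits \<open>prime_count_bound\<close>, and the last inequality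
    leaves room for rounding x / L up.\<close>
  have "eventually (\<lambda>x::nat. ln (ln (real x)) \<ge> 1 \<and> ln (ln (real x)) \<le> ln (real x) / 2 \<and> ln (real x) \<ge> 1
      \<and> real x / ln (real x) \<ge> 3 \<and> real x / ln (real x) + 1 \<le> real x) sequentially"
    by (intro eventually_conj; real_asymp)
  then obtain N where N: "\<And>x. x \<ge> N \<Longrightarrow> ln (ln (real x)) \<ge> 1 \<and> ln (ln (real x)) \<le> ln (real x) / 2 \<and> ln (real x) \<ge> 1
      \<and> real x / ln (real x) \<ge> 3 \<and> real x / ln (real x) + 1 \<le> real x"
    unfolding eventually_sequentially by blast
  show ?thesis
  proof (rule that[of "4 * C + 4" N])
    show "4 * C + 4 > 0" using C by simp
    fix x y :: nat assume x: "x \<ge> N" and y: "y \<le> x"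
    define L where "L = ln (real x)"
    define K where "K = ln L"
    define E where "E = real x * K / L ^ 2"
    have L: "K \<ge> 1" "K \<le> L / 2" "L \<ge> 1" "real x / L \<ge> 3" "real x / L + 1 \<le> real x"
      using N[OF x] by (simp_all add: L_def K_def)
    have x0: "real x > 0" using L by linarith
    have E1: "real x / L ^ 2 \<le> E" 
      unfolding E_def using L x0 by (intro divide_right_mono) auto
    have big: "\<bar>real (prime_count y) - real y / L\<bar> \<le> (4 * C + 2) * E" if y: "y \<le> x" "real y \<ge> real x / L" for y
    proof -
      have y3: "y \<ge> 3" using y(2) L by linarith
      have "L - K = ln (real x / L)" using x0 L by (simp add: ln_div L_def K_def)
      also have "\<dots> \<le> ln (real y)" using y y3 L x0 by (subst ln_le_cancel_iff) auto
      finally have ly: "L - ln (real y) \<le> K" "ln (real y) \<ge> L / 2" using L by auto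
      have ly': "ln (real y) \<le> L" unfolding L_def using y y3 by (subst ln_le_cancel_iff) auto
      have "\<bar>real (prime_count y) - real y / ln (real y)\<bar> \<le> C * (real y / ln (real y) ^ 2)" by (rule C(2)[OF y3])
      also have "\<dots> \<le> C * (real x / (L / 2) ^ 2)"
        using C L ly y by (intro mult_left_mono frac_le power_mono zero_less_power) auto
      also have "\<dots> = 4 * C * (real x / L ^ 2)" by (simp add: power_divide)
      also have "\<dots> \<le> 4 * C * E" using C E1 by (intro mult_left_mono) auto
      finally have 1: "\<bar>real (prime_count y) - real y / ln (real y)\<bar> \<le> 4 * C * E" .
      have "real y / ln (real y) - real y / L = real y * (L - ln (real y)) / (ln (real y) * L)"
        using L ly by (simp add: field_simps)
      hence "\<bar>real y / ln (real y) - real y / L\<bar> = \<bar>real y * (L - ln (real y)) / (ln (real y) * L)\<bar>" by simp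
      also have "\<dots> = real y * (L - ln (real y)) / (ln (real y) * L)"
        using L ly ly' by (intro abs_of_nonneg divide_nonneg_nonneg mult_nonneg_nonneg) auto
      also have "\<dots> \<le> real x * K / (L / 2 * L)"
        using L ly ly' y by (intro frac_le mult_mono mult_right_mono) auto
      also have "\<dots> = 2 * E" by (simp add: E_def power2_eq_square)
      finally have "\<bar>real y / ln (real y) - real y / L\<bar> \<le> 2 * E" .
      hence "\<bar>real (prime_count y) - real y / L\<bar> \<le> 4 * C * E + 2 * E" using 1 by linarith
      thus ?thesis by (simp add: algebra_simps)
    qed
    have E0: "E \<ge> 0" unfolding E_def using L by auto
    show "\<bar>real (prime_count y) - real y / ln (real x)\<bar> \<le> (4 * C + 4) * (real x * ln (ln (real x)) / ln (real x) ^ 2)"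
    proof (cases "real y \<ge> real x / L")
      case True
      have "(4 * C + 2) * E \<le> (4 * C + 4) * E" using E0 by (intro mult_right_mono) auto
      thus ?thesis using big[OF y True] by (simp add: E_def L_def K_def)
    next
      case False
      define z where "z = nat \<lceil>real x / L\<rceil>"
      have z0: "real z \<ge> real x / L" "real z \<le> real x / L + 1" using L unfolding z_def by linarith+
      have z: "real z \<ge> real x / L" "z \<le> x" "real z \<le> 2 * (real x / L)" "y \<le> z"
      proof -
        show "real z \<ge> real x / L" by fact
        have "real z \<le> real x" using z0 L by linarith
        thus "z \<le> x" by simp
        show "real z \<le> 2 * (real x / L)" using z0 L by linarith
        have "real y \<le> real z" using False z0 by linarith
        thus "y \<le> z" by simp
      qed
      have "real (prime_count y) \<le> real (prime_count z)" using prime_count_mono[OF z(4)] by simp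
      moreover have "real z / L \<le> 2 * (real x / L) / L" using z L by (intro divide_right_mono) auto
      moreover have "2 * (real x / L) / L = 2 * (real x / L ^ 2)" by (simp add: power2_eq_square)
      moreover have "\<bar>real (prime_count z) - real z / L\<bar> \<le> (4 * C + 2) * E" by (rule big[OF z(2,1)])
      ultimately have "real (prime_count y) \<le> 2 * E + (4 * C + 2) * E" using E1 by linarith
      hence 1: "real (prime_count y) \<le> (4 * C + 4) * E" by (simp add: algebra_simps)
      have "real y / L \<le> (real x / L) / L" using False L by (intro divide_right_mono) auto
      also have "\<dots> = real x / L ^ 2" by (simp add: power2_eq_square)
      also have "\<dots> \<le> E" by (rule E1)
      also have "\<dots> \<le> (4 * C + 4) * E" using mult_right_mono[OF _ E0, of 1 "4 * C + 4"] C by simp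
      finally have 2: "real y / L \<le> (4 * C + 4) * E" .
      have "real y / L \<ge> 0" using L by simp
      hence "\<bar>real (prime_count y) - real y / L\<bar> \<le> (4 * C + 4) * E" using 1 2 by linarith
      thus ?thesis by (simp add: E_def L_def K_def)
    qed
  qed
qed

text \<open>Partitions of different numbers are different pairs, so the sum counts all pairs with p
  + 2q odd and at most x; the parity of the sum is that of p. As q \<le> M, the subtraction x - 2q
  never truncates.\<close>

lemma sum_lemoine_levy:
  assumes x: "x = 2 * M + 1"
  shows "(\<Sum>i = 1..(x + 1) div 2. lemoine_levy (2 * i - 1)) =
     (\<Sum>q | prime q \<and> q \<le> M. card {p. prime p \<and> odd p \<and> p \<le> x - 2 * q})"
proof -
  define A where "A = (\<lambda>i. {(p::nat, q::nat). prime p \<and> prime q \<and> 2 * i - 1 = p + 2 * q})"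
  define S where "S = Sigma {q. prime q \<and> q \<le> M} (\<lambda>q. {p. prime p \<and> odd p \<and> p \<le> x - 2 * q})"
  have "(\<Sum>i = 1..(x + 1) div 2. lemoine_levy (2 * i - 1)) = (\<Sum>i = 1..M + 1. card (A i))"
    using x by (simp add: lemoine_levy_def A_def)
  also have "\<dots> = card (\<Union>i\<in>{1..M + 1}. A i)"
  proof (rule card_UN_disjoint[symmetric])
    show "\<forall>i\<in>{1..M + 1}. finite (A i)"
    proof
      fix i
      show "finite (A i)" by (rule finite_subset[of _ "{..2 * i} \<times> {..2 * i}"]) (auto simp: A_def)
    qed
    show "\<forall>i\<in>{1..M + 1}. \<forall>j\<in>{1..M + 1}. i \<noteq> j \<longrightarrow> A i \<inter> A j = {}"
      by (auto simp: A_def)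
  qed auto
  also have "(\<Union>i\<in>{1..M + 1}. A i) = prod.swap ` S"
  proof (intro set_eqI iffI)
    fix z assume "z \<in> (\<Union>i\<in>{1..M + 1}. A i)"
    then obtain i p q where z: "z = (p, q)" "i \<in> {1..M + 1}" "prime p" "prime q" "2 * i - 1 = p + 2 * q"
      by (auto simp: A_def)
    have "p + 2 * q + 1 = 2 * i" using z by auto
    hence "even (p + 2 * q + 1)" by simp
    hence "odd p" by simp
    moreover have "p + 2 * q \<le> x" using z x by auto
    ultimately have "(q, p) \<in> S" using z(3,4) x by (auto simp: S_def)
    thus "z \<in> prod.swap ` S" using z(1) by force
  next
    fix z assume "z \<in> prod.swap ` S"
    then obtain p q where z: "z = (p, q)" "prime q" "q \<le> M" "prime p" "odd p" "p \<le> x - 2 * q"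
      by (auto simp: S_def)
    from \<open>odd p\<close> obtain k where k: "p = 2 * k + 1" by (auto elim: oddE)
    have "k + q + 1 \<in> {1..M + 1}" using z x k by auto
    moreover have "z \<in> A (k + q + 1)" using z k by (auto simp: A_def)
    ultimately show "z \<in> (\<Union>i\<in>{1..M + 1}. A i)" by blast
  qed
  also have "card (prod.swap ` S) = card S" by (rule card_image) simp
  also have "card S = (\<Sum>q | prime q \<and> q \<le> M. card {p. prime p \<and> odd p \<and> p \<le> x - 2 * q})"
    unfolding S_def
  proof (rule card_SigmaI)
    show "\<forall>q\<in>{q. prime q \<and> q \<le> M}. finite {p. prime p \<and> odd p \<and> p \<le> x - 2 * q}"
      by (auto intro: finite_subset[OF _ finite_primes_le])
  qed (rule finite_primes_le)
  finally show ?thesis .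
qed

lemma card_odd_primes:
  "\<bar>real (card {p. prime p \<and> odd p \<and> p \<le> m}) - real (prime_count m)\<bar> \<le> 1"
proof -
  have "{p. prime p \<and> odd p \<and> p \<le> m} \<subseteq> {p. prime p \<and> p \<le> m}" by auto
  hence "card {p. prime p \<and> odd p \<and> p \<le> m} \<le> prime_count m"
    unfolding prime_count_def by (intro card_mono finite_primes_le)
  moreover have "{p. prime p \<and> p \<le> m} \<subseteq> insert 2 {p. prime p \<and> odd p \<and> p \<le> m}"
    using primes_dvd_imp_eq[OF two_is_prime_nat] by auto
  hence "prime_count m \<le> card (insert 2 {p. prime p \<and> odd p \<and> p \<le> m})"
    unfolding prime_count_def
    by (intro card_mono finite.insertI) (auto intro: finite_subset[OF _ finite_primes_le])
  hence "prime_count m \<le> card {p. prime p \<and> odd p \<and> p \<le> m} + 1"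
    using finite_subset[OF _ finite_primes_le, of "{p. prime p \<and> odd p \<and> p \<le> m}" m] by (subst (asm) card_insert_disjoint) auto
  ultimately show ?thesis by linarith
qed

text \<open>M - q counts the j with q \<le> j < M; swapping the sums counts primes up to each j.
  This turns a sum over primes into one of \<pi>, to which the uniform estimate applies a second
  time.\<close>

lemma sum_primes_diff:
  "(\<Sum>q | prime q \<and> q \<le> M. M - q) = (\<Sum>j<M. prime_count j)"
proof -
  have "(\<Sum>q | prime q \<and> q \<le> M. M - q) = (\<Sum>q | prime q \<and> q \<le> M. \<Sum>j<M. if q \<le> j then 1 else 0)"
  proof (rule sum.cong)
    fix q
    have "(\<Sum>j<M. if q \<le> j then 1 else (0::nat)) = card {j \<in> {..<M}. q \<le> j}"
      by (subst sum.inter_filter[symmetric]) auto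
    also have "{j \<in> {..<M}. q \<le> j} = {q..<M}" by auto
    finally show "M - q = (\<Sum>j<M. if q \<le> j then 1 else 0)" by simp
  qed auto
  also have "\<dots> = (\<Sum>j<M. \<Sum>q | prime q \<and> q \<le> M. if q \<le> j then 1 else 0)" by (rule sum.swap)
  also have "\<dots> = (\<Sum>j<M. prime_count j)"
  proof (rule sum.cong)
    fix j assume j: "j \<in> {..<M}"
    have "(\<Sum>q | prime q \<and> q \<le> M. if q \<le> j then 1 else (0::nat)) = card {q \<in> {q. prime q \<and> q \<le> M}. q \<le> j}"
      by (subst sum.inter_filter[symmetric]) (auto simp: finite_primes_le)
    also have "{q \<in> {q. prime q \<and> q \<le> M}. q \<le> j} = {q. prime q \<and> q \<le> j}" using j by auto
    finally show "(\<Sum>q | prime q \<and> q \<le> M. if q \<le> j then 1 else 0) = prime_count j"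
      by (simp add: prime_count_def)
  qed auto
  finally show ?thesis .
qed

theorem theorem3:
  shows "\<exists>C N. \<forall>x::nat. x \<ge> N \<and> odd x \<longrightarrow>
     \<bar>real (\<Sum>i = 1..(x + 1) div 2. lemoine_levy (2 * i - 1))
        - (real x)\<^sup>2 / (4 * (ln (real x))\<^sup>2)\<bar>
     \<le> C * ((real x)\<^sup>2 * ln (ln (real x)) / (ln (real x)) ^ 3)"
proof -
  obtain C N1 where C: "C > 0" "\<And>x y. x \<ge> N1 \<Longrightarrow> y \<le> x \<Longrightarrow>
    \<bar>real (prime_count y) - real y / ln (real x)\<bar> \<le> C * (real x * ln (ln (real x)) / ln (real x) ^ 2)"
    using prime_count_uniform by blast
  \<comment> \<open>The last inequality lets the target error absorb every term of size
    O(x).\<close>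
  have "eventually (\<lambda>x::nat. ln (real x) \<ge> 1 \<and> ln (ln (real x)) \<ge> 0 \<and> ln (ln (real x)) \<le> ln (real x) \<and>
      real x \<le> (real x)\<^sup>2 * ln (ln (real x)) / (ln (real x)) ^ 3) sequentially"
    by (intro eventually_conj; real_asymp)
  then obtain N2 where N2: "\<And>x. x \<ge> N2 \<Longrightarrow> ln (real x) \<ge> 1 \<and> ln (ln (real x)) \<ge> 0 \<and> ln (ln (real x)) \<le> ln (real x) \<and>
      real x \<le> (real x)\<^sup>2 * ln (ln (real x)) / (ln (real x)) ^ 3"
    unfolding eventually_sequentially by blast
  show ?thesis
  \<comment> \<open>The 3 collects the odd-prime correction, the summand 1 in x - 2q = 1 + 2 (M -
    q), and the passage from M (M - 1) to x^2 / 4; the terms (1 + C) C and C come from the two uses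
    of the uniform estimate.\<close>
  proof (rule exI[of _ "3 + (1 + C) * C + C"], rule exI[of _ "max N1 N2"], intro allI impI)
    fix x :: nat assume "x \<ge> max N1 N2 \<and> odd x"
    hence x: "x \<ge> N1" "x \<ge> N2" and "odd x" by auto
    then obtain M where M: "x = 2 * M + 1" by (auto elim: oddE)
    define L where "L = ln (real x)"
    define E where "E = C * (real x * ln L / L ^ 2)"
    define R where "R = (real x)\<^sup>2 * ln L / L ^ 3"
    define Q where "Q = {q. prime q \<and> q \<le> M}"
    have L: "L \<ge> 1" "ln L \<ge> 0" "ln L \<le> L" "real x \<le> R" using N2[OF x(2)] by (auto simp: L_def R_def)
    have U: "\<bar>real (prime_count y) - real y / L\<bar> \<le> E" if "y \<le> x" for y
      using C(2)[OF x(1) that] by (simp add: L_def E_def)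
    have E0: "E \<ge> 0" unfolding E_def using C L by auto
    have ER: "real x * (E / L) = C * R" using L by (simp add: E_def R_def field_simps eval_nat_numeral)
    have cardQ: "card Q = prime_count M" by (simp add: Q_def prime_count_def)
    define S where "S = (\<Sum>i = 1..(x + 1) div 2. lemoine_levy (2 * i - 1))"
    have S: "S = (\<Sum>q\<in>Q. card {p. prime p \<and> odd p \<and> p \<le> x - 2 * q})"
      unfolding S_def Q_def by (rule sum_lemoine_levy[OF M])
    have Mx: "2 * real M \<le> real x" using M by simp
    have pcM: "real (prime_count M) \<le> real x" 
    proof -
      have "prime_count M \<le> x" using prime_count_le[of M] M by linarith
      thus ?thesis by simp
    qed
    have "\<bar>real S - (\<Sum>q\<in>Q. real (prime_count (x - 2 * q)))\<bar> = \<bar>\<Sum>q\<in>Q. real (card {p. prime p \<and> odd p \<and> p \<le> x - 2 * q}) - real (prime_count (x - 2 * q))\<bar>"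
      unfolding S by (simp add: sum_subtractf)
    also have "\<dots> \<le> (\<Sum>q\<in>Q. 1)"
      by (intro order_trans[OF sum_abs] sum_mono card_odd_primes)
    also have "\<dots> \<le> R" using cardQ pcM L by simp
    finally have 1: "\<bar>real S - (\<Sum>q\<in>Q. real (prime_count (x - 2 * q)))\<bar> \<le> R" .
    have "\<bar>(\<Sum>q\<in>Q. real (prime_count (x - 2 * q))) - (\<Sum>q\<in>Q. real (x - 2 * q) / L)\<bar> = \<bar>\<Sum>q\<in>Q. real (prime_count (x - 2 * q)) - real (x - 2 * q) / L\<bar>"
      by (simp add: sum_subtractf)
    also have "\<dots> \<le> (\<Sum>q\<in>Q. E)"
      by (intro order_trans[OF sum_abs] sum_mono U) auto
    also have "\<dots> = real (prime_count M) * E" by (simp add: cardQ)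
    \<comment> \<open>The number of q must be estimated as O(x / L): the trivial bound by x would
      lose a logarithm.\<close>
    also have "\<dots> \<le> ((1 + C) * (real x / L)) * E"
    proof (intro mult_right_mono E0)
      have "real (prime_count M) \<le> real M / L + E" using U[of M] M by auto
      also have "real M / L \<le> real x / L" using Mx L by (intro divide_right_mono) auto
      also have "E \<le> C * (real x * L / L ^ 2)"
        unfolding E_def using C L by (intro mult_left_mono divide_right_mono) auto
      also have "\<dots> = C * (real x / L)" using L by (simp add: power2_eq_square)
      finally show "real (prime_count M) \<le> (1 + C) * (real x / L)" by (simp add: algebra_simps add_divide_distrib)
    qed
    also have "\<dots> = (1 + C) * (real x * (E / L))" by simp
    also have "\<dots> = (1 + C) * C * R" unfolding ER by simp
    finally have 2: "\<bar>(\<Sum>q\<in>Q. real (prime_count (x - 2 * q))) - (\<Sum>q\<in>Q. real (x - 2 * q) / L)\<bar> \<le> (1 + C) * C * R" .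
    have "(\<Sum>q\<in>Q. x - 2 * q) = (\<Sum>q\<in>Q. 1 + 2 * (M - q))"
      using M by (intro sum.cong) (auto simp: Q_def)
    also have "\<dots> = prime_count M + 2 * (\<Sum>j<M. prime_count j)"
      using sum_primes_diff[of M] cardQ
      unfolding sum.distrib sum_distrib_left[symmetric] Q_def[symmetric] by simp
    finally have "real (\<Sum>q\<in>Q. x - 2 * q) = real (prime_count M + 2 * (\<Sum>j<M. prime_count j))"
      by (rule arg_cong)
    hence "(\<Sum>q\<in>Q. real (x - 2 * q)) = real (prime_count M) + 2 * (\<Sum>j<M. real (prime_count j))"
      by (simp only: of_nat_add of_nat_mult of_nat_numeral of_nat_sum)
    hence 3: "(\<Sum>q\<in>Q. real (x - 2 * q) / L) = real (prime_count M) / L + 2 * (\<Sum>j<M. real (prime_count j)) / L"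
      by (simp add: sum_divide_distrib[symmetric] add_divide_distrib)
    have "real (prime_count M) / L \<le> real (prime_count M) / 1" using L by (intro divide_left_mono) auto
    hence 4: "\<bar>real (prime_count M) / L\<bar> \<le> R" using pcM L by simp
    have "\<bar>(\<Sum>j<M. real (prime_count j)) - (\<Sum>j<M. real j / L)\<bar> = \<bar>\<Sum>j<M. real (prime_count j) - real j / L\<bar>"
      by (simp add: sum_subtractf)
    also have "\<dots> \<le> (\<Sum>j<M. E)"
      using M by (intro order_trans[OF sum_abs] sum_mono U) auto
    also have "\<dots> = real M * E" by simp
    finally have "2 * \<bar>(\<Sum>j<M. real (prime_count j)) - (\<Sum>j<M. real j / L)\<bar> / L \<le> 2 * (real M * E) / L"
      using L by (intro divide_right_mono mult_left_mono) auto
    also have "\<dots> = (2 * real M) * (E / L)" by simp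
    also have "\<dots> \<le> real x * (E / L)" using Mx E0 L by (intro mult_right_mono) auto
    also note ER
    finally have "2 * \<bar>(\<Sum>j<M. real (prime_count j)) - (\<Sum>j<M. real j / L)\<bar> / L \<le> C * R" .
    moreover have "\<bar>2 * a / L - 2 * b / L\<bar> = 2 * \<bar>a - b\<bar> / L" for a b
    proof -
      have "2 * a / L - 2 * b / L = 2 * (a - b) / L" by (simp add: diff_divide_distrib right_diff_distrib)
      note eq = this
      show ?thesis unfolding eq abs_divide abs_mult using L by simp
    qed
    ultimately have 5: "\<bar>2 * (\<Sum>j<M. real (prime_count j)) / L - 2 * (\<Sum>j<M. real j / L) / L\<bar> \<le> C * R" by simp
    have "2 * (\<Sum>j<M. real j) = real M * (real M - 1)" by (induction M) (auto simp: algebra_simps)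
    hence 6: "2 * (\<Sum>j<M. real j / L) / L = real M * (real M - 1) / L ^ 2"
      by (simp add: sum_divide_distrib[symmetric] power2_eq_square)
    \<comment> \<open>As M = (x - 1) / 2, this product is (x - 1) (x - 3) / 4, the source of the
      factor 1/4.\<close>
    have "real M * (real M - 1) = (real x)\<^sup>2 / 4 - (real x - 3 / 4)"
      using M by (simp add: power2_eq_square field_simps)
    hence "real M * (real M - 1) / L ^ 2 - (real x)\<^sup>2 / (4 * L ^ 2) = - ((real x - 3 / 4) / L ^ 2)"
      by (simp add: diff_divide_distrib)
    hence "\<bar>real M * (real M - 1) / L ^ 2 - (real x)\<^sup>2 / (4 * L ^ 2)\<bar> = (real x - 3 / 4) / L ^ 2" using M by simp
    also have "\<dots> \<le> (real x - 3 / 4) / 1"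
      using L M by (intro divide_left_mono) (auto simp: one_le_power)
    also have "\<dots> \<le> R" using L by simp
    finally have 7: "\<bar>real M * (real M - 1) / L ^ 2 - (real x)\<^sup>2 / (4 * L ^ 2)\<bar> \<le> R" .
    have "\<bar>real S - (real x)\<^sup>2 / (4 * L ^ 2)\<bar> \<le> R + (1 + C) * C * R + R + C * R + R"
      using 1 2 4 5 7 unfolding 3 6 by linarith
    thus "\<bar>real (\<Sum>i = 1..(x + 1) div 2. lemoine_levy (2 * i - 1)) - (real x)\<^sup>2 / (4 * (ln (real x))\<^sup>2)\<bar>
     \<le> (3 + (1 + C) * C + C) * ((real x)\<^sup>2 * ln (ln (real x)) / (ln (real x)) ^ 3)"
      unfolding S_def[symmetric] L_def[symmetric] R_def[symmetric] by (simp add: algebra_simps)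
  qed
qed

end
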